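(* Suppose $K_1+k\le n_1+n_2$, $g(C)$ is a linear function of $C$, and $\delta_2=\rho\delta_1+e$ with $\delta_1$ independent of $e$. If the effect of the exposure variable $X$ on the outcome variable $Y$ is linear (i.e. $f(X)=aX$ for a constant $a$), then the point estimates from the control function method and the two-stage prediction method are identical. If the effect of $X$ on $Y$ is nonlinear (i.e. $f$ is a nonlinear function of $X$), then the control function method is more efficient than the two-stage prediction method.
   Context: Setting. One observes $n$ i.i.d. copies of $(Z,C,X,Y)$: $Z=(Z_1,\dots,Z_{n_1})$ instrumental variables, $C=(C_1,\dots,C_{n_2})$ observed covariates, $X$ a continuous real exposure, $Y$ a continuous real outcome; $U$ is an unobserved confounder. The model is $$X=\beta_{X0}+\beta_Z Z+\beta_C C+\delta_1,\qquad Y=\beta_{Y0}+f(X)+g(C)+\delta_2,$$ $$\delta_1=\beta_U U+\epsilon_X,\qquad \delta_2=h(U)+\epsilon_Y,$$ with $f(X)=\sum_{j=1}^{K_1}\theta_j f_j(X)$, $g(C)=\sum_{j=1}^{K_2}\gamma_j g_j(C)$, $K_1,K_2\ge1$, known basis functions $f_j,g_j$, and $h$ unrestricted; $k$ is the number of linear functions of $C$ among $g_1(C),\dots,g_{K_2}(C)$. The errors $\epsilon_X,\epsilon_Y$ have mean zero and are independent of each other and of $Z,C,U$. The instrument has a direct effect on $X$ ($\beta_Z\ne0$), $Z$ is independent of $U$, and $Z$ has no direct effect on $Y$. Also $C$ is independent of $Z$ and of $U$. The variables $1,f_1(X),\dots,f_{K_1}(X)$ are linearly independent, $1,g_1(C),\dots,g_{K_2}(C)$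 are linearly independent, and the instruments (resp. the covariates), if several, are linearly independent. Two-stage prediction method. First stage: for each $j$, fit the linear regression (with intercept) of $f_j(X)$ on $Z$ and $C$, with fitted values $\hat f_j(X)$. Second stage: least-squares regression of $Y$ on $1,\hat f_1(X),\dots,\hat f_{K_1}(X),g_1(C),\dots,g_{K_2}(C)$, giving estimates of $\beta_{Y0},\theta_1,\dots,\theta_{K_1},\gamma_1,\dots,\gamma_{K_2}$. Control function method. First stage: fit the linear regression (with intercept) of $X$ on $Z$ and $C$, with residuals $\hat\delta_1$. Second stage: least-squares regression of $Y$ on $1,f_1(X),\dots,f_{K_1}(X),g_1(C),\dots,g_{K_2}(C),\hat\delta_1$, giving estimates of $\beta_{Y0},\theta_1,\dots,\theta_{K_1},\gamma_1,\dots,\gamma_{K_2},\rho$. The comparison concerns the estimates of the parameters common to both methods. Under the hypotheses both methods give consistent, asymptotically normal estimates; "more efficient" means having the smaller asymptotic (co)variance of the $\sqrt n$-scaled estimation error.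
   Formalization: For nonlinear f, finite second moments and the rank condition are assumed; "more efficient" is strict only if Var δ2>0 and either δ1 charges all sets of positive length or some f_j(X) is not linear in (Z,C,X). Instruments, and covariates, are linearly independent jointly with 1. *)

theory Defs
  imports "HOL-Probability.Probability"
begin

text \<open>
  Every regression below contains an intercept, so a linear function is allowed a constant term.
  In particular functions of the form \<open>x \<mapsto> a * x\<close> and \<open>c \<mapsto> b \<bullet> c\<close> are covered.
\<close>

definition linear_function :: "('a::real_inner \<Rightarrow> real) \<Rightarrow> bool" where
  "linear_function h \<longleftrightarrow> (\<exists>a b. \<forall>x. h x = a + b \<bullet> x)"

text \<open>Linear independence of the components of a random vector, up to null sets.\<close>

definition linearly_independent_rv :: "'w measure \<Rightarrow> ('w \<Rightarrow> 'a::real_inner) \<Rightarrow> bool" where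
  "linearly_independent_rv M W \<longleftrightarrow> (\<forall>a. (AE \<omega> in M. a \<bullet> W \<omega> = 0) \<longrightarrow> a = 0)"

text \<open>
  Least-squares coefficients are a relation between data and coefficient vectors, because the
  minimiser is not unique when the regressors are collinear in the sample.
\<close>

definition least_squares ::
    "nat \<Rightarrow> (nat \<Rightarrow> 'a::real_inner) \<Rightarrow> (nat \<Rightarrow> real) \<Rightarrow> 'a \<Rightarrow> bool" where
  "least_squares n w y b \<longleftrightarrow> is_arg_min (\<lambda>b. \<Sum>i<n. (y i - b \<bullet> w i)\<^sup>2) (\<lambda>_. True) b"

text \<open>
  Coefficient vectors are nested pairs: (intercept, coefficients of the \<open>z\<close>'s, coefficients of
  the \<open>c\<close>'s) in the first stage, and (intercept, coefficients of the \<open>f j\<close>, coefficients of the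
  \<open>g j\<close>) in the second. The inner product of nested pairs is the sum of the inner products of
  the parts. First-stage coefficients need not be unique, but the fitted values are.
\<close>

definition two_stage_estimate ::
    "('k1::finite \<Rightarrow> real \<Rightarrow> real) \<Rightarrow> ('k2::finite \<Rightarrow> real^'n2 \<Rightarrow> real) \<Rightarrow>
     nat \<Rightarrow> (nat \<Rightarrow> real^'n1) \<Rightarrow> (nat \<Rightarrow> real^'n2) \<Rightarrow> (nat \<Rightarrow> real) \<Rightarrow> (nat \<Rightarrow> real) \<Rightarrow>
     real \<times> (real^'k1) \<times> (real^'k2) \<Rightarrow> bool" where
  "two_stage_estimate f g n z c x y b \<longleftrightarrow>
     (\<exists>a. (\<forall>j. least_squares n (\<lambda>i. (1::real, z i, c i)) (\<lambda>i. f j (x i)) (a j)) \<and>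
          least_squares n (\<lambda>i. (1::real, \<chi> j. a j \<bullet> (1::real, z i, c i), \<chi> j. g j (c i))) y b)"

text \<open>The last argument is the coefficient of the first-stage residual.\<close>

definition control_function_estimate ::
    "('k1::finite \<Rightarrow> real \<Rightarrow> real) \<Rightarrow> ('k2::finite \<Rightarrow> real^'n2 \<Rightarrow> real) \<Rightarrow>
     nat \<Rightarrow> (nat \<Rightarrow> real^'n1) \<Rightarrow> (nat \<Rightarrow> real^'n2) \<Rightarrow> (nat \<Rightarrow> real) \<Rightarrow> (nat \<Rightarrow> real) \<Rightarrow>
     real \<times> (real^'k1) \<times> (real^'k2) \<Rightarrow> real \<Rightarrow> bool" where
  "control_function_estimate f g n z c x y b r \<longleftrightarrow>
     (\<exists>a. least_squares n (\<lambda>i. (1::real, z i, c i)) x a \<and>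
          least_squares n
            (\<lambda>i. ((1, \<chi> j. f j (x i), \<chi> j. g j (c i)), x i - a \<bullet> (1::real, z i, c i))) y (b, r))"

text \<open>The centred normal law with variance \<open>v \<ge> 0\<close>; it is a point mass if \<open>v = 0\<close>.\<close>

definition centred_normal :: "real \<Rightarrow> real measure" where
  "centred_normal v =
     (if v = 0 then return borel 0 else density lborel (normal_density 0 (sqrt v)))"

text \<open>
  The possibly degenerate law \<open>N(0, \<Sigma>)\<close> on a Euclidean space. The covariance is given as a
  self-adjoint positive semidefinite operator, so that \<open>c \<bullet> \<Sigma> d\<close> is the covariance of the
  functionals \<open>c\<close> and \<open>d\<close>.
\<close>

definition centred_gaussian :: "'a::euclidean_space measure \<Rightarrow> ('a \<Rightarrow> 'a) \<Rightarrow> bool" where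
  "centred_gaussian N \<Sigma> \<longleftrightarrow>
     linear \<Sigma> \<and> (\<forall>c d. c \<bullet> \<Sigma> d = \<Sigma> c \<bullet> d) \<and> (\<forall>c. 0 \<le> c \<bullet> \<Sigma> c) \<and>
     sets N = sets borel \<and> (\<forall>c. distr N borel (\<lambda>x. c \<bullet> x) = centred_normal (c \<bullet> \<Sigma> c))"

definition converges_to_gaussian ::
    "'w measure \<Rightarrow> (nat \<Rightarrow> 'w \<Rightarrow> 'a::euclidean_space) \<Rightarrow> ('a \<Rightarrow> 'a) \<Rightarrow> bool" where
  "converges_to_gaussian M S \<Sigma> \<longleftrightarrow>
     (\<exists>N. centred_gaussian N \<Sigma> \<and>
        (\<forall>\<phi>::'a \<Rightarrow> real. continuous_on UNIV \<phi> \<longrightarrow> bounded (range \<phi>) \<longrightarrow>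
           (\<lambda>n. \<integral>\<omega>. \<phi> (S n \<omega>) \<partial>M) \<longlonglongrightarrow> (\<integral>x. \<phi> x \<partial>N)))"

text \<open>
  A sequence of random vectors, the \<open>n\<close>-th being a solution of the \<open>n\<close>-th estimation problem,
  has the asymptotic covariance \<open>\<Sigma>\<close> around \<open>\<beta>\<close>, whichever solutions are chosen in samples in
  which they are not unique.
\<close>

definition asymptotic_covariance ::
    "'w measure \<Rightarrow> (nat \<Rightarrow> 'w \<Rightarrow> 'a::euclidean_space \<Rightarrow> bool) \<Rightarrow> 'a \<Rightarrow> ('a \<Rightarrow> 'a) \<Rightarrow> bool" where
  "asymptotic_covariance M est \<beta> \<Sigma> \<longleftrightarrow>
     (\<forall>b. (\<forall>n. b n \<in> borel_measurable M \<and> (AE \<omega> in M. est n \<omega> (b n \<omega>))) \<longrightarrow>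
        converges_to_gaussian M (\<lambda>n \<omega>. sqrt (real n) *\<^sub>R (b n \<omega> - \<beta>)) \<Sigma>)"

end

theory Submission
  imports Defs
begin

text \<open>
  Linear effect: the residual of the first stage is orthogonal to the span of the first-stage
  regressors, which contains the second-stage regressors of the two-stage method, so the sum of
  squares of the control function regression splits and the common coefficients decouple.

  Nonlinear effect: write \<open>W = (1, Z, C)\<close>, \<open>D = (1, f(X), g(C))\<close>, \<open>v\<close> and \<open>\<epsilon>\<close> for the centred
  \<open>\<delta>1\<close> and \<open>e\<close>. Both estimators solve linear systems whose coefficients are sample second moments
  and whose right-hand sides are scaled sums of independent terms. By the law of large numbers and
  the central limit theorem they are asymptotically normal. Let \<open>p\<close> be the \<open>W\<close>-combination and
  \<open>h = c \<bullet> D + q v\<close> the combination orthogonal to \<open>v\<close> that represent a functional \<open>d\<close> in the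
  respective inverse systems. The asymptotic variances of \<open>d\<close> are \<open>(\<rho>\<^sup>2 Var v + Var \<epsilon>) E p\<^sup>2\<close>
  for the two-stage method and at most \<open>(\<rho>\<^sup>2 Var v + Var \<epsilon>) E h\<^sup>2\<close> for the control function method, and
  \<open>E p h = - E h\<^sup>2\<close> gives \<open>E h\<^sup>2 = E p\<^sup>2 - E (p + h)\<^sup>2\<close>. Equality for all \<open>d\<close> forces every
  \<open>f j (X)\<close> to be linear in \<open>(Z, C, X)\<close>; if \<open>\<delta>1\<close> charges all sets of positive length, then, by
  Fubini's theorem, it is even linear in \<open>X\<close> alone.
\<close>

section \<open>Least squares\<close>

text \<open>Estimators are relations: in a collinear sample there are many solutions, and the
  first-stage coefficients behind a solution need not depend measurably on the sample. Randomness is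
  therefore confined to one scalar, the distance between sample and population moments, and to the
  normalised sums. Whenever that distance is small, every solution satisfies a system close to the
  population one. As the second stage uses quantities generated in the first, first-stage errors are
  kept as unknowns of the same system, so no sample matrix has to be inverted. Both \<open>p\<close>
  and \<open>h\<close> represent \<open>d\<close> on the combinations of \<open>D\<close>, with
  opposite signs; this yields \<open>E p h = - E h\<^sup>2\<close>. The first-stage part of the
  control function variance involves \<open>\<rho>\<close> times the projection of \<open>h\<close>
  on the span of \<open>W\<close>, hence is at most \<open>\<rho>\<^sup>2 Var v E h\<^sup>2\<close>.
  The means of \<open>\<delta>1\<close> and \<open>e\<close> need not vanish and move into the
  intercepts. If \<open>v\<close> vanishes, the coefficient of the residual is arbitrary, and an
  auxiliary constant keeps the limiting system regular.\<close>

lemma least_squares_iff_normal_equations: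
  "least_squares n w y b \<longleftrightarrow> (\<forall>c. (\<Sum>i<n. (c \<bullet> w i) * (y i - b \<bullet> w i)) = 0)"
proof -
  have expand: "(\<Sum>i<n. (y i - (b + t *\<^sub>R c) \<bullet> w i)\<^sup>2) =
      (\<Sum>i<n. (y i - b \<bullet> w i)\<^sup>2) - 2 * t * (\<Sum>i<n. (c \<bullet> w i) * (y i - b \<bullet> w i))
        + t\<^sup>2 * (\<Sum>i<n. (c \<bullet> w i)\<^sup>2)" for t c
    unfolding sum_distrib_left sum.distrib[symmetric] sum_subtractf[symmetric]
    by (rule sum.cong) (simp_all add: inner_add_left power2_eq_square algebra_simps)
  show ?thesis
  proof
    assume "least_squares n w y b"
    then have le: "(\<Sum>i<n. (y i - b \<bullet> w i)\<^sup>2) \<le> (\<Sum>i<n. (y i - b' \<bullet> w i)\<^sup>2)" for b'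
      by (force simp: least_squares_def is_arg_min_linorder)
    show "\<forall>c. (\<Sum>i<n. (c \<bullet> w i) * (y i - b \<bullet> w i)) = 0"
    proof
      fix c
      define p where "p = (\<Sum>i<n. (c \<bullet> w i) * (y i - b \<bullet> w i))"
      define q where "q = (\<Sum>i<n. (c \<bullet> w i)\<^sup>2)"
      have q: "q \<ge> 0" by (auto simp: q_def intro: sum_nonneg)
      have "0 \<le> - 2 * t * p + t\<^sup>2 * q" for t
        using le[of "b + t *\<^sub>R c"] expand[of t c] by (simp add: p_def q_def)
      \<comment> \<open>The minimiser \<open>p / q\<close> fails for \<open>q = 0\<close>; with
        \<open>q + 1\<close> the inequality at \<open>u\<close> becomes
        \<open>u\<^sup>2 * (q + 2) \<le> 0\<close>.\<close>
      define u where "u = p / (q + 1)"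
      have p: "p = u * (q + 1)" using q by (simp add: u_def)
      have "u\<^sup>2 * (q + 2) \<le> 0"
        using \<open>\<And>t. 0 \<le> - 2 * t * p + t\<^sup>2 * q\<close>[of u] by (simp add: p power2_eq_square algebra_simps)
      then have "p = 0" using q by (auto simp: mult_le_0_iff p)
      then show "(\<Sum>i<n. (c \<bullet> w i) * (y i - b \<bullet> w i)) = 0" by (simp add: p_def)
    qed
  next
    assume normal: "\<forall>c. (\<Sum>i<n. (c \<bullet> w i) * (y i - b \<bullet> w i)) = 0"
    have "(\<Sum>i<n. (y i - b \<bullet> w i)\<^sup>2) \<le> (\<Sum>i<n. (y i - b' \<bullet> w i)\<^sup>2)" for b'
      using expand[of 1 "b' - b"] normal by (auto intro: sum_nonneg)
    then show "least_squares n w y b"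
      by (auto simp: least_squares_def is_arg_min_linorder)
  qed
qed

text \<open>A vector \<open>z\<close> orthogonal to the range of the Gram operator \<open>A\<close>
  satisfies \<open>z \<bullet> A z = 0\<close>, a sum of squares, so it is orthogonal to every
  regressor and hence to \<open>t\<close>. Therefore \<open>t\<close> lies in the range of
  \<open>A\<close>, collinear regressors included.\<close>

lemma least_squares_exists:
  fixes w :: "nat \<Rightarrow> 'a::euclidean_space"
  obtains b where "least_squares n w y b"
proof -
  define A where "A m = (\<Sum>i<n. (m \<bullet> w i) *\<^sub>R w i)" for m
  define t where "t = (\<Sum>i<n. y i *\<^sub>R w i)"
  have lin: "linear A"
    unfolding A_def
    by (rule linearI) (simp_all add: inner_add_left scaleR_left_distrib sum.distrib scaleR_sum_right)
  obtain p z where p: "p \<in> span (range A)" and z: "\<And>u. u \<in> span (range A) \<Longrightarrow> orthogonal z u"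
    and t: "t = p + z"
    using orthogonal_subspace_decomp_exists[of "range A" t] by blast
  have "subspace (range A)" using linear_subspace_image[OF lin subspace_UNIV] .
  then obtain a where a: "p = A a" using p by (auto simp: span_eq_iff[THEN iffD2])
  have "z \<bullet> A z = 0" using z[of "A z"] by (simp add: orthogonal_def span_base)
  then have "(\<Sum>i<n. (z \<bullet> w i)\<^sup>2) = 0"
    by (simp add: A_def inner_sum_right power2_eq_square)
  then have "z \<bullet> w i = 0" if "i < n" for i
    using that by (simp add: sum_nonneg_eq_0_iff)
  then have "z \<bullet> t = 0" by (simp add: t_def inner_sum_right)
  moreover have "z \<bullet> p = 0" using z[OF p] by (simp add: orthogonal_def)
  ultimately have "z = 0" using t by (simp add: inner_add_right)
  then have "t = A a" using t a by simp
  have "(\<Sum>i<n. (c \<bullet> w i) * (y i - a \<bullet> w i)) = c \<bullet> t - c \<bullet> A a" for c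
    by (simp add: A_def t_def inner_sum_right algebra_simps flip: sum_subtractf)
  with \<open>t = A a\<close> have "least_squares n w y a" by (simp add: least_squares_iff_normal_equations)
  then show thesis by (rule that)
qed

lemma least_squares_fitted_values_unique:
  assumes "least_squares n w y a" "least_squares n w y b" "i < n"
  shows "a \<bullet> w i = b \<bullet> w i"
proof -
  have "(\<Sum>i<n. ((a - b) \<bullet> w i)\<^sup>2) =
      (\<Sum>i<n. ((a - b) \<bullet> w i) * (y i - b \<bullet> w i)) - (\<Sum>i<n. ((a - b) \<bullet> w i) * (y i - a \<bullet> w i))"
    by (simp add: algebra_simps power2_eq_square flip: sum_subtractf)
  also have "\<dots> = 0" using assms by (simp add: least_squares_iff_normal_equations)
  finally show ?thesis using assms(3) by (simp add: sum_nonneg_eq_0_iff inner_diff_left)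
qed

lemma least_squares_cong:
  "(\<And>i. i < n \<Longrightarrow> w i = w' i) \<Longrightarrow> (\<And>i. i < n \<Longrightarrow> y i = y' i) \<Longrightarrow>
    least_squares n w y b \<longleftrightarrow> least_squares n w' y' b"
  by (simp add: least_squares_def)

lemma linear_effect_estimates_coincide:
  fixes f :: "'k1::finite \<Rightarrow> real \<Rightarrow> real" and g :: "'k2::finite \<Rightarrow> real^'n2 \<Rightarrow> real"
    and z :: "nat \<Rightarrow> real^'n1"
  assumes f: "\<And>j. linear_function (f j)" and g: "\<And>j. linear_function (g j)"
  shows "two_stage_estimate f g n z c x y b \<longleftrightarrow>
    (\<exists>r. control_function_estimate f g n z c x y b r)"
proof -
  obtain f0 f1 where f_eq: "\<And>j t. f j t = f0 j + f1 j * t"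
    using f unfolding linear_function_def inner_real_def by metis
  obtain g0 g1 where g_eq: "\<And>j t. g j t = g0 j + g1 j \<bullet> t"
    using g unfolding linear_function_def by metis
  define w where "w i = (1::real, z i, c i)" for i
  define F where "F a i = (1::real, (\<chi> j. f j (a \<bullet> w i)), (\<chi> j. g j (c i)))" for a i
  \<comment> \<open>If \<open>a\<close> fits \<open>x\<close> in the first stage,
    \<open>L j a\<close> fits \<open>f j (x)\<close>: an affine map commutes with the fit because
    the intercept is a regressor.\<close>
  define L where "L j a = (f0 j, 0, 0) + f1 j *\<^sub>R a" for j and a :: "real \<times> (real^'n1) \<times> (real^'n2)"
  have L: "L j a \<bullet> w i = f j (a \<bullet> w i)" for j a i
    by (simp add: L_def w_def f_eq algebra_simps inner_add_left)
  \<comment> \<open>Rewrites a second-stage combination as a combination of first-stage regressors;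
    this rests on the linearity of every \<open>g j\<close>.\<close>
  define A where "A d a = (fst d, 0, 0) + (\<Sum>j\<in>UNIV. (fst (snd d) $ j) *\<^sub>R L j a) +
      (\<Sum>j\<in>UNIV. (snd (snd d) $ j) *\<^sub>R (g0 j, 0, g1 j))"
    for d :: "real \<times> (real^'k1) \<times> (real^'k2)" and a :: "real \<times> (real^'n1) \<times> (real^'n2)"
  have w_g: "(g0 j, 0, g1 j) \<bullet> w i = g j (c i)" for j i
    by (simp add: w_def g_eq)
  have w_1: "(r, 0, 0) \<bullet> w i = r" for r i
    by (simp add: w_def)
  have A: "A d a \<bullet> w i = d \<bullet> F a i" for d a i
    unfolding A_def inner_add_left inner_sum_left inner_scaleR_left L w_g w_1
    by (cases d) (simp add: F_def inner_vec_def)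
  define F' where "F' i = (1::real, (\<chi> j. f j (x i)), (\<chi> j. g j (c i)))" for i
  \<comment> \<open>Slope of the combination \<open>d\<close> in the exposure: replacing the fitted
    by the observed exposure adds \<open>s d\<close> times the residual.\<close>
  define s where "s d = (\<Sum>j\<in>UNIV. fst (snd d) $ j * f1 j)" for d :: "real \<times> (real^'k1) \<times> (real^'k2)"
  have F': "d \<bullet> F' i = d \<bullet> F a i + s d * (x i - a \<bullet> w i)" for d a i
    by (cases d) (simp add: F'_def F_def s_def inner_vec_def f_eq sum_distrib_right sum.distrib[symmetric]
      sum_distrib_left algebra_simps flip: sum.distrib)
  have LS_L: "least_squares n w (\<lambda>i. f j (x i)) (L j a)" if "least_squares n w x a" for j a
  proof -
    have "(\<Sum>i<n. (d \<bullet> w i) * (f j (x i) - L j a \<bullet> w i)) =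
        f1 j * (\<Sum>i<n. (d \<bullet> w i) * (x i - a \<bullet> w i))" for d
      unfolding L f_eq sum_distrib_left by (rule sum.cong) (simp_all add: algebra_simps)
    with that show ?thesis by (simp add: least_squares_iff_normal_equations)
  qed
  have ts: "two_stage_estimate f g n z c x y b \<longleftrightarrow>
     (\<exists>a. least_squares n w x a \<and> least_squares n (F a) y b)" (is "?l \<longleftrightarrow> ?r")
  proof
    assume ?l
    then obtain h where h: "\<And>j. least_squares n w (\<lambda>i. f j (x i)) (h j)"
      and b: "least_squares n (\<lambda>i. (1::real, \<chi> j. h j \<bullet> w i, \<chi> j. g j (c i))) y b"
      unfolding two_stage_estimate_def w_def by blast
    obtain a where a: "least_squares n w x a" by (rule least_squares_exists)
    \<comment> \<open>The coefficients \<open>h j\<close> may differ from \<open>L j a\<close> in a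
      collinear sample, but their fitted values agree.\<close>
    have "h j \<bullet> w i = f j (a \<bullet> w i)" if "i < n" for i j
      using least_squares_fitted_values_unique[OF h LS_L[OF a] that] by (simp add: L)
    then have "least_squares n (F a) y b"
      using b by (subst least_squares_cong[of n "F a" "\<lambda>i. (1::real, \<chi> j. h j \<bullet> w i, \<chi> j. g j (c i))" y y])
        (simp_all add: F_def)
    with a show ?r by blast
  next
    assume ?r
    then obtain a where a: "least_squares n w x a" and b: "least_squares n (F a) y b" by blast
    have "least_squares n (\<lambda>i. (1::real, \<chi> j. L j a \<bullet> w i, \<chi> j. g j (c i))) y b"
      using b by (simp add: L F_def[abs_def])
    with LS_L[OF a] show ?l unfolding two_stage_estimate_def w_def
      by (intro exI[of _ "\<lambda>j. L j a"]) simp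
  qed
  have second_stage: "least_squares n (F a) y b \<longleftrightarrow> (\<exists>r. least_squares n (\<lambda>i. (F' i, x i - a \<bullet> w i)) y (b, r))"
    if a: "least_squares n w x a" for a
  proof -
    define v where "v i = x i - a \<bullet> w i" for i
    have orth: "(\<Sum>i<n. (d \<bullet> F a i) * v i) = 0" for d
      using a unfolding least_squares_iff_normal_equations v_def A[symmetric] by blast
    \<comment> \<open>In the coordinates \<open>d\<close> and \<open>s d + q\<close> the normal
      equations separate, since the mixed sums pair a first-stage combination with the
      residual.\<close>
    have eq: "(\<Sum>i<n. ((d, q) \<bullet> (F' i, v i)) * (y i - (b, r) \<bullet> (F' i, v i))) =
        (\<Sum>i<n. (d \<bullet> F a i) * (y i - b \<bullet> F a i))
        + (s d + q) * ((\<Sum>i<n. v i * y i) - (s b + r) * (\<Sum>i<n. (v i)\<^sup>2))" for d q r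
    proof -
      have "(\<Sum>i<n. ((d, q) \<bullet> (F' i, v i)) * (y i - (b, r) \<bullet> (F' i, v i))) =
        (\<Sum>i<n. (d \<bullet> F a i) * (y i - b \<bullet> F a i) + (s d + q) * (v i * y i - (s b + r) * (v i)\<^sup>2)
           - (s b + r) * ((d \<bullet> F a i) * v i) - (s d + q) * ((b \<bullet> F a i) * v i))"
        by (rule sum.cong)
          (simp_all add: F'[of _ _ a] v_def power2_eq_square algebra_simps)
      also have "\<dots> = (\<Sum>i<n. (d \<bullet> F a i) * (y i - b \<bullet> F a i))
        + (s d + q) * ((\<Sum>i<n. v i * y i) - (s b + r) * (\<Sum>i<n. (v i)\<^sup>2))"
        by (simp only: sum.distrib sum_subtractf flip: sum_distrib_left) (simp add: orth)
      finally show ?thesis .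
    qed
    \<comment> \<open>The equation for the residual only fixes \<open>s b + r\<close>, so some
      \<open>r\<close> always solves it; if all residuals vanish, both sides are zero.\<close>
    have "\<exists>r. (\<Sum>i<n. v i * y i) = (s b + r) * (\<Sum>i<n. (v i)\<^sup>2)"
    proof (cases "(\<Sum>i<n. (v i)\<^sup>2) = 0")
      case True
      then show ?thesis by (simp add: sum_nonneg_eq_0_iff)
    next
      case False
      then show ?thesis
        by (intro exI[of _ "(\<Sum>i<n. v i * y i) / (\<Sum>i<n. (v i)\<^sup>2) - s b"]) simp
    qed
    then obtain r where r: "(\<Sum>i<n. v i * y i) = (s b + r) * (\<Sum>i<n. (v i)\<^sup>2)" ..
    show ?thesis
    proof
      assume "least_squares n (F a) y b"
      then have "least_squares n (\<lambda>i. (F' i, v i)) y (b, r)"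
        unfolding least_squares_iff_normal_equations split_paired_All eq r by simp
      then show "\<exists>r. least_squares n (\<lambda>i. (F' i, x i - a \<bullet> w i)) y (b, r)"
        unfolding v_def by blast
    next
      assume "\<exists>r. least_squares n (\<lambda>i. (F' i, x i - a \<bullet> w i)) y (b, r)"
      then obtain r where "least_squares n (\<lambda>i. (F' i, v i)) y (b, r)" by (auto simp: v_def)
      then have "\<forall>d q. (\<Sum>i<n. (d \<bullet> F a i) * (y i - b \<bullet> F a i))
        + (s d + q) * ((\<Sum>i<n. v i * y i) - (s b + r) * (\<Sum>i<n. (v i)\<^sup>2)) = 0"
        unfolding least_squares_iff_normal_equations split_paired_All eq by simp
      then have "(\<Sum>i<n. (d \<bullet> F a i) * (y i - b \<bullet> F a i)) = 0" for d
        \<comment> \<open>The test direction \<open>q = - s d\<close> removes the residual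
          equation.\<close>
        by (drule_tac spec[of _ d], drule_tac spec[of _ "- s d"]) simp
      then show "least_squares n (F a) y b" by (simp add: least_squares_iff_normal_equations)
    qed
  qed
  show ?thesis
    unfolding ts control_function_estimate_def F'_def[symmetric] w_def[symmetric]
    using second_stage by blast
qed

section \<open>Gaussian laws\<close>

text \<open>Treats the point mass \<open>v = 0\<close> together with the genuine normal laws, so
  that characteristic functions need no case distinction.\<close>

lemma centred_normal_eq_distr:
  assumes "v \<ge> 0"
  shows "centred_normal v = distr std_normal_distribution borel (\<lambda>x. sqrt v * x)"
proof (cases "v = 0")
  case True
  interpret real_distribution std_normal_distribution by (rule real_dist_normal_dist)
  show ?thesis
    using True by (simp add: centred_normal_def prob_space.distr_const) 
next
  case False
  with assms have v: "v > 0" by simp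
  interpret prob_space std_normal_distribution by (rule real_distribution.axioms[OF real_dist_normal_dist])
  have "distributed std_normal_distribution lborel (\<lambda>x. x) std_normal_density"
    unfolding distributed_def by (simp add: distr_id2)
  then have "distributed std_normal_distribution lborel (\<lambda>x. 0 + sqrt v * x) (normal_density (0 + sqrt v * 0) (\<bar>sqrt v\<bar> * 1))"
    using v by (intro normal_density_affine) auto
  then have "density lborel (normal_density 0 (sqrt v)) = distr std_normal_distribution lborel (\<lambda>x. sqrt v * x)"
    using v by (simp add: distributed_def)
  also have "\<dots> = distr std_normal_distribution borel (\<lambda>x. sqrt v * x)"
    by (rule distr_cong) auto
  finally show ?thesis using v by (simp add: centred_normal_def)
qed

lemma real_distribution_centred_normal:
  "v \<ge> 0 \<Longrightarrow> real_distribution (centred_normal v)"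
  by (simp add: centred_normal_eq_distr)
    (intro prob_space.real_distribution_distr real_distribution.axioms[OF real_dist_normal_dist]; simp)

lemma char_centred_normal:
  assumes "v \<ge> 0"
  shows "char (centred_normal v) t = complex_of_real (exp (- (v * t\<^sup>2) / 2))"
proof -
  have "char (centred_normal v) t = char std_normal_distribution (t * sqrt v)"
    unfolding char_def centred_normal_eq_distr[OF assms]
    by (subst integral_distr) (simp_all add: mult_ac)
  also have "\<dots> = complex_of_real (exp (- (v * t\<^sup>2) / 2))"
    using assms by (simp add: char_std_normal_distribution power_mult_distrib mult_ac)
  finally show ?thesis .
qed

lemma nonneg_quadratic_discriminant:
  fixes p q r :: real
  assumes nn: "\<And>t. 0 \<le> q + 2 * p * t + r * t\<^sup>2" and "0 \<le> r"
  shows "p\<^sup>2 \<le> q * r"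
proof (cases "r = 0")
  case True
  have "p = 0"
  proof (rule ccontr)
    assume "p \<noteq> 0"
    \<comment> \<open>With \<open>r = 0\<close> the expression is affine in \<open>t\<close>; at
      this \<open>t\<close> its value is -1.\<close>
    then show False using nn[of "- (q + 1) / (2 * p)"] True by (simp add: field_simps)
  qed
  then show ?thesis using True by simp
next
  case False
  with assms(2) have "r > 0" by simp
  then show ?thesis using nn[of "- p / r"] by (simp add: field_simps power2_eq_square)
qed

text \<open>Symmetric Gaussian elimination: each step moves a basis vector into the kernel.\<close>

lemma psd_operator_sum_of_squares:
  fixes \<Sigma> :: "'a::euclidean_space \<Rightarrow> 'a"
  assumes "linear \<Sigma>" "\<And>c d. c \<bullet> \<Sigma> d = \<Sigma> c \<bullet> d" "\<And>c. 0 \<le> c \<bullet> \<Sigma> c"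
  obtains vs where "\<And>c. c \<bullet> \<Sigma> c = (\<Sum>v\<leftarrow>vs. (v \<bullet> c)\<^sup>2)"
proof -
  have "\<exists>vs. \<forall>c. c \<bullet> \<Sigma> c = (\<Sum>v\<leftarrow>vs. (v \<bullet> c)\<^sup>2)"
    using assms
  proof (induction "card {b\<in>Basis. \<Sigma> b \<noteq> 0}" arbitrary: \<Sigma> rule: less_induct)
    case less
    note lin = less.prems(1) and sym = less.prems(2) and psd = less.prems(3)
    show ?case
    proof (cases "\<forall>b\<in>Basis. \<Sigma> b = 0")
      case True
      have "\<Sigma> c = 0" for c
        using linear_eq_stdbasis[OF lin linear_zero] True by auto
      then show ?thesis by (intro exI[of _ "[]"]) simp
    next
      case False
      then obtain b where b: "b \<in> Basis" "\<Sigma> b \<noteq> 0" by auto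
      define q where "q = b \<bullet> \<Sigma> b"
      \<comment> \<open>Cauchy-Schwarz for the form: it excludes \<open>q = 0\<close> and later
        keeps the reduced operator positive semidefinite.\<close>
      have cs: "(c \<bullet> \<Sigma> b)\<^sup>2 \<le> q * (c \<bullet> \<Sigma> c)" for c
      proof -
        have "0 \<le> (b + t *\<^sub>R c) \<bullet> \<Sigma> (b + t *\<^sub>R c)" for t by (rule psd)
        moreover have "(b + t *\<^sub>R c) \<bullet> \<Sigma> (b + t *\<^sub>R c) = q + 2 * (c \<bullet> \<Sigma> b) * t + (c \<bullet> \<Sigma> c) * t\<^sup>2" for t
          using sym[of b c] by (simp add: linear_add[OF lin] linear_scale[OF lin] inner_add_left
            inner_add_right q_def power2_eq_square algebra_simps inner_commute)
        ultimately have "0 \<le> q + 2 * (c \<bullet> \<Sigma> b) * t + (c \<bullet> \<Sigma> c) * t\<^sup>2" for t by metis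
        then show ?thesis by (rule nonneg_quadratic_discriminant) (rule psd)
      qed
      have "q \<noteq> 0" 
      proof
        assume "q = 0"
        then have "c \<bullet> \<Sigma> b = 0" for c using cs[of c] by simp
        then have "\<Sigma> b = 0" using inner_eq_zero_iff by blast
        with b show False by simp
      qed
      then have q: "q > 0" using psd[of b] by (simp add: q_def)
      \<comment> \<open>Normalised so that subtracting the square of \<open>v\<close> sends
        \<open>b\<close> to zero, while vectors already in the kernel stay there.\<close>
      define v where "v = (1 / sqrt q) *\<^sub>R \<Sigma> b"
      have v2: "(v \<bullet> c) * (v \<bullet> d) = (\<Sigma> b \<bullet> c) * (\<Sigma> b \<bullet> d) / q" for c d
        using q by (simp add: v_def)
      define \<Sigma>' where "\<Sigma>' c = \<Sigma> c - (v \<bullet> c) *\<^sub>R v" for c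
      have "linear \<Sigma>'" unfolding \<Sigma>'_def
        by (rule linearI) (simp_all add: linear_add[OF lin] linear_scale[OF lin] inner_add_right algebra_simps)
      moreover have "c \<bullet> \<Sigma>' d = \<Sigma>' c \<bullet> d" for c d
        using sym[of c d] by (simp add: \<Sigma>'_def inner_diff_left inner_diff_right inner_commute)
      moreover have eq: "c \<bullet> \<Sigma>' c = c \<bullet> \<Sigma> c - (v \<bullet> c)\<^sup>2" for c
        by (simp add: \<Sigma>'_def inner_diff_right power2_eq_square inner_commute)
      moreover have "0 \<le> c \<bullet> \<Sigma>' c" for c
        using cs[of c] q unfolding eq power2_eq_square v2 by (simp add: field_simps inner_commute)
      moreover have "card {b\<in>Basis. \<Sigma>' b \<noteq> 0} < card {b\<in>Basis. \<Sigma> b \<noteq> 0}"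
      proof (rule psubset_card_mono)
        have "\<Sigma>' u = 0" if "\<Sigma> u = 0" for u
          using sym[of b u] that by (simp add: \<Sigma>'_def v_def)
        moreover have "\<Sigma>' b = 0"
          using q by (simp add: \<Sigma>'_def v_def inner_commute flip: q_def)
        ultimately show "{b\<in>Basis. \<Sigma>' b \<noteq> 0} \<subset> {b\<in>Basis. \<Sigma> b \<noteq> 0}"
          using b by auto
      qed simp
      ultimately obtain vs where "\<And>c. c \<bullet> \<Sigma>' c = (\<Sum>v\<leftarrow>vs. (v \<bullet> c)\<^sup>2)"
        using less.hyps[of \<Sigma>'] by metis
      then have "c \<bullet> \<Sigma> c = (\<Sum>v\<leftarrow>v # vs. (v \<bullet> c)\<^sup>2)" for c
        using eq[of c] by simp
      then show ?thesis by blast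
    qed
  qed
  then show thesis using that by blast
qed

text \<open>Built as the law of a sum of independent standard normal multiples of the vectors
  \<open>vs\<close>, one convolution per vector. The one-dimensional projections are recognised by
  their characteristic functions.\<close>

lemma centred_gaussian_exists:
  fixes \<Sigma> :: "'a::euclidean_space \<Rightarrow> 'a"
  assumes lin: "linear \<Sigma>" and sym: "\<And>c d. c \<bullet> \<Sigma> d = \<Sigma> c \<bullet> d" and psd: "\<And>c. 0 \<le> c \<bullet> \<Sigma> c"
  obtains N where "centred_gaussian N \<Sigma>" "prob_space N"
proof -
  have "\<exists>N. prob_space N \<and> sets N = sets borel \<and>
    (\<forall>c::'a. distr N borel (\<lambda>x. c \<bullet> x) = centred_normal (\<Sum>v\<leftarrow>vs. (v \<bullet> c)\<^sup>2))" for vs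
  proof (induction vs)
    case Nil
    have "prob_space (return borel (0::'a))" by (simp add: prob_space_return)
    moreover have "distr (return borel 0) borel (\<lambda>x. c \<bullet> x) = centred_normal 0" for c :: 'a
      by (subst distr_return) (simp_all add: centred_normal_def)
    ultimately show ?case by (intro exI[of _ "return borel 0"]) simp
  next
    case (Cons v vs)
    then obtain N where N: "prob_space N" and sets[measurable_cong]: "sets N = sets borel"
      and dN: "\<And>c::'a. distr N borel (\<lambda>x. c \<bullet> x) = centred_normal (\<Sum>v\<leftarrow>vs. (v \<bullet> c)\<^sup>2)" by blast
    let ?S = "std_normal_distribution"
    interpret N: prob_space N by (rule N)
    interpret S: prob_space ?S by (rule real_distribution.axioms[OF real_dist_normal_dist])
    interpret P: pair_prob_space N ?S ..
    define N' where "N' = distr (N \<Otimes>\<^sub>M ?S) borel (\<lambda>(x, z). x + z *\<^sub>R v)"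
    have N': "prob_space N'" "sets N' = sets borel"
      by (simp_all add: N'_def P.prob_space_distr)
    have "distr N' borel (\<lambda>x. c \<bullet> x) = centred_normal (\<Sum>v\<leftarrow>v # vs. (v \<bullet> c)\<^sup>2)" for c
    proof (rule Levy_uniqueness)
      have nn: "0 \<le> (\<Sum>v\<leftarrow>vs. (v \<bullet> c)\<^sup>2)" for vs by (induction vs) auto
      show "real_distribution (distr N' borel (\<lambda>x. c \<bullet> x))"
        using N' by (intro prob_space.real_distribution_distr) (auto cong: measurable_cong_sets)
      show "real_distribution (centred_normal (\<Sum>v\<leftarrow>v # vs. (v \<bullet> c)\<^sup>2))"
        by (rule real_distribution_centred_normal[OF nn])
      show "char (distr N' borel (\<lambda>x. c \<bullet> x)) = char (centred_normal (\<Sum>v\<leftarrow>v # vs. (v \<bullet> c)\<^sup>2))"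
      proof
        fix t
        have "char (distr N' borel (\<lambda>x. c \<bullet> x)) t =
            (\<integral>p. iexp (t * (c \<bullet> fst p)) * iexp ((t * (c \<bullet> v)) * snd p) \<partial>(N \<Otimes>\<^sub>M ?S))"
          unfolding char_def N'_def
          by (subst integral_distr, simp, simp, subst integral_distr, simp, simp)
            (simp add: split_beta inner_add_right exp_add[symmetric] algebra_simps)
        also have "\<dots> = (\<integral>x. (\<integral>z. iexp (t * (c \<bullet> x)) * iexp ((t * (c \<bullet> v)) * z) \<partial>?S) \<partial>N)"
          by (subst P.integral_fst'[symmetric])
            (auto intro!: P.integrable_const_bound[where B=1] simp: norm_mult)
        also have "\<dots> = (\<integral>x. iexp (t * (c \<bullet> x)) \<partial>N) * char ?S (t * (c \<bullet> v))"
          by (simp add: char_def)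
        also have "(\<integral>x. iexp (t * (c \<bullet> x)) \<partial>N) = char (distr N borel (\<lambda>x. c \<bullet> x)) t"
          unfolding char_def by (subst integral_distr) auto
        also have "\<dots> * char ?S (t * (c \<bullet> v)) = char (centred_normal (\<Sum>v\<leftarrow>v # vs. (v \<bullet> c)\<^sup>2)) t"
          unfolding dN char_centred_normal[OF nn] char_std_normal_distribution
          by (simp add: exp_add[symmetric] power_mult_distrib inner_commute field_simps flip: of_real_mult)
        finally show "char (distr N' borel (\<lambda>x. c \<bullet> x)) t = char (centred_normal (\<Sum>v\<leftarrow>v # vs. (v \<bullet> c)\<^sup>2)) t" .
      qed
    qed
    with N' show ?case by blast
  qed
  moreover obtain vs where "\<And>c. c \<bullet> \<Sigma> c = (\<Sum>v\<leftarrow>vs. (v \<bullet> c)\<^sup>2)"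
    using psd_operator_sum_of_squares[OF lin sym psd] by blast
  ultimately show thesis
    using that lin sym psd unfolding centred_gaussian_def by metis
qed

section \<open>Weak convergence in several dimensions\<close>

text \<open>Products are not a constructor: convergence of expectations passes through sums and
  scalings by linearity, while closure under products follows from the product-to-sum formulas and
  serves polynomials in sines.\<close>

inductive trig_poly :: "('a::real_inner \<Rightarrow> real) \<Rightarrow> bool" where
  cos: "trig_poly (\<lambda>x. cos (c \<bullet> x))"
| sin: "trig_poly (\<lambda>x. sin (c \<bullet> x))"
| add: "trig_poly p \<Longrightarrow> trig_poly q \<Longrightarrow> trig_poly (\<lambda>x. p x + q x)"
| scale: "trig_poly p \<Longrightarrow> trig_poly (\<lambda>x. r * p x)"

lemma trig_poly_const: "trig_poly (\<lambda>_. r)"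
  using trig_poly.scale[OF trig_poly.cos[of 0], of r] by simp

lemma trig_poly_sum:
  "(\<And>i. i \<in> I \<Longrightarrow> trig_poly (p i)) \<Longrightarrow> trig_poly (\<lambda>x. \<Sum>i\<in>I. p i x)"
  by (induction I rule: infinite_finite_induct) (auto intro: trig_poly_const trig_poly.add)

lemma trig_poly_cos_mult:
  assumes "trig_poly q" shows "trig_poly (\<lambda>x. cos (c \<bullet> x) * q x)"
  using assms
proof induction
  case (cos d)
  have "(\<lambda>x. cos (c \<bullet> x) * cos (d \<bullet> x)) =
      (\<lambda>x. 1/2 * cos ((c - d) \<bullet> x) + 1/2 * cos ((c + d) \<bullet> x))"
    by (simp add: cos_times_cos inner_diff_left inner_add_left add_divide_distrib)
  then show ?case by (simp only:) (intro trig_poly.intros)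
next
  case (sin d)
  have "(\<lambda>x. cos (c \<bullet> x) * sin (d \<bullet> x)) =
      (\<lambda>x. 1/2 * sin ((c + d) \<bullet> x) + -1/2 * sin ((c - d) \<bullet> x))"
    by (simp add: cos_times_sin inner_diff_left inner_add_left diff_divide_distrib)
  then show ?case by (simp only:) (intro trig_poly.intros)
next
  case (add p q)
  then show ?case using trig_poly.add by (fastforce simp: algebra_simps)
next
  case (scale p r)
  then show ?case using trig_poly.scale by (fastforce simp: algebra_simps)
qed

lemma trig_poly_sin_mult:
  assumes "trig_poly q" shows "trig_poly (\<lambda>x. sin (c \<bullet> x) * q x)"
  using assms
proof induction
  case (cos d)
  have "(\<lambda>x. sin (c \<bullet> x) * cos (d \<bullet> x)) =
      (\<lambda>x. 1/2 * sin ((c + d) \<bullet> x) + 1/2 * sin ((c - d) \<bullet> x))"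
    by (simp add: sin_times_cos inner_diff_left inner_add_left add_divide_distrib)
  then show ?case by (simp only:) (intro trig_poly.intros)
next
  case (sin d)
  have "(\<lambda>x. sin (c \<bullet> x) * sin (d \<bullet> x)) =
      (\<lambda>x. 1/2 * cos ((c - d) \<bullet> x) + -1/2 * cos ((c + d) \<bullet> x))"
    by (simp add: sin_times_sin inner_diff_left inner_add_left diff_divide_distrib)
  then show ?case by (simp only:) (intro trig_poly.intros)
next
  case (add p q)
  then show ?case using trig_poly.add by (fastforce simp: algebra_simps)
next
  case (scale p r)
  then show ?case using trig_poly.scale by (fastforce simp: algebra_simps)
qed

lemma trig_poly_mult:
  assumes "trig_poly p" "trig_poly q" shows "trig_poly (\<lambda>x. p x * q x)"
  using assms
proof induction
  case (add p p')
  then show ?case using trig_poly.add by (fastforce simp: algebra_simps)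
next
  case (scale p r)
  then show ?case using trig_poly.scale by (fastforce simp: algebra_simps)
qed (simp_all add: trig_poly_cos_mult trig_poly_sin_mult)

lemma trig_poly_bounded_continuous:
  assumes "trig_poly p"
  obtains B where "\<And>x. \<bar>p x\<bar> \<le> B" and "continuous_on UNIV p"
proof -
  have "(\<exists>B. \<forall>x. \<bar>p x\<bar> \<le> B) \<and> continuous_on UNIV p"
    using assms
  proof induction
    case (add p q)
    then obtain B B' where "\<And>x. \<bar>p x\<bar> \<le> B" "\<And>x. \<bar>q x\<bar> \<le> B'" by blast
    then have "\<bar>p x + q x\<bar> \<le> B + B'" for x by (meson abs_triangle_ineq add_mono order_trans)
    then show ?case using add by (auto intro: continuous_intros)
  next
    case (scale p r)
    then obtain B where "\<And>x. \<bar>p x\<bar> \<le> B" by blast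
    then have "\<bar>r * p x\<bar> \<le> \<bar>r\<bar> * B" for x by (simp add: abs_mult mult_left_mono)
    then show ?case using scale by (auto intro: continuous_intros)
  qed (auto intro!: continuous_intros exI[of _ 1])
  then show thesis using that by blast
qed

text \<open>On a large ball \<open>\<phi>\<close> is a continuous function of \<open>sin (s (b \<bullet> x))\<close>, \<open>b \<in> Basis\<close>, hence
  uniformly close to a polynomial in these sines.\<close>

lemma trig_poly_approximation:
  fixes \<phi> :: "'a::euclidean_space \<Rightarrow> real"
  assumes cont: "continuous_on UNIV \<phi>" and bound: "\<And>x. \<bar>\<phi> x\<bar> \<le> B" and "\<epsilon> > 0" "R > 0"
  obtains p where "trig_poly p" "\<And>x. norm x \<le> R \<Longrightarrow> \<bar>\<phi> x - p x\<bar> \<le> \<epsilon>" "\<And>x. \<bar>p x\<bar> \<le> B + \<epsilon>"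
proof -
  \<comment> \<open>On the ball of radius \<open>R\<close> the arguments
    \<open>s * (b \<bullet> x)\<close> stay in [-1, 1], where \<open>arcsin\<close> inverts
    \<open>sin\<close>.\<close>
  define s where "s = 1 / R"
  have s: "s > 0" using \<open>R > 0\<close> by (simp add: s_def)
  define T where "T x = (\<Sum>b\<in>Basis. sin (s * (b \<bullet> x)) *\<^sub>R b)" for x :: 'a
  define T' where "T' y = (\<Sum>b\<in>Basis. (arcsin (y \<bullet> b) / s) *\<^sub>R b)" for y :: 'a
  have T_b: "T x \<bullet> b = sin (s * (b \<bullet> x))" if "b \<in> Basis" for x b
    using that by (simp add: T_def inner_sum_left inner_Basis if_distrib sum.delta cong: if_cong)
  have T_box: "T x \<in> cbox (-One) One" for x
    by (auto simp: mem_box T_b)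
  have T'_T: "T' (T x) = x" if "norm x \<le> R" for x
  proof -
    have "arcsin (T x \<bullet> b) / s = x \<bullet> b" if b: "b \<in> Basis" for b
    proof -
      have "\<bar>b \<bullet> x\<bar> \<le> R"
        using Basis_le_norm[OF b, of x] \<open>norm x \<le> R\<close> by (simp add: inner_commute)
      then have "\<bar>s * (b \<bullet> x)\<bar> \<le> 1"
        using \<open>R > 0\<close> by (simp add: s_def abs_mult)
      then have "\<bar>s * (b \<bullet> x)\<bar> \<le> pi / 2" using pi_ge_two by linarith
      then have "arcsin (sin (s * (b \<bullet> x))) = s * (b \<bullet> x)"
        by (intro arcsin_sin) (auto simp: abs_le_iff)
      then show ?thesis using s by (simp only: T_b[OF b]) (simp add: inner_commute)
    qed
    then show ?thesis unfolding T'_def by (simp add: euclidean_representation)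
  qed
  have "continuous_on (cbox (-One) One) T'"
    unfolding T'_def using s by (intro continuous_intros) (auto simp: mem_box)
  then have "continuous_on (cbox (-One) One) (\<lambda>y. \<phi> (T' y))"
    by (rule continuous_on_compose2[OF cont]) auto
  then obtain g where g: "real_polynomial_function g"
    and approx: "\<And>y. y \<in> cbox (-One) One \<Longrightarrow> \<bar>\<phi> (T' y) - g y\<bar> < \<epsilon>"
    using Stone_Weierstrass_real_polynomial_function[OF compact_cbox _ \<open>\<epsilon> > 0\<close>] by blast
  have "trig_poly (\<lambda>x. g (T x))"
    using g
  proof induction
    case (linear h)
    have "h (T x) = (\<Sum>b\<in>Basis. h b * sin ((s *\<^sub>R b) \<bullet> x))" for x
      using linear by (simp add: T_def linear_sum linear_scale bounded_linear.linear mult.commute)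
    then show ?case by (simp only:) (intro trig_poly_sum trig_poly.intros)
  qed (auto intro: trig_poly_const trig_poly.add trig_poly_mult)
  moreover have "\<bar>\<phi> x - g (T x)\<bar> \<le> \<epsilon>" if "norm x \<le> R" for x
    using approx[OF T_box[of x]] T'_T[OF that] by simp
  \<comment> \<open>\<open>T\<close> maps the whole space into the cube, so this bound is global; it
    controls the trigonometric polynomial outside the ball.\<close>
  moreover have "\<bar>g (T x)\<bar> \<le> B + \<epsilon>" for x
    using approx[OF T_box[of x]] bound[of "T' (T x)"] by linarith
  ultimately show thesis by (rule that)
qed

text \<open>Levy's continuity theorem in several dimensions with tightness assumed: trigonometric
  polynomials approximate \<open>\<phi>\<close> uniformly on a large ball and stay bounded off it,
  where the laws have little mass.\<close>

lemma weak_convergence_from_trig: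
  fixes S :: "nat \<Rightarrow> 'w \<Rightarrow> 'a::euclidean_space"
  assumes "prob_space M" "prob_space N" and sets_N[measurable_cong]: "sets N = sets borel"
    and S[measurable]: "\<And>n. S n \<in> borel_measurable M"
    and cos: "\<And>c. (\<lambda>n. \<integral>\<omega>. cos (c \<bullet> S n \<omega>) \<partial>M) \<longlonglongrightarrow> (\<integral>x. cos (c \<bullet> x) \<partial>N)"
    and sin: "\<And>c. (\<lambda>n. \<integral>\<omega>. sin (c \<bullet> S n \<omega>) \<partial>M) \<longlonglongrightarrow> (\<integral>x. sin (c \<bullet> x) \<partial>N)"
    and tight: "\<And>\<epsilon>. \<epsilon> > 0 \<Longrightarrow>
      \<exists>R. \<forall>\<^sub>F n in sequentially. measure M {\<omega> \<in> space M. norm (S n \<omega>) > R} \<le> \<epsilon>"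
    and cont: "continuous_on UNIV \<phi>" and bounded: "bounded (range \<phi>)"
  shows "(\<lambda>n. \<integral>\<omega>. \<phi> (S n \<omega>) \<partial>M) \<longlonglongrightarrow> (\<integral>x. \<phi> x \<partial>N :: real)"
proof -
  interpret M: prob_space M by fact
  interpret N: prob_space N by fact
  note [measurable] = borel_measurable_continuous_onI[OF cont]
  obtain B where B: "\<And>x. \<bar>\<phi> x\<bar> \<le> B" using bounded by (auto simp: bounded_iff)
  have B0: "B \<ge> 0" using B[of undefined] by linarith
  have trig: "(\<lambda>n. \<integral>\<omega>. p (S n \<omega>) \<partial>M) \<longlonglongrightarrow> (\<integral>x. p x \<partial>N)" if "trig_poly p" for p
    using that
  proof induction
    case (add p q)
    obtain B1 where p: "\<And>x. \<bar>p x\<bar> \<le> B1" "continuous_on UNIV p"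
      using trig_poly_bounded_continuous[OF add.hyps(1)] by blast
    obtain B2 where q: "\<And>x. \<bar>q x\<bar> \<le> B2" "continuous_on UNIV q"
      using trig_poly_bounded_continuous[OF add.hyps(2)] by blast
    note [measurable] = borel_measurable_continuous_onI[OF p(2)] borel_measurable_continuous_onI[OF q(2)]
    have "integrable M (\<lambda>\<omega>. p (S n \<omega>))" for n
      by (rule M.integrable_const_bound[where B=B1]) (simp_all add: p(1))
    moreover have "integrable M (\<lambda>\<omega>. q (S n \<omega>))" for n
      by (rule M.integrable_const_bound[where B=B2]) (simp_all add: q(1))
    moreover have "integrable N p"
      by (rule N.integrable_const_bound[where B=B1]) (simp_all add: p(1))
    moreover have "integrable N q"
      by (rule N.integrable_const_bound[where B=B2]) (simp_all add: q(1))
    ultimately show ?case using add.IH by (auto intro: tendsto_add)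
  next
    case (scale p r)
    then show ?case by (auto intro: tendsto_mult)
  qed (simp_all add: cos sin)
  show ?thesis
  proof (rule LIMSEQ_I)
    fix r :: real assume "r > 0"
    \<comment> \<open>The total error is \<open>(4 * B + 5) * \<epsilon>'\<close>: approximation and
      tail give \<open>\<epsilon>' + (2 * B + 1) * \<epsilon>'\<close> for each of the two laws,
      convergence for \<open>p\<close> gives one more \<open>\<epsilon>'\<close>. The cap at 1
      bounds the difference off the ball by \<open>2 * B + 1\<close>.\<close>
    define \<epsilon> where "\<epsilon> = r / (2 * (4 * B + 5))"
    have \<epsilon>: "\<epsilon> > 0" using \<open>r > 0\<close> B0 by (simp add: \<epsilon>_def)
    define \<epsilon>' where "\<epsilon>' = min \<epsilon> 1"
    have \<epsilon>': "\<epsilon>' > 0" "\<epsilon>' \<le> \<epsilon>" "\<epsilon>' \<le> 1" using \<epsilon> by (auto simp: \<epsilon>'_def)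
    obtain R1 where R1: "\<forall>\<^sub>F n in sequentially. measure M {\<omega> \<in> space M. norm (S n \<omega>) > R1} \<le> \<epsilon>'"
      using tight[OF \<epsilon>'(1)] by blast
    have "(\<lambda>k. measure N {x \<in> space N. norm x > real k}) \<longlonglongrightarrow> measure N (\<Inter>k. {x \<in> space N. norm x > real k})"
      by (rule N.finite_Lim_measure_decseq) (auto simp: decseq_def)
    also have "(\<Inter>k. {x \<in> space N. norm x > real k}) = {}"
    proof -
      have "\<exists>k. \<not> norm x > real k" for x :: 'a
        using real_arch_simple[of "norm x"] by (auto simp: not_less)
      then show ?thesis by blast
    qed
    finally have "\<forall>\<^sub>F k in sequentially. measure N {x \<in> space N. norm x > real k} < \<epsilon>'"
      using \<epsilon>'(1) by (auto dest: order_tendstoD)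
    then obtain k where k: "measure N {x \<in> space N. norm x > real k} < \<epsilon>'"
      using eventually_happens'[OF sequentially_bot] by blast
    define R where "R = max (max R1 (real k)) 1"
    have "R > 0" by (simp add: R_def)
    obtain p where p: "trig_poly p" and close: "\<And>x. norm x \<le> R \<Longrightarrow> \<bar>\<phi> x - p x\<bar> \<le> \<epsilon>'"
      and p_bound: "\<And>x. \<bar>p x\<bar> \<le> B + \<epsilon>'"
      using trig_poly_approximation[OF cont B \<epsilon>'(1) \<open>R > 0\<close>] by blast
    have "continuous_on UNIV p" using trig_poly_bounded_continuous[OF p] by blast
    note [measurable] = borel_measurable_continuous_onI[OF this]
    have pointwise: "\<bar>\<phi> x - p x\<bar> \<le> \<epsilon>' + (2 * B + 1) * indicator {x. norm x > R} x" for x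
      using close[of x] B[of x] p_bound[of x] \<epsilon>' B0
      by (cases "norm x \<le> R") (auto simp: indicator_def)
    have *: "\<bar>(\<integral>\<omega>. \<phi> (s \<omega>) \<partial>Q) - (\<integral>\<omega>. p (s \<omega>) \<partial>Q)\<bar> \<le> \<epsilon>' + (2 * B + 1) * \<epsilon>'"
      if Q: "prob_space Q" and [measurable]: "s \<in> borel_measurable Q"
        and tail: "measure Q {\<omega> \<in> space Q. norm (s \<omega>) > R} \<le> \<epsilon>'" for Q and s :: "'c \<Rightarrow> 'a"
    proof -
      interpret Q: prob_space Q by fact
      have int: "integrable Q (\<lambda>\<omega>. \<phi> (s \<omega>))" "integrable Q (\<lambda>\<omega>. p (s \<omega>))"
        by (rule Q.integrable_const_bound[where B=B], simp_all add: B)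
          (rule Q.integrable_const_bound[where B="B + \<epsilon>'"], simp_all add: p_bound)
      have ind: "integrable Q (indicator {\<omega> \<in> space Q. norm (s \<omega>) > R} :: 'c \<Rightarrow> real)"
        by (rule Q.integrable_const_bound[where B=1]) (auto simp: indicator_def)
      have "\<bar>(\<integral>\<omega>. \<phi> (s \<omega>) \<partial>Q) - (\<integral>\<omega>. p (s \<omega>) \<partial>Q)\<bar> = \<bar>\<integral>\<omega>. \<phi> (s \<omega>) - p (s \<omega>) \<partial>Q\<bar>"
        using int by simp
      also have "\<dots> \<le> (\<integral>\<omega>. \<bar>\<phi> (s \<omega>) - p (s \<omega>)\<bar> \<partial>Q)"
        by (rule integral_abs_bound)
      also have "\<dots> \<le> (\<integral>\<omega>. \<epsilon>' + (2 * B + 1) * indicator {\<omega> \<in> space Q. norm (s \<omega>) > R} \<omega> \<partial>Q)"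
      proof (rule integral_mono)
        show "\<bar>\<phi> (s \<omega>) - p (s \<omega>)\<bar> \<le> \<epsilon>' + (2 * B + 1) * indicator {\<omega> \<in> space Q. norm (s \<omega>) > R} \<omega>"
          if "\<omega> \<in> space Q" for \<omega> using pointwise[of "s \<omega>"] that by (auto simp: indicator_def)
        from ind show "integrable Q (\<lambda>\<omega>. \<epsilon>' + (2 * B + 1) * indicator {\<omega> \<in> space Q. norm (s \<omega>) > R} \<omega>)"
          by simp
      qed (use int in auto)
      also have "\<dots> = \<epsilon>' + (2 * B + 1) * measure Q {\<omega> \<in> space Q. norm (s \<omega>) > R}"
        using ind by (simp add: Q.prob_space Int_def conj_commute)
      also have "\<dots> \<le> \<epsilon>' + (2 * B + 1) * \<epsilon>'"
        using tail B0 by (intro add_left_mono mult_left_mono) auto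
      finally show ?thesis .
    qed
    have "\<forall>\<^sub>F n in sequentially. \<bar>(\<integral>\<omega>. p (S n \<omega>) \<partial>M) - (\<integral>x. p x \<partial>N)\<bar> < \<epsilon>'"
      using tendstoD[OF trig[OF p] \<epsilon>'(1)] by (simp add: dist_real_def)
    with R1 have "\<forall>\<^sub>F n in sequentially. \<bar>(\<integral>\<omega>. \<phi> (S n \<omega>) \<partial>M) - (\<integral>x. \<phi> x \<partial>N)\<bar> < r"
    proof eventually_elim
      case (elim n)
      have "measure M {\<omega> \<in> space M. norm (S n \<omega>) > R} \<le> measure M {\<omega> \<in> space M. norm (S n \<omega>) > R1}"
        by (rule M.finite_measure_mono) (auto simp: R_def)
      with elim have "\<bar>(\<integral>\<omega>. \<phi> (S n \<omega>) \<partial>M) - (\<integral>\<omega>. p (S n \<omega>) \<partial>M)\<bar> \<le> \<epsilon>' + (2 * B + 1) * \<epsilon>'"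
        by (intro *) (auto simp: M.prob_space_axioms)
      moreover have "measure N {x \<in> space N. norm x > R} \<le> measure N {x \<in> space N. norm x > real k}"
        by (rule N.finite_measure_mono) (auto simp: R_def)
      with k have "\<bar>(\<integral>x. \<phi> x \<partial>N) - (\<integral>x. p x \<partial>N)\<bar> \<le> \<epsilon>' + (2 * B + 1) * \<epsilon>'"
        by (intro *) (auto simp: N.prob_space_axioms)
      ultimately have "\<bar>(\<integral>\<omega>. \<phi> (S n \<omega>) \<partial>M) - (\<integral>x. \<phi> x \<partial>N)\<bar> < (4 * B + 5) * \<epsilon>'"
        using elim(2) by (simp add: algebra_simps)
      also have "\<dots> \<le> (4 * B + 5) * \<epsilon>" using \<epsilon>' B0 by (intro mult_left_mono) auto
      also have "(4 * B + 5) * \<epsilon> = r / 2" using B0 by (simp add: \<epsilon>_def field_simps)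
      also have "\<dots> < r" using \<open>r > 0\<close> by simp
      finally show ?case .
    qed
    then show "\<exists>no. \<forall>n\<ge>no. norm ((\<integral>\<omega>. \<phi> (S n \<omega>) \<partial>M) - (\<integral>x. \<phi> x \<partial>N)) < r"
      by (simp add: eventually_sequentially)
  qed
qed

section \<open>Independent identically distributed sequences\<close>

definition iid :: "'w measure \<Rightarrow> (nat \<Rightarrow> 'w \<Rightarrow> 'z::topological_space) \<Rightarrow> bool" where
  "iid M X \<longleftrightarrow> prob_space.indep_vars M (\<lambda>_. borel) X UNIV \<and>
     (\<forall>i. distr M borel (X i) = distr M borel (X 0))"

context prob_space
begin

lemma iid_measurable: "iid M X \<Longrightarrow> X i \<in> borel_measurable M"
  by (simp add: iid_def indep_vars_def)

lemma iid_indep_vars: "iid M X \<Longrightarrow> indep_vars (\<lambda>_. borel) X UNIV"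
  unfolding iid_def by blast

lemma iid_distr: "iid M X \<Longrightarrow> distr M borel (X i) = distr M borel (X 0)"
  unfolding iid_def by blast

lemma iid_compose:
  assumes "iid M X" "F \<in> borel_measurable borel"
  shows "iid M (\<lambda>i \<omega>. F (X i \<omega>))"
proof -
  note [measurable] = iid_measurable[OF assms(1)] assms(2)
  have "distr M borel (\<lambda>\<omega>. F (X i \<omega>)) = distr (distr M borel (X i)) borel F" for i
    by (subst distr_distr) (simp_all add: comp_def)
  then have "distr M borel (\<lambda>\<omega>. F (X i \<omega>)) = distr M borel (\<lambda>\<omega>. F (X 0 \<omega>))" for i
    using iid_distr[OF assms(1), of i] by simp
  moreover have "indep_vars (\<lambda>_. borel) (\<lambda>i \<omega>. F (X i \<omega>)) UNIV"
    by (rule indep_vars_compose2[where M'="\<lambda>_. borel" and X=X and Y="\<lambda>_. F"])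
      (simp_all add: iid_indep_vars[OF assms(1)])
  ultimately show ?thesis unfolding iid_def by blast
qed

lemma iid_integral:
  fixes X :: "nat \<Rightarrow> 'a \<Rightarrow> 'b::{banach, second_countable_topology}"
  assumes "iid M X"
  shows "(\<integral>\<omega>. X i \<omega> \<partial>M) = (\<integral>\<omega>. X 0 \<omega> \<partial>M)" "integrable M (X i) \<longleftrightarrow> integrable M (X 0)"
proof -
  note [measurable] = iid_measurable[OF assms]
  have eq: "distr M borel (X i) = distr M borel (X 0)" using iid_distr[OF assms] .
  have "(\<integral>\<omega>. X j \<omega> \<partial>M) = (\<integral>x. x \<partial>distr M borel (X j))" for j
    by (subst integral_distr) auto
  with eq show "(\<integral>\<omega>. X i \<omega> \<partial>M) = (\<integral>\<omega>. X 0 \<omega> \<partial>M)" by simp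
  have "integrable M (X j) \<longleftrightarrow> integrable (distr M borel (X j)) (\<lambda>x. x)" for j
    by (subst integrable_distr_eq) auto
  with eq show "integrable M (X i) \<longleftrightarrow> integrable M (X 0)" by simp
qed

lemma iid_AE:
  assumes "iid M X" "AE \<omega> in M. P (X 0 \<omega>)" "Measurable.pred borel P"
  shows "AE \<omega> in M. P (X i \<omega>)"
proof -
  note [measurable] = iid_measurable[OF assms(1)]
  have eq: "distr M borel (X i) = distr M borel (X 0)" using iid_distr[OF assms(1)] .
  have "(AE \<omega> in M. P (X j \<omega>)) \<longleftrightarrow> (AE x in distr M borel (X j). P x)" for j
    by (subst AE_distr_iff) (use assms(3) in auto)
  from this[of i] this[of 0] eq assms(2) show ?thesis by (simp only:)
qed

lemma iid_sum_second_moment: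
  fixes X :: "nat \<Rightarrow> 'a \<Rightarrow> real"
  assumes X: "iid M X" and sq: "integrable M (\<lambda>\<omega>. (X 0 \<omega>)\<^sup>2)" and mean: "expectation (X 0) = 0"
  shows "integrable M (\<lambda>\<omega>. (\<Sum>i<n. X i \<omega>)\<^sup>2)"
    "expectation (\<lambda>\<omega>. (\<Sum>i<n. X i \<omega>)\<^sup>2) = n * expectation (\<lambda>\<omega>. (X 0 \<omega>)\<^sup>2)"
proof -
  note [measurable] = iid_measurable[OF X]
  have X2: "iid M (\<lambda>i \<omega>. (X i \<omega>)\<^sup>2)" using iid_compose[OF X, of "\<lambda>x. x\<^sup>2"] by simp
  have sq_i: "integrable M (\<lambda>\<omega>. (X i \<omega>)\<^sup>2)" for i using iid_integral(2)[OF X2, of i] sq by simp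
  have int: "integrable M (X i)" for i
    by (rule square_integrable_imp_integrable[OF _ sq_i]) simp
  have indep: "indep_var borel (X i) borel (X j)" if "i \<noteq> j" for i j
  proof -
    have "indep_vars (\<lambda>_. borel) X {j, i}"
      using iid_indep_vars[OF X] by (rule indep_vars_subset) simp
    from indep_vars_sum[OF _ _ this[THEN indep_vars_subset[of _ _ _ "insert i {j}"]], simplified]
    show ?thesis using that by (simp add: insert_commute)
  qed
  have prod: "integrable M (\<lambda>\<omega>. X i \<omega> * X j \<omega>)"
      "expectation (\<lambda>\<omega>. X i \<omega> * X j \<omega>) = (if i = j then expectation (\<lambda>\<omega>. (X 0 \<omega>)\<^sup>2) else 0)" for i j
    using indep_var_integrable[OF indep int int, of i j] indep_var_lebesgue_integral[OF indep int int, of i j]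
      sq_i[of i] iid_integral(1)[OF X2, of i] iid_integral(1)[OF X, of i] mean
    by (cases "i = j"; simp add: power2_eq_square)+
  have eq: "(\<Sum>i<n. X i \<omega>)\<^sup>2 = (\<Sum>i<n. \<Sum>j<n. X i \<omega> * X j \<omega>)" for \<omega>
    by (simp add: power2_eq_square sum_product)
  show "integrable M (\<lambda>\<omega>. (\<Sum>i<n. X i \<omega>)\<^sup>2)"
    unfolding eq by (intro Bochner_Integration.integrable_sum prod)
  show "expectation (\<lambda>\<omega>. (\<Sum>i<n. X i \<omega>)\<^sup>2) = n * expectation (\<lambda>\<omega>. (X 0 \<omega>)\<^sup>2)"
    unfolding eq by (simp add: prod Bochner_Integration.integral_sum sum.delta)
qed

text \<open>Convergence in mean lets finitely many deviations be added by linearity. The law is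
  applied to products of two square integrable components, which have only a first moment; hence the
  truncation at level \<open>k\<close>, after which a variance bound applies.\<close>

lemma weak_law_of_large_numbers_L1:
  fixes X :: "nat \<Rightarrow> 'a \<Rightarrow> real"
  assumes X: "iid M X" and int: "integrable M (X 0)"
  shows "(\<lambda>n. expectation (\<lambda>\<omega>. \<bar>(\<Sum>i<n. X i \<omega>) / n - expectation (X 0)\<bar>)) \<longlonglongrightarrow> 0"
proof (rule LIMSEQ_I)
  note [measurable] = iid_measurable[OF X]
  have int_i: "integrable M (X i)" for i using iid_integral(2)[OF X, of i] int by simp
  fix r :: real assume "r > 0"
  define t where "t k x = x * indicator {x. \<bar>x\<bar> \<le> real k} x" for k and x :: real
  have t_meas[measurable]: "t k \<in> borel_measurable borel" for k unfolding t_def by measurable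
  have t_bound: "\<bar>t k x\<bar> \<le> real k" "\<bar>t k x\<bar> \<le> \<bar>x\<bar>" for k x by (auto simp: t_def indicator_def)
  have "(\<lambda>k. expectation (\<lambda>\<omega>. \<bar>X 0 \<omega> - t k (X 0 \<omega>)\<bar>)) \<longlonglongrightarrow> expectation (\<lambda>\<omega>. 0)"
  proof (rule integral_dominated_convergence[where w="\<lambda>\<omega>. 2 * \<bar>X 0 \<omega>\<bar>"])
    show "AE \<omega> in M. (\<lambda>k. \<bar>X 0 \<omega> - t k (X 0 \<omega>)\<bar>) \<longlonglongrightarrow> 0"
    proof (intro always_eventually allI)
      fix \<omega>
      obtain k0 where k0: "\<bar>X 0 \<omega>\<bar> \<le> real k0" using real_arch_simple by blast
      have "\<forall>\<^sub>F k in sequentially. \<bar>X 0 \<omega> - t k (X 0 \<omega>)\<bar> = 0"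
        using eventually_ge_at_top[of k0] by eventually_elim (use k0 in \<open>auto simp: t_def indicator_def\<close>)
      then show "(\<lambda>k. \<bar>X 0 \<omega> - t k (X 0 \<omega>)\<bar>) \<longlonglongrightarrow> 0" by (rule tendsto_eventually)
    qed
    show "AE \<omega> in M. norm \<bar>X 0 \<omega> - t k (X 0 \<omega>)\<bar> \<le> 2 * \<bar>X 0 \<omega>\<bar>" for k
      using t_bound(2)[of k] by (intro always_eventually allI) (simp, smt (verit))
  qed (use int in auto)
  then have "\<forall>\<^sub>F k in sequentially. expectation (\<lambda>\<omega>. \<bar>X 0 \<omega> - t k (X 0 \<omega>)\<bar>) < r / 4"
    using \<open>r > 0\<close> by (intro order_tendstoD(2)) auto
  then obtain k where k: "expectation (\<lambda>\<omega>. \<bar>X 0 \<omega> - t k (X 0 \<omega>)\<bar>) < r / 4"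
    using eventually_happens'[OF sequentially_bot] by blast
  have t_int: "integrable M (\<lambda>\<omega>. t k (X i \<omega>))" for i
    by (rule Bochner_Integration.integrable_bound[OF int_i[of i]]) (auto simp: t_bound)
  define m where "m = expectation (\<lambda>\<omega>. t k (X 0 \<omega>))"
  define Y where "Y i \<omega> = t k (X i \<omega>) - m" for i \<omega>
  have Y: "iid M Y" unfolding Y_def[abs_def] using iid_compose[OF X, of "\<lambda>x. t k x - m"] by simp
  note [measurable] = iid_measurable[OF Y]
  have Y_bound: "\<bar>Y i \<omega>\<bar> \<le> real k + \<bar>m\<bar>" for i \<omega>
    using t_bound(1)[of k "X i \<omega>"] unfolding Y_def by linarith
  have Y_sq: "integrable M (\<lambda>\<omega>. (Y 0 \<omega>)\<^sup>2)"
    by (rule integrable_const_bound[where B="(real k + \<bar>m\<bar>)\<^sup>2"])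
      (use Y_bound[of 0] in \<open>auto simp: abs_le_square_iff[symmetric]\<close>)
  have Y_mean: "expectation (Y 0) = 0"
    using t_int by (simp add: Y_def[abs_def] m_def prob_space)
  note Y_sum = iid_sum_second_moment[OF Y Y_sq Y_mean]
  define s where "s = expectation (\<lambda>\<omega>. (Y 0 \<omega>)\<^sup>2)"
  have "s \<ge> 0" by (simp add: s_def)
  have diff: "iid M (\<lambda>i \<omega>. \<bar>X i \<omega> - t k (X i \<omega>)\<bar>)"
    using iid_compose[OF X, of "\<lambda>x. \<bar>x - t k x\<bar>"] by simp
  have diff_int: "integrable M (\<lambda>\<omega>. \<bar>X i \<omega> - t k (X i \<omega>)\<bar>)" for i using int_i t_int by auto
  \<comment> \<open>One \<open>r / 4\<close> comes from bounding \<open>\<bar>u\<bar>\<close> by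
    \<open>u\<^sup>2 / r + r / 4\<close>, the other two from the truncation, once in the sum and
    once in the mean.\<close>
  have bound: "expectation (\<lambda>\<omega>. \<bar>(\<Sum>i<n. X i \<omega>) / n - expectation (X 0)\<bar>) < 3 * r / 4 + s / (r * n)"
    if "n > 0" for n
  proof -
    have pointwise: "\<bar>(\<Sum>i<n. X i \<omega>) / n - expectation (X 0)\<bar> \<le>
      (\<Sum>i<n. Y i \<omega>)\<^sup>2 / (n\<^sup>2 * r) + r / 4 + (\<Sum>i<n. \<bar>X i \<omega> - t k (X i \<omega>)\<bar>) / n + \<bar>m - expectation (X 0)\<bar>" for \<omega>
    proof -
      have "(\<Sum>i<n. X i \<omega>) = (\<Sum>i<n. Y i \<omega>) + (\<Sum>i<n. X i \<omega> - t k (X i \<omega>)) + n * m"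
        by (simp add: Y_def sum_subtractf)
      then have "(\<Sum>i<n. X i \<omega>) / n - expectation (X 0) =
          (\<Sum>i<n. Y i \<omega>) / n + (\<Sum>i<n. X i \<omega> - t k (X i \<omega>)) / n + (m - expectation (X 0))"
        using that by (simp add: field_simps)
      moreover have "\<bar>(\<Sum>i<n. X i \<omega> - t k (X i \<omega>)) / n\<bar> \<le> (\<Sum>i<n. \<bar>X i \<omega> - t k (X i \<omega>)\<bar>) / n"
        by (simp add: divide_right_mono)
      \<comment> \<open>Completing the square passes from the first to the second moment of the
        truncated sum without a square root.\<close>
      moreover have "\<bar>u\<bar> \<le> u\<^sup>2 / r + r / 4" for u :: real
      proof -
        have "0 \<le> (\<bar>u\<bar> - r / 2)\<^sup>2 / r" using \<open>r > 0\<close> by simp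
        also have "\<dots> = u\<^sup>2 / r + r / 4 - \<bar>u\<bar>" using \<open>r > 0\<close> by (simp add: power2_eq_square field_simps)
        finally show ?thesis by simp
      qed
      from this[of "(\<Sum>i<n. Y i \<omega>) / n"]
      have "\<bar>(\<Sum>i<n. Y i \<omega>) / n\<bar> \<le> (\<Sum>i<n. Y i \<omega>)\<^sup>2 / (n\<^sup>2 * r) + r / 4"
        by (simp add: power_divide)
      ultimately show ?thesis by linarith
    qed
    have "expectation (\<lambda>\<omega>. \<bar>(\<Sum>i<n. X i \<omega>) / n - expectation (X 0)\<bar>) \<le>
      expectation (\<lambda>\<omega>. (\<Sum>i<n. Y i \<omega>)\<^sup>2 / (n\<^sup>2 * r) + r / 4 + (\<Sum>i<n. \<bar>X i \<omega> - t k (X i \<omega>)\<bar>) / n + \<bar>m - expectation (X 0)\<bar>)"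
      by (rule integral_mono)
        (use pointwise int_i diff_int Y_sum(1) in \<open>auto intro!: Bochner_Integration.integrable_add Bochner_Integration.integrable_diff integrable_abs\<close>)
    also have "\<dots> = (n * s) / (n\<^sup>2 * r) + r / 4 + (\<Sum>i<n. expectation (\<lambda>\<omega>. \<bar>X i \<omega> - t k (X i \<omega>)\<bar>)) / n + \<bar>m - expectation (X 0)\<bar>"
      using diff_int Y_sum by (simp add: prob_space s_def)
    also have "(\<Sum>i<n. expectation (\<lambda>\<omega>. \<bar>X i \<omega> - t k (X i \<omega>)\<bar>)) / n = expectation (\<lambda>\<omega>. \<bar>X 0 \<omega> - t k (X 0 \<omega>)\<bar>)"
      using that by (subst iid_integral(1)[OF diff]) simp
    also have "\<bar>m - expectation (X 0)\<bar> = \<bar>expectation (\<lambda>\<omega>. t k (X 0 \<omega>) - X 0 \<omega>)\<bar>"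
      using t_int int by (simp add: m_def)
    also have "\<dots> \<le> expectation (\<lambda>\<omega>. \<bar>t k (X 0 \<omega>) - X 0 \<omega>\<bar>)" by (rule integral_abs_bound)
    also have "\<dots> = expectation (\<lambda>\<omega>. \<bar>X 0 \<omega> - t k (X 0 \<omega>)\<bar>)" by (simp add: abs_minus_commute)
    also have "(n * s) / (n\<^sup>2 * r) = s / (r * n)" using that by (simp add: power2_eq_square field_simps)
    finally show ?thesis using k by linarith
  qed
  have lim: "(\<lambda>n. 3 * r / 4 + s / (r * real n)) \<longlonglongrightarrow> 3 * r / 4 + 0"
    using \<open>r > 0\<close> by (intro tendsto_add tendsto_const tendsto_divide_0[OF tendsto_const]
      filterlim_at_top_imp_at_infinity filterlim_tendsto_pos_mult_at_top[OF tendsto_const] filterlim_real_sequentially)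
  then have "\<forall>\<^sub>F n in sequentially. 3 * r / 4 + s / (r * real n) < r"
    using \<open>r > 0\<close> order_tendstoD(2)[OF lim, of r] by simp
  then have "\<forall>\<^sub>F n in sequentially.
      norm (expectation (\<lambda>\<omega>. \<bar>(\<Sum>i<n. X i \<omega>) / n - expectation (X 0)\<bar>) - 0) < r"
    using eventually_gt_at_top[of 0]
  proof eventually_elim
    case (elim n)
    have "expectation (\<lambda>\<omega>. \<bar>(\<Sum>i<n. X i \<omega>) / n - expectation (X 0)\<bar>) \<ge> 0" by simp
    with bound[OF elim(2)] elim(1) show ?case by simp
  qed
  then show "\<exists>no. \<forall>n\<ge>no.
      norm (expectation (\<lambda>\<omega>. \<bar>(\<Sum>i<n. X i \<omega>) / n - expectation (X 0)\<bar>) - 0) < r"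
    by (simp only: eventually_sequentially)
qed

text \<open>With zero variance the sums vanish almost surely and the limit is the point mass.
  Otherwise the sums are standardised and the scale \<open>sqrt v\<close> is moved into the test
  function.\<close>

lemma central_limit_theorem_integral:
  fixes X :: "nat \<Rightarrow> 'a \<Rightarrow> real" and \<phi> :: "real \<Rightarrow> real"
  assumes X: "iid M X" and sq: "integrable M (\<lambda>\<omega>. (X 0 \<omega>)\<^sup>2)" and mean: "expectation (X 0) = 0"
    and cont: "continuous_on UNIV \<phi>" and bound: "\<And>x. \<bar>\<phi> x\<bar> \<le> B"
  shows "(\<lambda>n. \<integral>\<omega>. \<phi> ((\<Sum>i<n. X i \<omega>) / sqrt n) \<partial>M) \<longlonglongrightarrow>
    (\<integral>x. \<phi> x \<partial>centred_normal (expectation (\<lambda>\<omega>. (X 0 \<omega>)\<^sup>2)))"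
proof -
  note [measurable] = iid_measurable[OF X] borel_measurable_continuous_onI[OF cont]
  define v where "v = expectation (\<lambda>\<omega>. (X 0 \<omega>)\<^sup>2)"
  have "v \<ge> 0" by (simp add: v_def)
  have X2: "iid M (\<lambda>i \<omega>. (X i \<omega>)\<^sup>2)" using iid_compose[OF X, of "\<lambda>x. x\<^sup>2"] by simp
  have sq_i: "integrable M (\<lambda>\<omega>. (X i \<omega>)\<^sup>2)" for i using iid_integral(2)[OF X2, of i] sq by simp
  have mean_i: "expectation (X i) = 0" for i using iid_integral(1)[OF X, of i] mean by simp
  have normal: "(\<integral>x. \<phi> x \<partial>centred_normal v) = (\<integral>x. \<phi> (sqrt v * x) \<partial>std_normal_distribution)"
    unfolding centred_normal_eq_distr[OF \<open>v \<ge> 0\<close>] by (subst integral_distr) auto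
  show ?thesis
  proof (cases "v = 0")
    case True
    have "AE \<omega> in M. X i \<omega> = 0" for i
      using integral_nonneg_eq_0_iff_AE[OF sq_i[of i]] True iid_integral(1)[OF X2, of i] by (simp add: v_def)
    then have "AE \<omega> in M. \<forall>i. X i \<omega> = 0" by (simp add: AE_all_countable)
    then have "(\<integral>\<omega>. \<phi> ((\<Sum>i<n. X i \<omega>) / sqrt n) \<partial>M) = (\<integral>\<omega>. \<phi> 0 \<partial>M)" for n
      by (intro integral_cong_AE) auto
    moreover interpret N: prob_space std_normal_distribution
      by (rule real_distribution.axioms[OF real_dist_normal_dist])
    have "(\<integral>x. \<phi> x \<partial>centred_normal v) = \<phi> 0"
      unfolding normal using True N.prob_space by simp
    ultimately show ?thesis by (simp add: prob_space v_def)
  next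
    case False
    with \<open>v \<ge> 0\<close> have "v > 0" by simp
    have "weak_conv_m (\<lambda>n. distr M borel (\<lambda>x. (\<Sum>i<n. X i x) / sqrt (n * (sqrt v)\<^sup>2))) std_normal_distribution"
    proof (rule central_limit_theorem_zero_mean)
      show "indep_vars (\<lambda>i. borel) X UNIV" using X by (rule iid_indep_vars)
      show "distr M borel (X n) = distr M borel (X 0)" for n using X by (rule iid_distr)
      show "variance (X n) = (sqrt v)\<^sup>2" for n
        using iid_integral(1)[OF X2, of n] \<open>v > 0\<close> by (simp add: mean_i v_def)
    qed (use mean_i sq_i \<open>v > 0\<close> in auto)
    then have "(\<lambda>n. integral\<^sup>L (distr M borel (\<lambda>x. (\<Sum>i<n. X i x) / sqrt (n * (sqrt v)\<^sup>2))) (\<lambda>x. \<phi> (sqrt v * x)))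
      \<longlonglongrightarrow> (\<integral>x. \<phi> (sqrt v * x) \<partial>std_normal_distribution)"
    proof (rule weak_conv_imp_integral_bdd_continuous_conv[rotated 2])
      show "isCont (\<lambda>x. \<phi> (sqrt v * x)) x" for x
        using continuous_on_compose2[OF cont, of UNIV "\<lambda>x. sqrt v * x"]
        by (auto simp: continuous_on_eq_continuous_at intro: continuous_intros)
      show "norm (\<phi> (sqrt v * x)) \<le> B" for x using bound by simp
    qed (auto intro: real_dist_normal_dist real_distribution_distr)
    moreover have "integral\<^sup>L (distr M borel (\<lambda>x. (\<Sum>i<n. X i x) / sqrt (n * (sqrt v)\<^sup>2))) (\<lambda>x. \<phi> (sqrt v * x)) =
      (\<integral>\<omega>. \<phi> ((\<Sum>i<n. X i \<omega>) / sqrt n) \<partial>M)" for n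
      using \<open>v > 0\<close> by (subst integral_distr) (auto simp: real_sqrt_mult)
    ultimately show ?thesis using normal by (simp add: v_def)
  qed
qed

lemma square_integrable_imp_integrable_vector:
  fixes X :: "'a \<Rightarrow> 'b::euclidean_space"
  assumes "X \<in> borel_measurable M" "integrable M (\<lambda>\<omega>. (norm (X \<omega>))\<^sup>2)"
  shows "integrable M X"
proof -
  have "integrable M (\<lambda>\<omega>. norm (X \<omega>))"
    by (rule square_integrable_imp_integrable) (use assms in auto)
  then show ?thesis using assms(1) by (simp add: integrable_norm_iff)
qed

lemma integrable_inner_scaleR_self:
  fixes X :: "'a \<Rightarrow> 'b::euclidean_space"
  assumes [measurable]: "X \<in> borel_measurable M" and sq: "integrable M (\<lambda>\<omega>. (norm (X \<omega>))\<^sup>2)"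
  shows "integrable M (\<lambda>\<omega>. (X \<omega> \<bullet> d) *\<^sub>R X \<omega>)"
proof (rule Bochner_Integration.integrable_bound)
  show "integrable M (\<lambda>\<omega>. norm d * (norm (X \<omega>))\<^sup>2)" using sq by simp
  have "\<bar>x \<bullet> d\<bar> * norm x \<le> norm d * (norm x)\<^sup>2" for x :: 'b
    using mult_right_mono[OF Cauchy_Schwarz_ineq2[of x d] norm_ge_zero[of x]]
    by (simp add: power2_eq_square mult_ac)
  then show "AE \<omega> in M. norm ((X \<omega> \<bullet> d) *\<^sub>R X \<omega>) \<le> norm (norm d * (norm (X \<omega>))\<^sup>2)"
    by (intro always_eventually allI) simp
qed simp

lemma iid_normalized_sum_second_moment:
  fixes X :: "nat \<Rightarrow> 'a \<Rightarrow> 'b::euclidean_space"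
  assumes X: "iid M X" and sq: "integrable M (\<lambda>\<omega>. (norm (X 0 \<omega>))\<^sup>2)" and mean: "expectation (X 0) = 0"
  shows "integrable M (\<lambda>\<omega>. (norm ((1 / sqrt n) *\<^sub>R (\<Sum>i<n. X i \<omega>)))\<^sup>2)"
    "expectation (\<lambda>\<omega>. (norm ((1 / sqrt n) *\<^sub>R (\<Sum>i<n. X i \<omega>)))\<^sup>2) \<le> expectation (\<lambda>\<omega>. (norm (X 0 \<omega>))\<^sup>2)"
proof -
  note [measurable] = iid_measurable[OF X]
  have norm_sq: "(norm x)\<^sup>2 = (\<Sum>b\<in>Basis. (b \<bullet> x)\<^sup>2)" for x :: 'b
    by (subst power2_norm_eq_inner, subst euclidean_inner) (simp add: power2_eq_square inner_commute)
  have int: "integrable M (X 0)"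
    by (rule square_integrable_imp_integrable_vector[OF _ sq]) simp
  have b: "iid M (\<lambda>i \<omega>. b \<bullet> X i \<omega>)" "integrable M (\<lambda>\<omega>. (b \<bullet> X 0 \<omega>)\<^sup>2)" "expectation (\<lambda>\<omega>. b \<bullet> X 0 \<omega>) = 0"
    if "b \<in> Basis" for b
  proof -
    show "iid M (\<lambda>i \<omega>. b \<bullet> X i \<omega>)" by (rule iid_compose[OF X]) simp
    show "integrable M (\<lambda>\<omega>. (b \<bullet> X 0 \<omega>)\<^sup>2)"
    proof (rule Bochner_Integration.integrable_bound[OF sq])
      have "\<bar>b \<bullet> x\<bar> \<le> norm x" for x
        using Basis_le_norm[OF that, of x] by (simp add: inner_commute)
      then show "AE \<omega> in M. norm ((b \<bullet> X 0 \<omega>)\<^sup>2) \<le> norm ((norm (X 0 \<omega>))\<^sup>2)"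
        by (intro always_eventually allI) (simp add: abs_le_square_iff[symmetric])
    qed simp
    show "expectation (\<lambda>\<omega>. b \<bullet> X 0 \<omega>) = 0" using int mean by simp
  qed
  note sums = iid_sum_second_moment[OF b]
  have eq: "(norm ((1 / sqrt n) *\<^sub>R (\<Sum>i<n. X i \<omega>)))\<^sup>2 = (\<Sum>b\<in>Basis. (\<Sum>i<n. b \<bullet> X i \<omega>)\<^sup>2) / n" for \<omega>
    by (simp only: norm_sq) (simp add: power_mult_distrib power_divide inner_sum_right flip: sum_divide_distrib)
  show "integrable M (\<lambda>\<omega>. (norm ((1 / sqrt n) *\<^sub>R (\<Sum>i<n. X i \<omega>)))\<^sup>2)"
    unfolding eq using sums(1) by simp
  have "expectation (\<lambda>\<omega>. (\<Sum>b\<in>Basis. (\<Sum>i<n. b \<bullet> X i \<omega>)\<^sup>2) / n) =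
      (\<Sum>b\<in>Basis. n * expectation (\<lambda>\<omega>. (b \<bullet> X 0 \<omega>)\<^sup>2)) / n"
    using sums by simp
  \<comment> \<open>For \<open>n = 0\<close> the normalised sum is zero, so only an inequality holds
    for all \<open>n\<close>.\<close>
  also have "\<dots> = (if n = 0 then 0 else (\<Sum>b\<in>Basis. expectation (\<lambda>\<omega>. (b \<bullet> X 0 \<omega>)\<^sup>2)))"
    by (simp flip: sum_distrib_left)
  also have "\<dots> \<le> (\<Sum>b\<in>Basis. expectation (\<lambda>\<omega>. (b \<bullet> X 0 \<omega>)\<^sup>2))"
    by (auto intro!: sum_nonneg)
  also have "\<dots> = expectation (\<lambda>\<omega>. (norm (X 0 \<omega>))\<^sup>2)"
    unfolding norm_sq using b(2) by simp
  finally show "expectation (\<lambda>\<omega>. (norm ((1 / sqrt n) *\<^sub>R (\<Sum>i<n. X i \<omega>)))\<^sup>2) \<le> expectation (\<lambda>\<omega>. (norm (X 0 \<omega>))\<^sup>2)"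
    unfolding eq .
qed

end

section \<open>Asymptotically linear estimators\<close>

context prob_space
begin

text \<open>The central limit theorem along each functional \<open>c\<close> handles the normalised
  sums; bounded Lipschitz test functions, among them sine and cosine, transfer the limit to
  \<open>S\<close>. Tightness comes from the uniform second moment bound and the small
  remainder.\<close>

lemma asymptotically_linear_imp_gaussian:
  fixes \<psi> :: "nat \<Rightarrow> 'a \<Rightarrow> 'b::euclidean_space"
  assumes \<psi>: "iid M \<psi>" and sq: "integrable M (\<lambda>\<omega>. (norm (\<psi> 0 \<omega>))\<^sup>2)" and mean: "expectation (\<psi> 0) = 0"
    and S[measurable]: "\<And>n. S n \<in> borel_measurable M"
    and remainder: "\<And>\<epsilon>. \<epsilon> > 0 \<Longrightarrow>
      (\<lambda>n. prob {\<omega> \<in> space M. norm (S n \<omega> - (1 / sqrt n) *\<^sub>R (\<Sum>i<n. \<psi> i \<omega>)) > \<epsilon>}) \<longlonglongrightarrow> 0"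
  shows "converges_to_gaussian M S (\<lambda>d. expectation (\<lambda>\<omega>. (\<psi> 0 \<omega> \<bullet> d) *\<^sub>R \<psi> 0 \<omega>))"
proof -
  note [measurable] = iid_measurable[OF \<psi>]
  define \<Sigma> where "\<Sigma> d = expectation (\<lambda>\<omega>. (\<psi> 0 \<omega> \<bullet> d) *\<^sub>R \<psi> 0 \<omega>)" for d
  define T where "T n \<omega> = (1 / sqrt n) *\<^sub>R (\<Sum>i<n. \<psi> i \<omega>)" for n :: nat and \<omega>
  have T_meas[measurable]: "T n \<in> borel_measurable M" for n unfolding T_def by measurable
  define m where "m = expectation (\<lambda>\<omega>. (norm (\<psi> 0 \<omega>))\<^sup>2)"
  have m: "m \<ge> 0" by (simp add: m_def)
  have int_\<Sigma>: "integrable M (\<lambda>\<omega>. (\<psi> 0 \<omega> \<bullet> d) *\<^sub>R \<psi> 0 \<omega>)" for d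
    by (rule integrable_inner_scaleR_self[OF _ sq]) simp
  have quad: "c \<bullet> \<Sigma> d = expectation (\<lambda>\<omega>. (\<psi> 0 \<omega> \<bullet> c) * (\<psi> 0 \<omega> \<bullet> d))" for c d
  proof -
    have "c \<bullet> \<Sigma> d = expectation (\<lambda>\<omega>. c \<bullet> ((\<psi> 0 \<omega> \<bullet> d) *\<^sub>R \<psi> 0 \<omega>))"
      unfolding \<Sigma>_def by (rule integral_inner_right[OF int_\<Sigma>, symmetric])
    then show ?thesis by (simp add: inner_commute mult.commute)
  qed
  have lin: "linear \<Sigma>"
    using int_\<Sigma> by (intro linearI) (simp_all add: \<Sigma>_def inner_add_right scaleR_left_distrib flip: scaleR_scaleR)
  have sym: "c \<bullet> \<Sigma> d = \<Sigma> c \<bullet> d" for c d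
    by (subst inner_commute[of "\<Sigma> c"]) (simp add: quad mult.commute)
  have psd: "0 \<le> c \<bullet> \<Sigma> c" for c
    unfolding quad by (rule integral_nonneg_AE) simp
  obtain N where N: "centred_gaussian N \<Sigma>" and pN: "prob_space N"
    using centred_gaussian_exists[OF lin sym psd] by blast
  have sets_N[measurable_cong]: "sets N = sets borel" using N by (simp add: centred_gaussian_def)
  have limit: "(\<lambda>n. \<integral>\<omega>. h (c \<bullet> S n \<omega>) \<partial>M) \<longlonglongrightarrow> (\<integral>x. h (c \<bullet> x) \<partial>N)"
    if h: "continuous_on UNIV h" "\<And>x. \<bar>h x\<bar> \<le> 1" "\<And>x y. \<bar>h x - h y\<bar> \<le> \<bar>x - y\<bar>" for h :: "real \<Rightarrow> real" and c
  proof -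
    note [measurable] = borel_measurable_continuous_onI[OF h(1)]
    define X where "X i \<omega> = c \<bullet> \<psi> i \<omega>" for i \<omega>
    have "iid M X" unfolding X_def[abs_def] by (rule iid_compose[OF \<psi>]) simp
    moreover have X_sq: "integrable M (\<lambda>\<omega>. (X 0 \<omega>)\<^sup>2)"
    proof -
      have eq: "(X 0 \<omega>)\<^sup>2 = c \<bullet> ((\<psi> 0 \<omega> \<bullet> c) *\<^sub>R \<psi> 0 \<omega>)" for \<omega>
        by (simp add: X_def power2_eq_square inner_commute)
      show ?thesis unfolding eq by (intro integrable_inner_right int_\<Sigma>)
    qed
    moreover have "expectation (X 0) = 0"
      using square_integrable_imp_integrable_vector[OF _ sq] mean by (simp add: X_def[abs_def])
    ultimately have "(\<lambda>n. \<integral>\<omega>. h ((\<Sum>i<n. X i \<omega>) / sqrt n) \<partial>M) \<longlonglongrightarrow>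
        (\<integral>x. h x \<partial>centred_normal (expectation (\<lambda>\<omega>. (X 0 \<omega>)\<^sup>2)))"
      using h by (intro central_limit_theorem_integral) auto
    also have "expectation (\<lambda>\<omega>. (X 0 \<omega>)\<^sup>2) = c \<bullet> \<Sigma> c"
      unfolding quad by (simp add: X_def power2_eq_square inner_commute)
    also have "centred_normal (c \<bullet> \<Sigma> c) = distr N borel (\<lambda>x. c \<bullet> x)"
      using N by (simp add: centred_gaussian_def)
    also have "(\<integral>x. h x \<partial>distr N borel (\<lambda>x. c \<bullet> x)) = (\<integral>x. h (c \<bullet> x) \<partial>N)"
      by (subst integral_distr) auto
    finally have T_lim: "(\<lambda>n. \<integral>\<omega>. h (c \<bullet> T n \<omega>) \<partial>M) \<longlonglongrightarrow> (\<integral>x. h (c \<bullet> x) \<partial>N)"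
      by (simp add: X_def T_def inner_sum_right)
    have int: "integrable M (\<lambda>\<omega>. h (c \<bullet> S n \<omega>))" "integrable M (\<lambda>\<omega>. h (c \<bullet> T n \<omega>))" for n
      by (rule integrable_const_bound[where B=1]; simp add: h(2))+
    have "(\<lambda>n. (\<integral>\<omega>. h (c \<bullet> S n \<omega>) \<partial>M) - (\<integral>\<omega>. h (c \<bullet> T n \<omega>) \<partial>M)) \<longlonglongrightarrow> 0"
    proof (rule LIMSEQ_I)
      fix r :: real assume "r > 0"
      \<comment> \<open>Off the exceptional event the test function changes by at most
        \<open>norm c * \<epsilon>\<close>, hence by at most \<open>r / 2\<close>; the additive 1
        covers \<open>c = 0\<close>.\<close>
      define \<epsilon> where "\<epsilon> = r / 2 / (norm c + 1)"
      have "\<epsilon> > 0" using \<open>r > 0\<close> by (simp add: \<epsilon>_def add_nonneg_pos)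
      let ?A = "\<lambda>n. {\<omega> \<in> space M. norm (S n \<omega> - T n \<omega>) > \<epsilon>}"
      have "norm c * \<epsilon> \<le> (norm c + 1) * \<epsilon>" using \<open>\<epsilon> > 0\<close> by simp
      also have "\<dots> = r / 2"
      proof -
        have "norm c + 1 \<noteq> 0" using norm_ge_zero[of c] by linarith
        moreover have "a * (x / a) = x" if "a \<noteq> 0" for a x :: real using that by simp
        ultimately show ?thesis unfolding \<epsilon>_def by blast
      qed
      finally have c\<epsilon>: "norm c * \<epsilon> \<le> r / 2" .
      have "\<forall>\<^sub>F n in sequentially. prob (?A n) < r / 4"
        using order_tendstoD(2)[OF remainder[OF \<open>\<epsilon> > 0\<close>], of "r / 4"] \<open>r > 0\<close> by (simp add: T_def)
      then obtain n0 where n0: "\<And>n. n \<ge> n0 \<Longrightarrow> prob (?A n) < r / 4"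
        by (auto simp: eventually_sequentially)
      have "norm ((\<integral>\<omega>. h (c \<bullet> S n \<omega>) \<partial>M) - (\<integral>\<omega>. h (c \<bullet> T n \<omega>) \<partial>M) - 0) < r" if "n \<ge> n0" for n
      proof -
        have ind: "integrable M (indicator (?A n) :: 'a \<Rightarrow> real)"
          by (rule integrable_const_bound[where B=1]) (auto simp: indicator_def)
        have "norm ((\<integral>\<omega>. h (c \<bullet> S n \<omega>) \<partial>M) - (\<integral>\<omega>. h (c \<bullet> T n \<omega>) \<partial>M) - 0) =
            \<bar>\<integral>\<omega>. h (c \<bullet> S n \<omega>) - h (c \<bullet> T n \<omega>) \<partial>M\<bar>" using int by simp
        also have "\<dots> \<le> (\<integral>\<omega>. \<bar>h (c \<bullet> S n \<omega>) - h (c \<bullet> T n \<omega>)\<bar> \<partial>M)" by (rule integral_abs_bound)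
        also have "\<dots> \<le> (\<integral>\<omega>. r / 2 + 2 * indicator (?A n) \<omega> \<partial>M)"
        proof (rule integral_mono)
          fix \<omega> assume \<omega>: "\<omega> \<in> space M"
          show "\<bar>h (c \<bullet> S n \<omega>) - h (c \<bullet> T n \<omega>)\<bar> \<le> r / 2 + 2 * indicator (?A n) \<omega>"
          proof (cases "\<omega> \<in> ?A n")
            case True
            then show ?thesis using h(2)[of "c \<bullet> S n \<omega>"] h(2)[of "c \<bullet> T n \<omega>"] \<open>r > 0\<close> by simp
          next
            case False
            have "\<bar>h (c \<bullet> S n \<omega>) - h (c \<bullet> T n \<omega>)\<bar> \<le> \<bar>c \<bullet> (S n \<omega> - T n \<omega>)\<bar>"
              using h(3)[of "c \<bullet> S n \<omega>" "c \<bullet> T n \<omega>"] by (simp add: inner_diff_right)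
            also have "\<dots> \<le> norm c * norm (S n \<omega> - T n \<omega>)" by (rule Cauchy_Schwarz_ineq2)
            also have "\<dots> \<le> norm c * \<epsilon>" using False \<omega> by (intro mult_left_mono) auto
            finally show ?thesis using False c\<epsilon> by simp
          qed
        qed (use int ind in auto)
        also have "\<dots> = r / 2 + 2 * prob (?A n)"
          using ind by (simp add: prob_space Int_def conj_commute)
        also have "\<dots> < r" using n0[OF that] by simp
        finally show ?thesis .
      qed
      then show "\<exists>n0. \<forall>n\<ge>n0. norm ((\<integral>\<omega>. h (c \<bullet> S n \<omega>) \<partial>M) - (\<integral>\<omega>. h (c \<bullet> T n \<omega>) \<partial>M) - 0) < r" by blast
    qed
    from tendsto_add[OF this T_lim] show ?thesis by simp
  qed
  have tight: "\<exists>R. \<forall>\<^sub>F n in sequentially. prob {\<omega> \<in> space M. norm (S n \<omega>) > R} \<le> \<epsilon>" if "\<epsilon> > 0" for \<epsilon>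
  proof -
    \<comment> \<open>Chosen so that Markov's inequality leaves at most
      \<open>\<epsilon> / 2\<close>; the additive 1 keeps \<open>R\<close> positive when
      \<open>m = 0\<close>.\<close>
    define R where "R = sqrt (2 * m / \<epsilon>) + 1"
    have R: "R > 0" "m / R\<^sup>2 \<le> \<epsilon> / 2"
    proof -
      have s: "sqrt (2 * m / \<epsilon>) \<ge> 0" using m that by simp
      then show "R > 0" unfolding R_def by linarith
      have "2 * m / \<epsilon> = (sqrt (2 * m / \<epsilon>))\<^sup>2" using m that by simp
      also have "\<dots> \<le> R\<^sup>2" by (rule power_mono[OF _ s]) (unfold R_def, linarith)
      finally have "m \<le> \<epsilon> / 2 * R\<^sup>2" using that by (simp add: field_simps)
      then show "m / R\<^sup>2 \<le> \<epsilon> / 2" using \<open>R > 0\<close> by (simp add: pos_divide_le_eq)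
    qed
    have T_tail: "prob {\<omega> \<in> space M. norm (T n \<omega>) > R} \<le> \<epsilon> / 2" for n
    proof -
      note T2 = iid_normalized_sum_second_moment[OF \<psi> sq mean, of n, folded T_def m_def]
      have "prob {\<omega> \<in> space M. norm (T n \<omega>) > R} \<le> prob {\<omega> \<in> space M. (norm (T n \<omega>))\<^sup>2 \<ge> R\<^sup>2}"
        using R(1) by (intro finite_measure_mono) (auto intro!: power_mono)
      also have "\<dots> \<le> expectation (\<lambda>\<omega>. (norm (T n \<omega>))\<^sup>2) / R\<^sup>2"
        using R(1) T2 by (intro integral_Markov_inequality_measure[where A="{}"]) auto
      also have "\<dots> \<le> m / R\<^sup>2" using T2 by (intro divide_right_mono) auto
      finally show ?thesis using R(2) by linarith
    qed
    have "\<forall>\<^sub>F n in sequentially. prob {\<omega> \<in> space M. norm (S n \<omega> - T n \<omega>) > 1} < \<epsilon> / 2"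
      using order_tendstoD(2)[OF remainder[of 1], of "\<epsilon> / 2"] that by (simp add: T_def)
    then have "\<forall>\<^sub>F n in sequentially. prob {\<omega> \<in> space M. norm (S n \<omega>) > R + 1} \<le> \<epsilon>"
    proof eventually_elim
      case (elim n)
      have "prob {\<omega> \<in> space M. norm (S n \<omega>) > R + 1} \<le>
        prob ({\<omega> \<in> space M. norm (T n \<omega>) > R} \<union> {\<omega> \<in> space M. norm (S n \<omega> - T n \<omega>) > 1})"
      proof (rule finite_measure_mono)
        have "norm (T n \<omega>) > R \<or> norm (S n \<omega> - T n \<omega>) > 1" if "norm (S n \<omega>) > R + 1" for \<omega>
          using norm_triangle_sub[of "S n \<omega>" "T n \<omega>"] that by linarith
        then show "{\<omega> \<in> space M. norm (S n \<omega>) > R + 1} \<subseteq>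
          {\<omega> \<in> space M. norm (T n \<omega>) > R} \<union> {\<omega> \<in> space M. norm (S n \<omega> - T n \<omega>) > 1}" by auto
      qed simp
      also have "\<dots> \<le> prob {\<omega> \<in> space M. norm (T n \<omega>) > R} + prob {\<omega> \<in> space M. norm (S n \<omega> - T n \<omega>) > 1}"
        by (rule measure_Un_le) auto
      finally show ?case using T_tail[of n] elim by linarith
    qed
    then show ?thesis by blast
  qed
  have cos_lip: "\<bar>cos x - cos y\<bar> \<le> \<bar>x - y\<bar>" and sin_lip: "\<bar>sin x - sin y\<bar> \<le> \<bar>x - y\<bar>" for x y :: real
  proof -
    have "cos x - cos y = 2 * sin ((x + y) / 2) * sin ((y - x) / 2)" by (rule cos_diff_cos)
    then have "\<bar>cos x - cos y\<bar> = 2 * \<bar>sin ((x + y) / 2)\<bar> * \<bar>sin ((y - x) / 2)\<bar>" by (simp add: abs_mult)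
    also have "\<dots> \<le> 2 * 1 * \<bar>(y - x) / 2\<bar>"
      by (intro mult_mono abs_sin_x_le_abs_x) auto
    finally show "\<bar>cos x - cos y\<bar> \<le> \<bar>x - y\<bar>" by simp
    have "sin x - sin y = 2 * sin ((x - y) / 2) * cos ((x + y) / 2)" by (rule sin_diff_sin)
    then have "\<bar>sin x - sin y\<bar> = 2 * \<bar>sin ((x - y) / 2)\<bar> * \<bar>cos ((x + y) / 2)\<bar>" by (simp add: abs_mult)
    also have "\<dots> \<le> 2 * \<bar>(x - y) / 2\<bar> * 1"
      by (intro mult_mono abs_sin_x_le_abs_x) auto
    finally show "\<bar>sin x - sin y\<bar> \<le> \<bar>x - y\<bar>" by simp
  qed
  have "(\<lambda>n. \<integral>\<omega>. \<phi> (S n \<omega>) \<partial>M) \<longlonglongrightarrow> (\<integral>x. \<phi> x \<partial>N)"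
    if "continuous_on UNIV \<phi>" "bounded (range \<phi>)" for \<phi> :: "'b \<Rightarrow> real"
    by (rule weak_convergence_from_trig[OF prob_space_axioms pN sets_N S limit limit tight that])
      (auto intro!: continuous_intros cos_lip sin_lip)
  with N show ?thesis unfolding converges_to_gaussian_def \<Sigma>_def[symmetric] by blast
qed

end

text \<open>The stacked normal equations need not be symmetric, so nondegeneracy concerns the left
  argument only. The lower bound \<open>m\<close> serves the perturbation argument for approximate
  solutions.\<close>

lemma nondegenerate_bilinear_form_representation:
  fixes K :: "'e::euclidean_space \<Rightarrow> 'e \<Rightarrow> real"
  assumes K: "bilinear K" and nondeg: "\<And>x. (\<And>y. K x y = 0) \<Longrightarrow> x = 0"
  obtains k J m where "linear k" "linear J" "\<And>x. J (k x) = x" "\<And>x. k (J x) = x"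
    "\<And>x y. K x y = k x \<bullet> y" "m > 0" "\<And>x. m * norm x \<le> norm (k x)"
proof -
  define k where "k x = (\<Sum>b\<in>Basis. K x b *\<^sub>R b)" for x
  have lin: "linear k"
    unfolding k_def
    by (rule linearI) (simp_all add: bilinear_ladd[OF K] bilinear_lmul[OF K] scaleR_left_distrib
      sum.distrib scaleR_sum_right)
  have rep: "K x y = k x \<bullet> y" for x y
  proof -
    have "K x y = K x (\<Sum>b\<in>Basis. (y \<bullet> b) *\<^sub>R b)" by (simp add: euclidean_representation)
    also have "\<dots> = (\<Sum>b\<in>Basis. (y \<bullet> b) * K x b)"
      using K by (simp add: bilinear_def linear_sum linear_scale)
    also have "\<dots> = k x \<bullet> y"
      unfolding k_def inner_sum_left by (rule sum.cong) (simp_all add: inner_commute mult.commute)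
    finally show ?thesis .
  qed
  have "inj k"
  proof (rule linear_injective_0[OF lin, THEN iffD2], intro allI impI)
    fix x assume "k x = 0"
    then show "x = 0" by (intro nondeg) (simp add: rep)
  qed
  then obtain J where J: "linear J" "\<And>x. J (k x) = x" "\<And>x. k (J x) = x"
    using linear_injective_isomorphism[OF lin] by blast
  obtain m where m: "m > 0" "\<And>x. m * norm x \<le> norm (k x)"
    using linear_inj_bounded_below_pos[OF lin \<open>inj k\<close>] by blast
  show thesis using that[OF lin J rep m] .
qed

context prob_space
begin

text \<open>The scaled error is read off a solution of a system that is close to \<open>K x = \<Sum>\<tau> / sqrt n\<close> as soon as
  the sample moments are close to the population moments. The solution itself need not depend
  measurably on the sample, only \<open>dev\<close> does. If \<open>y\<close> solves the adjoint system for \<open>d\<close>, then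
  \<open>y \<bullet> \<tau>\<close> is the influence function of the functional \<open>d\<close>.\<close>

lemma asymptotic_covariance_linear_system:
  fixes \<tau> :: "nat \<Rightarrow> 'a \<Rightarrow> 'e::euclidean_space" and \<pi> :: "'e \<Rightarrow> 'b::euclidean_space"
    and dev :: "nat \<Rightarrow> 'a \<Rightarrow> real"
  assumes \<tau>: "iid M \<tau>" and sq: "integrable M (\<lambda>\<omega>. (norm (\<tau> 0 \<omega>))\<^sup>2)" and mean: "expectation (\<tau> 0) = 0"
    and K: "bilinear K" and nondeg: "\<And>x. (\<And>y. K x y = 0) \<Longrightarrow> x = 0" and \<pi>: "linear \<pi>"
    and dev: "\<And>n. integrable M (dev n)" "\<And>n \<omega>. dev n \<omega> \<ge> 0" "(\<lambda>n. expectation (dev n)) \<longlonglongrightarrow> 0"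
    and approx: "\<And>\<eta>. \<eta> > 0 \<Longrightarrow> \<exists>\<delta>>0. AE \<omega> in M. \<forall>n>0. \<forall>b. dev n \<omega> \<le> \<delta> \<longrightarrow> est n \<omega> b \<longrightarrow>
      (\<exists>x. \<pi> x = sqrt n *\<^sub>R (b - \<beta>) \<and>
        (\<forall>y. \<bar>K x y - ((1 / sqrt n) *\<^sub>R (\<Sum>i<n. \<tau> i \<omega>)) \<bullet> y\<bar> \<le> \<eta> * norm x * norm y))"
  obtains V where "asymptotic_covariance M est \<beta> V"
    "\<And>d y. (\<And>x. K x y = \<pi> x \<bullet> d) \<Longrightarrow> d \<bullet> V d = expectation (\<lambda>\<omega>. (y \<bullet> \<tau> 0 \<omega>)\<^sup>2)"
proof -
  note [measurable] = iid_measurable[OF \<tau>] borel_measurable_integrable[OF dev(1)]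
  obtain k J m where k: "linear k" and J: "linear J" "\<And>x. J (k x) = x" "\<And>x. k (J x) = x"
    and rep: "\<And>x y. K x y = k x \<bullet> y" and m: "m > 0" "\<And>x. m * norm x \<le> norm (k x)"
    using nondegenerate_bilinear_form_representation[OF K nondeg] by blast
  \<comment> \<open>Solves the population system and projects to the parameters: \<open>L\<close>
    turns the scores \<open>\<tau>\<close> into influence functions.\<close>
  define L where "L x = \<pi> (J x)" for x
  have L: "linear L" unfolding L_def using linear_compose[OF J(1) \<pi>] by (simp add: comp_def)
  then have [measurable]: "L \<in> borel_measurable borel"
    by (intro borel_measurable_continuous_onI linear_continuous_on linear_conv_bounded_linear[THEN iffD1])
  obtain B where B: "B > 0" "\<And>x. norm (\<pi> x) \<le> B * norm x" using linear_bounded_pos[OF \<pi>] by blast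
  obtain B' where B': "B' > 0" "\<And>x. norm (J x) \<le> B' * norm x" using linear_bounded_pos[OF J(1)] by blast
  obtain B'' where B'': "B'' > 0" "\<And>x. norm (L x) \<le> B'' * norm x" using linear_bounded_pos[OF L] by blast
  define \<psi> where "\<psi> i \<omega> = L (\<tau> i \<omega>)" for i \<omega>
  have \<psi>: "iid M \<psi>" unfolding \<psi>_def[abs_def] by (rule iid_compose[OF \<tau>]) simp
  have int_\<tau>: "integrable M (\<tau> 0)"
    by (rule square_integrable_imp_integrable_vector[OF _ sq]) simp
  have \<psi>_sq: "integrable M (\<lambda>\<omega>. (norm (\<psi> 0 \<omega>))\<^sup>2)"
  proof (rule Bochner_Integration.integrable_bound)
    show "integrable M (\<lambda>\<omega>. B''\<^sup>2 * (norm (\<tau> 0 \<omega>))\<^sup>2)" using sq by simp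
    show "AE \<omega> in M. norm ((norm (\<psi> 0 \<omega>))\<^sup>2) \<le> norm (B''\<^sup>2 * (norm (\<tau> 0 \<omega>))\<^sup>2)"
      using power_mono[OF B''(2) norm_ge_zero, of _ 2]
      by (intro always_eventually allI) (simp add: \<psi>_def power_mult_distrib)
  qed (simp add: \<psi>_def)
  have \<psi>_mean: "expectation (\<psi> 0) = 0"
    using integral_bounded_linear[OF linear_conv_bounded_linear[THEN iffD1, OF L] int_\<tau>]
    by (simp add: \<psi>_def[abs_def] mean linear_0[OF L])
  define V where "V d = expectation (\<lambda>\<omega>. (\<psi> 0 \<omega> \<bullet> d) *\<^sub>R \<psi> 0 \<omega>)" for d
  define T where "T n \<omega> = (1 / sqrt n) *\<^sub>R (\<Sum>i<n. \<tau> i \<omega>)" for n :: nat and \<omega>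
  have [measurable]: "T n \<in> borel_measurable M" for n unfolding T_def by measurable
  have L_T: "(1 / sqrt n) *\<^sub>R (\<Sum>i<n. \<psi> i \<omega>) = L (T n \<omega>)" for n \<omega>
    by (simp add: T_def \<psi>_def linear_scale[OF L] linear_sum[OF L])
  define t where "t = expectation (\<lambda>\<omega>. (norm (\<tau> 0 \<omega>))\<^sup>2)"
  have t: "t \<ge> 0" by (simp add: t_def)
  note T2 = iid_normalized_sum_second_moment[OF \<tau> sq mean, folded T_def t_def]
  \<comment> \<open>The error is tested with \<open>k (x - J s)\<close>, which bounds it by
    \<open>\<eta> * norm x\<close>; then \<open>\<eta> \<le> m / 2\<close> absorbs half of
    \<open>m * norm (x - J s)\<close>.\<close>
  have solution_close: "norm (\<pi> x - L s) \<le> (B * (2 * \<eta> / m) * B') * norm s"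
    if x: "\<And>y. \<bar>K x y - s \<bullet> y\<bar> \<le> \<eta> * norm x * norm y" and \<eta>: "0 < \<eta>" "\<eta> \<le> m / 2" for x s \<eta>
  proof -
    let ?x = "J s"
    have "\<bar>k (x - ?x) \<bullet> y\<bar> \<le> \<eta> * norm x * norm y" for y
      using x[of y] by (simp add: rep linear_diff[OF k] inner_diff_left J)
    from this[of "k (x - ?x)"] have "norm (k (x - ?x)) * norm (k (x - ?x)) \<le> \<eta> * norm x * norm (k (x - ?x))"
      by (simp add: dot_square_norm power2_eq_square)
    then have "norm (k (x - ?x)) \<le> \<eta> * norm x"
      by (cases "norm (k (x - ?x)) = 0") (use \<eta> in auto)
    with m(2)[of "x - ?x"] have "m * norm (x - ?x) \<le> \<eta> * norm x" by linarith
    also have "\<dots> \<le> \<eta> * (norm (x - ?x) + norm ?x)"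
      using \<eta> norm_triangle_sub[of x ?x] by (intro mult_left_mono) (auto simp: add.commute)
    also have "\<dots> \<le> m / 2 * norm (x - ?x) + \<eta> * norm ?x"
      using \<eta> mult_right_mono[OF \<eta>(2) norm_ge_zero[of "x - ?x"]] by (simp add: distrib_left)
    finally have "norm (x - ?x) \<le> (2 * \<eta> / m) * norm ?x"
      using m(1) by (simp add: field_simps)
    also have "\<dots> \<le> (2 * \<eta> / m) * (B' * norm s)"
      using m(1) \<eta> B'(2) by (intro mult_left_mono) auto
    finally have "B * norm (x - ?x) \<le> B * ((2 * \<eta> / m) * (B' * norm s))"
      using B(1) by (intro mult_left_mono) auto
    moreover have "norm (\<pi> x - L s) \<le> B * norm (x - ?x)"
      using B(2)[of "x - ?x"] by (simp add: L_def linear_diff[OF \<pi>])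
    ultimately show ?thesis by (simp add: mult.assoc)
  qed
  have remainder: "(\<lambda>n. prob {\<omega> \<in> space M. norm (sqrt n *\<^sub>R (b n \<omega> - \<beta>) - L (T n \<omega>)) > \<epsilon>}) \<longlonglongrightarrow> 0"
    if b[measurable]: "\<And>n. b n \<in> borel_measurable M" and est: "\<And>n. AE \<omega> in M. est n \<omega> (b n \<omega>)" and "\<epsilon> > 0" for b \<epsilon>
  proof (rule LIMSEQ_I)
    fix r :: real assume "r > 0"
    define C where "C = B * (2 / m) * B'"
    have "C > 0" using B B' m by (simp add: C_def)
    \<comment> \<open>Makes the Markov bound \<open>t * q\<^sup>2 / \<epsilon>\<^sup>2\<close> for
      the tail of \<open>T n\<close> at most \<open>r / 2\<close>; \<open>t + 1\<close> stands for
      \<open>t\<close>, which may vanish.\<close>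
    define q where "q = sqrt (\<epsilon>\<^sup>2 * r / (2 * (t + 1)))"
    have "q > 0" using \<open>\<epsilon> > 0\<close> \<open>r > 0\<close> t by (simp add: q_def)
    define \<eta> where "\<eta> = min (m / 2) (q / C)"
    have \<eta>: "\<eta> > 0" "\<eta> \<le> m / 2" "C * \<eta> \<le> q"
      using m \<open>q > 0\<close> \<open>C > 0\<close> by (auto simp: \<eta>_def min_def field_simps)
    have C\<eta>: "B * (2 * \<eta> / m) * B' = C * \<eta>" by (simp add: C_def)
    obtain \<delta> where "\<delta> > 0" and \<delta>: "AE \<omega> in M. \<forall>n>0. \<forall>b. dev n \<omega> \<le> \<delta> \<longrightarrow> est n \<omega> b \<longrightarrow>
      (\<exists>x. \<pi> x = sqrt n *\<^sub>R (b - \<beta>) \<and> (\<forall>y. \<bar>K x y - T n \<omega> \<bullet> y\<bar> \<le> \<eta> * norm x * norm y))"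
      using approx[OF \<eta>(1)] unfolding T_def by blast
    have "\<forall>\<^sub>F n in sequentially. expectation (dev n) < \<delta> * r / 2"
      using \<open>\<delta> > 0\<close> \<open>r > 0\<close> by (intro order_tendstoD(2)[OF dev(3)]) simp
    then have "\<forall>\<^sub>F n in sequentially.
        norm (prob {\<omega> \<in> space M. norm (sqrt n *\<^sub>R (b n \<omega> - \<beta>) - L (T n \<omega>)) > \<epsilon>} - 0) < r"
      using eventually_gt_at_top[of 0]
    proof eventually_elim
      case (elim n)
      \<comment> \<open>A large remainder forces one of two events expressed by the measurable
        quantities \<open>dev n\<close> and \<open>T n\<close>, and Markov's inequality applies to
        both.\<close>
      have "AE \<omega> in M. norm (sqrt n *\<^sub>R (b n \<omega> - \<beta>) - L (T n \<omega>)) > \<epsilon> \<longrightarrow>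
          dev n \<omega> \<ge> \<delta> \<or> (norm (T n \<omega>))\<^sup>2 \<ge> (\<epsilon> / (C * \<eta>))\<^sup>2"
        using \<delta> est[of n]
      proof eventually_elim
        case (elim \<omega>)
        show ?case
        proof (intro impI disjCI)
          assume large: "norm (sqrt n *\<^sub>R (b n \<omega> - \<beta>) - L (T n \<omega>)) > \<epsilon>"
            and "\<not> (norm (T n \<omega>))\<^sup>2 \<ge> (\<epsilon> / (C * \<eta>))\<^sup>2"
          then have "norm (T n \<omega>) < \<epsilon> / (C * \<eta>)"
            using \<open>\<epsilon> > 0\<close> \<open>C > 0\<close> \<eta> by (simp add: not_le power_less_imp_less_base)
          then have small: "C * \<eta> * norm (T n \<omega>) < \<epsilon>"
            using \<open>C > 0\<close> \<eta> by (simp add: field_simps)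
          show "dev n \<omega> \<ge> \<delta>"
          proof (rule ccontr)
            assume "\<not> dev n \<omega> \<ge> \<delta>"
            then have "dev n \<omega> \<le> \<delta>" by simp
            with elim \<open>n > 0\<close> obtain x where x: "\<pi> x = sqrt n *\<^sub>R (b n \<omega> - \<beta>)"
              "\<forall>y. \<bar>K x y - T n \<omega> \<bullet> y\<bar> \<le> \<eta> * norm x * norm y"
              by blast
            have "norm (\<pi> x - L (T n \<omega>)) \<le> (B * (2 * \<eta> / m) * B') * norm (T n \<omega>)"
              by (rule solution_close[OF x(2)[rule_format] \<eta>(1,2)])
            then show False
              using small large unfolding C\<eta> x(1) by linarith
          qed
        qed
      qed
      then have "prob {\<omega> \<in> space M. norm (sqrt n *\<^sub>R (b n \<omega> - \<beta>) - L (T n \<omega>)) > \<epsilon>} \<le>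
        prob ({\<omega> \<in> space M. dev n \<omega> \<ge> \<delta>} \<union> {\<omega> \<in> space M. (norm (T n \<omega>))\<^sup>2 \<ge> (\<epsilon> / (C * \<eta>))\<^sup>2})"
        by (intro finite_measure_mono_AE) auto
      also have "\<dots> \<le> prob {\<omega> \<in> space M. dev n \<omega> \<ge> \<delta>} + prob {\<omega> \<in> space M. (norm (T n \<omega>))\<^sup>2 \<ge> (\<epsilon> / (C * \<eta>))\<^sup>2}"
        by (rule measure_Un_le) auto
      also have "prob {\<omega> \<in> space M. dev n \<omega> \<ge> \<delta>} \<le> expectation (dev n) / \<delta>"
        using dev \<open>\<delta> > 0\<close> by (intro integral_Markov_inequality_measure[where A="{}"]) auto
      also have "prob {\<omega> \<in> space M. (norm (T n \<omega>))\<^sup>2 \<ge> (\<epsilon> / (C * \<eta>))\<^sup>2} \<le>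
          expectation (\<lambda>\<omega>. (norm (T n \<omega>))\<^sup>2) / (\<epsilon> / (C * \<eta>))\<^sup>2"
        using T2 \<open>\<epsilon> > 0\<close> \<open>C > 0\<close> \<eta> by (intro integral_Markov_inequality_measure[where A="{}"]) auto
      also have "\<dots> \<le> t / (\<epsilon> / (C * \<eta>))\<^sup>2"
        using T2 by (intro divide_right_mono) auto
      also have "\<dots> = t * (C * \<eta>)\<^sup>2 / \<epsilon>\<^sup>2" by (simp add: power_divide)
      also have "\<dots> \<le> t * q\<^sup>2 / \<epsilon>\<^sup>2"
        using t \<eta> \<open>C > 0\<close> by (intro divide_right_mono mult_left_mono power_mono) auto
      also have "\<dots> = t * r / (2 * (t + 1))"
        using \<open>\<epsilon> > 0\<close> \<open>r > 0\<close> t by (simp add: q_def)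
      also have "\<dots> \<le> r / 2"
        using t \<open>r > 0\<close> by (simp add: field_simps)
      also have "expectation (dev n) / \<delta> < r / 2"
        using elim \<open>\<delta> > 0\<close> by (simp add: field_simps)
      finally show ?case by simp
    qed
    then show "\<exists>n0. \<forall>n\<ge>n0.
        norm (prob {\<omega> \<in> space M. norm (sqrt n *\<^sub>R (b n \<omega> - \<beta>) - L (T n \<omega>)) > \<epsilon>} - 0) < r"
      by (simp only: eventually_sequentially)
  qed
  have "asymptotic_covariance M est \<beta> V"
    unfolding asymptotic_covariance_def
  proof (intro allI impI)
    fix b assume "\<forall>n. b n \<in> borel_measurable M \<and> (AE \<omega> in M. est n \<omega> (b n \<omega>))"
    then have b[measurable]: "\<And>n. b n \<in> borel_measurable M" and est: "\<And>n. AE \<omega> in M. est n \<omega> (b n \<omega>)" by auto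
    show "converges_to_gaussian M (\<lambda>n \<omega>. sqrt (real n) *\<^sub>R (b n \<omega> - \<beta>)) V"
      unfolding V_def[abs_def]
    proof (rule asymptotically_linear_imp_gaussian[OF \<psi> \<psi>_sq \<psi>_mean])
      show "(\<lambda>n. prob {\<omega> \<in> space M. norm (sqrt (real n) *\<^sub>R (b n \<omega> - \<beta>) - (1 / sqrt (real n)) *\<^sub>R (\<Sum>i<n. \<psi> i \<omega>)) > \<epsilon>}) \<longlonglongrightarrow> 0"
        if "\<epsilon> > 0" for \<epsilon>
        unfolding L_T by (rule remainder[OF b est that])
    qed simp
  qed
  moreover have "d \<bullet> V d = expectation (\<lambda>\<omega>. (y \<bullet> \<tau> 0 \<omega>)\<^sup>2)" if y: "\<And>x. K x y = \<pi> x \<bullet> d" for d y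
  proof -
    have eq: "\<psi> 0 \<omega> \<bullet> d = y \<bullet> \<tau> 0 \<omega>" for \<omega>
      using y[of "J (\<tau> 0 \<omega>)"] by (simp add: \<psi>_def L_def rep J inner_commute)
    have "integrable M (\<lambda>\<omega>. (\<psi> 0 \<omega> \<bullet> d) *\<^sub>R \<psi> 0 \<omega>)"
      by (rule integrable_inner_scaleR_self[OF _ \<psi>_sq]) (simp add: \<psi>_def)
    then have "d \<bullet> V d = expectation (\<lambda>\<omega>. d \<bullet> ((\<psi> 0 \<omega> \<bullet> d) *\<^sub>R \<psi> 0 \<omega>))"
      unfolding V_def by (rule integral_inner_right[symmetric])
    also have "\<dots> = expectation (\<lambda>\<omega>. (\<psi> 0 \<omega> \<bullet> d)\<^sup>2)"
      by (simp add: power2_eq_square inner_commute)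
    finally show ?thesis by (simp add: eq)
  qed
  ultimately show thesis by (rule that)
qed

end

section \<open>Independence\<close>

text \<open>The library notion \<^const>\<open>prob_space.indep_var\<close> requires both variables to have the same type.\<close>

definition indep_rv ::
    "'w measure \<Rightarrow> ('w \<Rightarrow> 'a::second_countable_topology) \<Rightarrow> ('w \<Rightarrow> 'b::second_countable_topology) \<Rightarrow> bool" where
  "indep_rv M X Y \<longleftrightarrow> X \<in> borel_measurable M \<and> Y \<in> borel_measurable M \<and>
     distr M borel (\<lambda>\<omega>. (X \<omega>, Y \<omega>)) = distr M borel X \<Otimes>\<^sub>M distr M borel Y"

lemma distr_pair_measure_projections:
  assumes "prob_space P" "prob_space Q"
  shows "distr (P \<Otimes>\<^sub>M Q) P fst = P" "distr (P \<Otimes>\<^sub>M Q) Q snd = Q"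
proof -
  interpret P: prob_space P by fact
  interpret Q: prob_space Q by fact
  show "distr (P \<Otimes>\<^sub>M Q) P fst = P" by (rule Q.distr_pair_fst)
  show "distr (P \<Otimes>\<^sub>M Q) Q snd = Q"
  proof (rule measure_eqI)
    fix A assume "A \<in> sets (distr (P \<Otimes>\<^sub>M Q) Q snd)"
    then have A: "A \<in> sets Q" by simp
    have "emeasure (distr (P \<Otimes>\<^sub>M Q) Q snd) A = emeasure (P \<Otimes>\<^sub>M Q) (space P \<times> A)"
      using A sets.sets_into_space[OF A]
      by (subst emeasure_distr) (auto simp: space_pair_measure intro!: arg_cong2[where f=emeasure])
    also have "\<dots> = emeasure Q A"
      using A by (simp add: Q.emeasure_pair_measure_Times P.emeasure_space_1)
    finally show "emeasure (distr (P \<Otimes>\<^sub>M Q) Q snd) A = emeasure Q A" .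
  qed simp
qed

lemma distr_pair_measure_assoc:
  assumes "prob_space P" "prob_space Q" "prob_space R"
  shows "distr (P \<Otimes>\<^sub>M (Q \<Otimes>\<^sub>M R)) ((P \<Otimes>\<^sub>M Q) \<Otimes>\<^sub>M R) (\<lambda>(x, y, z). ((x, y), z)) = (P \<Otimes>\<^sub>M Q) \<Otimes>\<^sub>M R"
proof (rule sym, rule pair_measure_eqI)
  interpret P: prob_space P by fact
  interpret Q: prob_space Q by fact
  interpret R: prob_space R by fact
  interpret PQ: pair_prob_space P Q ..
  interpret QR: pair_prob_space Q R ..
  show "sigma_finite_measure (P \<Otimes>\<^sub>M Q)" "sigma_finite_measure R" by unfold_locales
  fix A B assume A[measurable]: "A \<in> sets (P \<Otimes>\<^sub>M Q)" and B[measurable]: "B \<in> sets R"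
  define S where "S = (\<lambda>(x, y, z). ((x, y), z)) -` (A \<times> B) \<inter> space (P \<Otimes>\<^sub>M (Q \<Otimes>\<^sub>M R))"
  have S: "S \<in> sets (P \<Otimes>\<^sub>M (Q \<Otimes>\<^sub>M R))"
    unfolding S_def by (rule measurable_sets[where A="(P \<Otimes>\<^sub>M Q) \<Otimes>\<^sub>M R"]) auto
  have "emeasure (P \<Otimes>\<^sub>M (Q \<Otimes>\<^sub>M R)) S = (\<integral>\<^sup>+x. emeasure (Q \<Otimes>\<^sub>M R) (Pair x -` S) \<partial>P)"
    by (rule QR.emeasure_pair_measure_alt[OF S])
  also have "\<dots> = (\<integral>\<^sup>+x. emeasure Q (Pair x -` A) * emeasure R B \<partial>P)"
  proof (rule nn_integral_cong)
    fix x assume x: "x \<in> space P"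
    have "Pair x -` S = (Pair x -` A) \<times> B"
      using x sets.sets_into_space[OF A] sets.sets_into_space[OF B]
      by (auto simp: S_def space_pair_measure)
    then show "emeasure (Q \<Otimes>\<^sub>M R) (Pair x -` S) = emeasure Q (Pair x -` A) * emeasure R B"
      using sets_Pair1[OF A] by (simp add: R.emeasure_pair_measure_Times)
  qed
  also have "\<dots> = emeasure (P \<Otimes>\<^sub>M Q) A * emeasure R B"
    using Q.measurable_emeasure_Pair[OF A]
    by (subst nn_integral_multc) (simp_all add: Q.emeasure_pair_measure_alt)
  finally show "emeasure (P \<Otimes>\<^sub>M Q) A * emeasure R B =
      emeasure (distr (P \<Otimes>\<^sub>M (Q \<Otimes>\<^sub>M R)) ((P \<Otimes>\<^sub>M Q) \<Otimes>\<^sub>M R) (\<lambda>(x, y, z). ((x, y), z))) (A \<times> B)"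
    unfolding S_def by (subst emeasure_distr) auto
qed simp

context prob_space
begin

lemma indep_rvD:
  assumes "indep_rv M X Y"
  shows "X \<in> borel_measurable M" "Y \<in> borel_measurable M"
    "distr M borel (\<lambda>\<omega>. (X \<omega>, Y \<omega>)) = distr M borel X \<Otimes>\<^sub>M distr M borel Y"
  using assms by (auto simp: indep_rv_def)

text \<open>Peels one factor off a product law; the second conclusion is the law of the remaining
  tuple, so the step can be repeated.\<close>

lemma indep_rv_from_product:
  fixes X :: "'a \<Rightarrow> 'x::second_countable_topology" and Y :: "'a \<Rightarrow> 'y::second_countable_topology"
  assumes [measurable]: "X \<in> borel_measurable M" "Y \<in> borel_measurable M"
    and eq: "distr M borel (\<lambda>\<omega>. (X \<omega>, Y \<omega>)) = P \<Otimes>\<^sub>M Q"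
    and P: "prob_space P" "sets P = sets borel" and Q: "prob_space Q" "sets Q = sets borel"
  shows "indep_rv M X Y" "distr M borel Y = Q"
proof -
  have "distr (distr M borel (\<lambda>\<omega>. (X \<omega>, Y \<omega>))) P fst = P"
    "distr (distr M borel (\<lambda>\<omega>. (X \<omega>, Y \<omega>))) Q snd = Q"
    unfolding eq by (rule distr_pair_measure_projections[OF P(1) Q(1)])+
  moreover have "distr (distr M borel (\<lambda>\<omega>. (X \<omega>, Y \<omega>))) P fst = distr M borel X"
    using P(2) by (subst distr_distr)
      (auto simp: comp_def borel_prod[symmetric] cong: measurable_cong_sets intro!: distr_cong)
  moreover have "distr (distr M borel (\<lambda>\<omega>. (X \<omega>, Y \<omega>))) Q snd = distr M borel Y"
    using Q(2) by (subst distr_distr)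
      (auto simp: comp_def borel_prod[symmetric] cong: measurable_cong_sets intro!: distr_cong)
  ultimately have "distr M borel X = P" "distr M borel Y = Q" by simp_all
  with eq show "indep_rv M X Y" "distr M borel Y = Q" by (simp_all add: indep_rv_def)
qed

lemma indep_rv_compose:
  fixes h :: "'x::second_countable_topology \<Rightarrow> 'c::second_countable_topology"
    and q :: "'y::second_countable_topology \<Rightarrow> 'd::second_countable_topology"
  assumes XY: "indep_rv M X Y" and [measurable]: "h \<in> borel_measurable borel" "q \<in> borel_measurable borel"
  shows "indep_rv M (\<lambda>\<omega>. h (X \<omega>)) (\<lambda>\<omega>. q (Y \<omega>))"
proof -
  note [measurable] = indep_rvD(1,2)[OF XY]
  have pQ: "prob_space (distr (distr M borel Y) borel q)"
    by (intro prob_space.prob_space_distr prob_space_distr) auto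
  have "distr M borel (\<lambda>\<omega>. h (X \<omega>)) \<Otimes>\<^sub>M distr M borel (\<lambda>\<omega>. q (Y \<omega>)) =
      distr (distr M borel X) borel h \<Otimes>\<^sub>M distr (distr M borel Y) borel q"
    by (subst (1 2) distr_distr) (auto simp: comp_def)
  also have "\<dots> = distr (distr M borel X \<Otimes>\<^sub>M distr M borel Y) (borel \<Otimes>\<^sub>M borel) (\<lambda>(x, y). (h x, q y))"
    using pQ by (intro pair_measure_distr) (auto intro: prob_space_imp_sigma_finite)
  also have "\<dots> = distr (distr M borel (\<lambda>\<omega>. (X \<omega>, Y \<omega>))) borel (\<lambda>(x, y). (h x, q y))"
    by (simp add: indep_rvD(3)[OF XY] borel_prod)
  also have "\<dots> = distr M borel (\<lambda>\<omega>. (h (X \<omega>), q (Y \<omega>)))"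
    by (subst distr_distr) (auto simp: comp_def borel_prod[symmetric])
  finally show ?thesis by (simp add: indep_rv_def)
qed

text \<open>Used to merge instruments with covariates, and later first-stage regressors with the
  first-stage error, against the remaining errors. The law of the triple is a product, and
  rebracketing it changes nothing.\<close>

lemma indep_rv_assoc:
  assumes XYZ: "indep_rv M X (\<lambda>\<omega>. (Y \<omega>, Z \<omega>))" and YZ: "indep_rv M Y Z"
  shows "indep_rv M (\<lambda>\<omega>. (X \<omega>, Y \<omega>)) Z"
proof -
  note [measurable] = indep_rvD(1)[OF XYZ] indep_rvD(1,2)[OF YZ]
  have XY: "indep_rv M X Y"
    using indep_rv_compose[OF XYZ, of "\<lambda>x. x" fst] by (simp add: borel_prod[symmetric])
  let ?P = "distr M borel X" and ?Q = "distr M borel Y" and ?R = "distr M borel Z"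
  have "(?P \<Otimes>\<^sub>M ?Q) \<Otimes>\<^sub>M ?R = distr (?P \<Otimes>\<^sub>M (?Q \<Otimes>\<^sub>M ?R)) ((?P \<Otimes>\<^sub>M ?Q) \<Otimes>\<^sub>M ?R) (\<lambda>(x, y, z). ((x, y), z))"
    by (rule distr_pair_measure_assoc[symmetric]) (auto intro: prob_space_distr)
  also have "\<dots> = distr (distr M borel (\<lambda>\<omega>. (X \<omega>, Y \<omega>, Z \<omega>))) borel (\<lambda>(x, y, z). ((x, y), z))"
    unfolding indep_rvD(3)[OF XYZ] indep_rvD(3)[OF YZ]
    by (rule distr_cong) (simp_all add: borel_prod[symmetric] cong: sets_pair_measure_cong)
  also have "\<dots> = distr M borel (\<lambda>\<omega>. ((X \<omega>, Y \<omega>), Z \<omega>))"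
    by (subst distr_distr) (auto simp: comp_def borel_prod[symmetric])
  finally show ?thesis
    by (simp add: indep_rv_def indep_rvD(3)[OF XY])
qed

lemma indep_rv_iff_indep_var:
  fixes X Y :: "'a \<Rightarrow> real"
  shows "indep_rv M X Y \<longleftrightarrow> indep_var borel X borel Y"
  unfolding indep_rv_def indep_var_distribution_eq borel_prod by auto

lemma indep_rv_integral_mult:
  fixes X :: "'a \<Rightarrow> 'x::second_countable_topology" and Y :: "'a \<Rightarrow> 'y::second_countable_topology"
    and h q :: "_ \<Rightarrow> real"
  assumes "indep_rv M X Y" "h \<in> borel_measurable borel" "q \<in> borel_measurable borel"
    and "integrable M (\<lambda>\<omega>. h (X \<omega>))" "integrable M (\<lambda>\<omega>. q (Y \<omega>))"
  shows "integrable M (\<lambda>\<omega>. h (X \<omega>) * q (Y \<omega>))"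
    "expectation (\<lambda>\<omega>. h (X \<omega>) * q (Y \<omega>)) = expectation (\<lambda>\<omega>. h (X \<omega>)) * expectation (\<lambda>\<omega>. q (Y \<omega>))"
proof -
  have "indep_var borel (\<lambda>\<omega>. h (X \<omega>)) borel (\<lambda>\<omega>. q (Y \<omega>))"
    using indep_rv_compose[OF assms(1-3)] by (simp add: indep_rv_iff_indep_var)
  from indep_var_integrable[OF this assms(4,5)] indep_var_lebesgue_integral[OF this assms(4,5)]
  show "integrable M (\<lambda>\<omega>. h (X \<omega>) * q (Y \<omega>))"
    "expectation (\<lambda>\<omega>. h (X \<omega>) * q (Y \<omega>)) = expectation (\<lambda>\<omega>. h (X \<omega>)) * expectation (\<lambda>\<omega>. q (Y \<omega>))" .
qed

end

section \<open>Second moments\<close>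

text \<open>In finite dimension nondegeneracy on the left makes the adjoint system solvable:
  \<open>y\<close> collects the coordinates of \<open>\<phi>\<close> composed with the inverse of
  the representing operator. It supplies the adjoint solutions that enter the asymptotic
  variances.\<close>

lemma nondegenerate_bilinear_form_riesz:
  fixes K :: "'e::euclidean_space \<Rightarrow> 'e \<Rightarrow> real"
  assumes K: "bilinear K" and nondeg: "\<And>x. (\<And>y. K x y = 0) \<Longrightarrow> x = 0" and \<phi>: "linear \<phi>"
  shows "\<exists>y. \<forall>x. K x y = \<phi> x"
proof -
  obtain k J where J: "linear J" "\<And>x. J (k x) = x" and rep: "\<And>x y. K x y = k x \<bullet> y"
    using nondegenerate_bilinear_form_representation[OF K nondeg] by metis
  define y where "y = (\<Sum>b\<in>Basis. \<phi> (J b) *\<^sub>R b)"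
  have "z \<bullet> y = \<phi> (J z)" for z
  proof -
    have "\<phi> (J z) = \<phi> (J (\<Sum>b\<in>Basis. (z \<bullet> b) *\<^sub>R b))" by (simp add: euclidean_representation)
    also have "\<dots> = (\<Sum>b\<in>Basis. (z \<bullet> b) * \<phi> (J b))"
      by (simp add: linear_sum[OF J(1)] linear_scale[OF J(1)] linear_sum[OF \<phi>] linear_scale[OF \<phi>])
    finally show ?thesis by (simp add: y_def inner_sum_right mult.commute)
  qed
  then have "K x y = \<phi> x" for x by (simp add: rep J)
  then show ?thesis by blast
qed

definition sample_moment :: "(nat \<Rightarrow> 'w \<Rightarrow> 'e::real_inner) \<Rightarrow> nat \<Rightarrow> 'w \<Rightarrow> 'e \<Rightarrow> 'e \<Rightarrow> real" where
  "sample_moment \<xi> n \<omega> x y = (\<Sum>i<n. (x \<bullet> \<xi> i \<omega>) * (y \<bullet> \<xi> i \<omega>)) / n"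

definition moment :: "'w measure \<Rightarrow> (nat \<Rightarrow> 'w \<Rightarrow> 'e::real_inner) \<Rightarrow> 'e \<Rightarrow> 'e \<Rightarrow> real" where
  "moment M \<xi> x y = (\<integral>\<omega>. (x \<bullet> \<xi> 0 \<omega>) * (y \<bullet> \<xi> 0 \<omega>) \<partial>M)"

text \<open>An entrywise norm of the error of the sample moment matrix: one nonnegative scalar that
  controls all second moments at once and whose expectation tends to zero by linearity.\<close>

definition moment_deviation :: "'w measure \<Rightarrow> (nat \<Rightarrow> 'w \<Rightarrow> 'e::euclidean_space) \<Rightarrow> nat \<Rightarrow> 'w \<Rightarrow> real" where
  "moment_deviation M \<xi> n \<omega> = (\<Sum>b\<in>Basis. \<Sum>c\<in>Basis. \<bar>sample_moment \<xi> n \<omega> b c - moment M \<xi> b c\<bar>)"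

lemma moment_commute: "moment M \<xi> x y = moment M \<xi> y x"
  by (simp add: moment_def mult.commute)

lemma moment_nonneg: "0 \<le> moment M \<xi> x x"
  by (simp add: moment_def)

lemma bilinear_sample_moment: "bilinear (sample_moment \<xi> n \<omega>)"
  unfolding bilinear_def sample_moment_def
  by (auto intro!: linearI simp: inner_add_left distrib_left distrib_right sum.distrib add_divide_distrib
      sum_distrib_left mult_ac)

lemma moment_deviation_nonneg: "0 \<le> moment_deviation M \<xi> n \<omega>"
  by (simp add: moment_deviation_def sum_nonneg)

lemma square_integrable_mult:
  fixes f g :: "'a \<Rightarrow> real"
  assumes [measurable]: "f \<in> borel_measurable M" "g \<in> borel_measurable M"
    and "integrable M (\<lambda>x. (f x)\<^sup>2)" "integrable M (\<lambda>x. (g x)\<^sup>2)"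
  shows "integrable M (\<lambda>x. f x * g x)"
proof (rule Bochner_Integration.integrable_bound)
  show "integrable M (\<lambda>x. (f x)\<^sup>2 + (g x)\<^sup>2)" using assms by simp
  have "\<bar>a * b\<bar> \<le> a\<^sup>2 + b\<^sup>2" for a b :: real
    using sum_squares_bound[of a b] sum_squares_bound[of a "-b"] zero_le_power2[of a] zero_le_power2[of b]
    by (simp add: abs_le_iff)
  then show "AE x in M. norm (f x * g x) \<le> norm ((f x)\<^sup>2 + (g x)\<^sup>2)"
    by (intro always_eventually allI) simp
qed simp

lemma square_integrable_inner:
  fixes f :: "'a \<Rightarrow> 'b::euclidean_space"
  assumes [measurable]: "f \<in> borel_measurable M" and "integrable M (\<lambda>x. (norm (f x))\<^sup>2)"
  shows "integrable M (\<lambda>x. (c \<bullet> f x)\<^sup>2)"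
proof (rule Bochner_Integration.integrable_bound)
  show "integrable M (\<lambda>x. (norm c)\<^sup>2 * (norm (f x))\<^sup>2)" using assms by simp
  have "(c \<bullet> y)\<^sup>2 \<le> (norm c)\<^sup>2 * (norm y)\<^sup>2" for y
    using Cauchy_Schwarz_ineq2[of c y] by (simp add: abs_le_square_iff[symmetric] flip: power_mult_distrib)
  then show "AE x in M. norm ((c \<bullet> f x)\<^sup>2) \<le> norm ((norm c)\<^sup>2 * (norm (f x))\<^sup>2)"
    by (intro always_eventually allI) simp
qed simp

context prob_space
begin

context
  fixes \<xi> :: "nat \<Rightarrow> 'a \<Rightarrow> 'e::euclidean_space"
  assumes \<xi>: "iid M \<xi>" and sq: "integrable M (\<lambda>\<omega>. (norm (\<xi> 0 \<omega>))\<^sup>2)"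
begin

lemma integrable_moment: "integrable M (\<lambda>\<omega>. (x \<bullet> \<xi> 0 \<omega>) * (y \<bullet> \<xi> 0 \<omega>))"
  using iid_measurable[OF \<xi>, of 0] by (intro square_integrable_mult square_integrable_inner sq) auto

lemma bilinear_moment: "bilinear (moment M \<xi>)"
  unfolding bilinear_def moment_def
  using integrable_moment
  by (auto intro!: linearI simp: inner_add_left distrib_left distrib_right mult.assoc mult.left_commute)

lemma moment_deviation_bound:
  "\<bar>sample_moment \<xi> n \<omega> x y - moment M \<xi> x y\<bar> \<le> moment_deviation M \<xi> n \<omega> * norm x * norm y"
proof -
  define d where "d x y = sample_moment \<xi> n \<omega> x y - moment M \<xi> x y" for x y
  have d: "bilinear d"
    using bilinear_sample_moment[of \<xi> n \<omega>] bilinear_moment unfolding bilinear_def d_def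
    by (auto intro: linear_compose_sub)
  have "d x y = d (\<Sum>b\<in>Basis. (x \<bullet> b) *\<^sub>R b) (\<Sum>c\<in>Basis. (y \<bullet> c) *\<^sub>R c)"
    by (simp add: euclidean_representation)
  also have "\<dots> = (\<Sum>b\<in>Basis. \<Sum>c\<in>Basis. (x \<bullet> b) * (y \<bullet> c) * d b c)"
    by (simp add: bilinear_sum[OF d] bilinear_lmul[OF d] bilinear_rmul[OF d] sum.cartesian_product mult_ac)
  finally have "\<bar>d x y\<bar> \<le> (\<Sum>b\<in>Basis. \<Sum>c\<in>Basis. \<bar>(x \<bullet> b) * (y \<bullet> c) * d b c\<bar>)"
    by (simp add: order_trans[OF sum_abs] sum_mono)
  also have "\<dots> \<le> (\<Sum>b\<in>Basis. \<Sum>c\<in>Basis. norm x * norm y * \<bar>d b c\<bar>)"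
    unfolding abs_mult by (intro sum_mono mult_right_mono mult_mono) (auto simp: Basis_le_norm)
  also have "\<dots> = moment_deviation M \<xi> n \<omega> * norm x * norm y"
    by (simp add: moment_deviation_def d_def sum_distrib_left sum_distrib_right mult_ac)
  finally show ?thesis by (simp add: d_def)
qed

lemma moment_deviation_tendsto:
  "integrable M (moment_deviation M \<xi> n)"
  "(\<lambda>n. expectation (moment_deviation M \<xi> n)) \<longlonglongrightarrow> 0"
proof -
  have X: "iid M (\<lambda>i \<omega>. (b \<bullet> \<xi> i \<omega>) * (c \<bullet> \<xi> i \<omega>))" for b c
    using iid_compose[OF \<xi>, of "\<lambda>x. (b \<bullet> x) * (c \<bullet> x)"] by simp
  have int_i: "integrable M (\<lambda>\<omega>. (b \<bullet> \<xi> i \<omega>) * (c \<bullet> \<xi> i \<omega>))" for b c i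
    using iid_integral(2)[OF X[of b c], of i] integrable_moment[of b c] by simp
  have int: "integrable M (\<lambda>\<omega>. \<bar>sample_moment \<xi> n \<omega> b c - moment M \<xi> b c\<bar>)" for n b c
    unfolding sample_moment_def using int_i by auto
  show "integrable M (moment_deviation M \<xi> n)"
    unfolding moment_deviation_def using int by auto
  have "(\<lambda>n. \<Sum>b\<in>Basis. \<Sum>c\<in>Basis. expectation (\<lambda>\<omega>. \<bar>sample_moment \<xi> n \<omega> b c - moment M \<xi> b c\<bar>))
      \<longlonglongrightarrow> (\<Sum>b\<in>(Basis::'e set). \<Sum>c\<in>(Basis::'e set). 0)"
    unfolding sample_moment_def moment_def
    by (intro tendsto_sum weak_law_of_large_numbers_L1[OF X]) (rule integrable_moment)
  then show "(\<lambda>n. expectation (moment_deviation M \<xi> n)) \<longlonglongrightarrow> 0"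
    unfolding moment_deviation_def using int by simp
qed

lemma moment_self_eq_0_iff: "moment M \<xi> x x = 0 \<longleftrightarrow> (AE \<omega> in M. x \<bullet> \<xi> 0 \<omega> = 0)"
  unfolding moment_def by (subst integral_nonneg_eq_0_iff_AE[OF integrable_moment]) simp_all

lemma moment_Cauchy_Schwarz: "(moment M \<xi> x y)\<^sup>2 \<le> moment M \<xi> x x * moment M \<xi> y y"
proof -
  note B = bilinear_moment
  let ?m = "moment M \<xi>"
  have "0 \<le> ?m x x + 2 * ?m x y * t + ?m y y * t\<^sup>2" for t
    using moment_nonneg[of M \<xi> "x + t *\<^sub>R y"] moment_commute[of M \<xi> x y]
    by (simp add: bilinear_ladd[OF B] bilinear_radd[OF B] bilinear_lmul[OF B] bilinear_rmul[OF B]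
        power2_eq_square algebra_simps)
  then show ?thesis by (rule nonneg_quadratic_discriminant) (rule moment_nonneg)
qed

end

end

section \<open>The endogenous regression model\<close>

context prob_space
begin

lemma expectation_eq_0I:
  fixes X :: "'a \<Rightarrow> 'b::euclidean_space"
  assumes "X \<in> borel_measurable M" "integrable M (\<lambda>\<omega>. (norm (X \<omega>))\<^sup>2)"
    and "\<And>y. expectation (\<lambda>\<omega>. y \<bullet> X \<omega>) = 0"
  shows "expectation X = 0"
proof -
  have "y \<bullet> expectation X = 0" for y
    using assms(3)[of y] square_integrable_imp_integrable_vector[OF assms(1,2)] by simp
  then show ?thesis using inner_eq_zero_iff by blast
qed

end

text \<open>\<open>w\<close> stands for the second-stage regressors: every combination \<open>c \<bullet> w\<close> is the first-stage fit
  of \<open>c \<bullet> D\<close>.\<close>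
definition two_stage_coefficients ::
    "nat \<Rightarrow> (nat \<Rightarrow> 'p::real_inner) \<Rightarrow> (nat \<Rightarrow> 'd::real_inner) \<Rightarrow> (nat \<Rightarrow> real) \<Rightarrow> 'd \<Rightarrow> bool" where
  "two_stage_coefficients n W D Y b \<longleftrightarrow>
     (\<exists>w. (\<forall>c. \<exists>a. least_squares n W (\<lambda>i. c \<bullet> D i) a \<and> (\<forall>i<n. c \<bullet> w i = a \<bullet> W i)) \<and>
          least_squares n w Y b)"

definition control_function_coefficients ::
    "nat \<Rightarrow> (nat \<Rightarrow> 'p::real_inner) \<Rightarrow> (nat \<Rightarrow> 'd::real_inner) \<Rightarrow> (nat \<Rightarrow> real) \<Rightarrow> (nat \<Rightarrow> real) \<Rightarrow>
     'd \<Rightarrow> real \<Rightarrow> bool" where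
  "control_function_coefficients n W D X Y b r \<longleftrightarrow>
     (\<exists>a. least_squares n W X a \<and> least_squares n (\<lambda>i. (D i, X i - a \<bullet> W i)) Y (b, r))"

text \<open>\<open>D\<close> may be correlated with \<open>v\<close>, which is the endogeneity;
  \<open>\<epsilon>\<close> is independent of \<open>D\<close>. The assumption \<open>rank\<close>
  says that the cross moment matrix of \<open>W\<close> and \<open>D\<close> has trivial kernel,
  that is, that the coefficients of \<open>D\<close> are identified through
  \<open>W\<close>.\<close>

locale endogenous_regression = prob_space M for M :: "'w measure" +
  fixes W :: "nat \<Rightarrow> 'w \<Rightarrow> 'p::euclidean_space" and D :: "nat \<Rightarrow> 'w \<Rightarrow> 'd::euclidean_space"
    and v \<epsilon> :: "nat \<Rightarrow> 'w \<Rightarrow> real" and \<rho> :: real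
  assumes iid_all: "iid M (\<lambda>i \<omega>. (W i \<omega>, D i \<omega>, v i \<omega>, \<epsilon> i \<omega>))"
    and sq_W: "integrable M (\<lambda>\<omega>. (norm (W 0 \<omega>))\<^sup>2)"
    and sq_D: "integrable M (\<lambda>\<omega>. (norm (D 0 \<omega>))\<^sup>2)"
    and sq_v: "integrable M (\<lambda>\<omega>. (v 0 \<omega>)\<^sup>2)"
    and sq_\<epsilon>: "integrable M (\<lambda>\<omega>. (\<epsilon> 0 \<omega>)\<^sup>2)"
    and indep_W: "indep_rv M (W 0) (\<lambda>\<omega>. (v 0 \<omega>, \<epsilon> 0 \<omega>))"
    and indep_\<epsilon>: "indep_rv M (\<lambda>\<omega>. (W 0 \<omega>, D 0 \<omega>, v 0 \<omega>)) (\<epsilon> 0)"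
    and mean_v: "expectation (v 0) = 0"
    and mean_\<epsilon>: "expectation (\<epsilon> 0) = 0"
    and lin_indep_W: "\<And>a. AE \<omega> in M. a \<bullet> W 0 \<omega> = 0 \<Longrightarrow> a = 0"
    and rank: "\<And>b. (\<And>m. expectation (\<lambda>\<omega>. (m \<bullet> W 0 \<omega>) * (b \<bullet> D 0 \<omega>)) = 0) \<Longrightarrow> b = 0"
begin

text \<open>All second moments are values of one bilinear form on the stacked vector \<open>\<xi>\<close>.\<close>
definition "\<xi> i \<omega> = (W i \<omega>, D i \<omega>, v i \<omega>, \<epsilon> i \<omega>)"
definition eW :: "'p \<Rightarrow> 'p \<times> 'd \<times> real \<times> real" where "eW m = (m, 0, 0, 0)"
definition eD :: "'d \<Rightarrow> 'p \<times> 'd \<times> real \<times> real" where "eD c = (0, c, 0, 0)"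
definition ev :: "'p \<times> 'd \<times> real \<times> real" where "ev = (0, 0, 1, 0)"
definition ee :: "'p \<times> 'd \<times> real \<times> real" where "ee = (0, 0, 0, 1)"

abbreviation E :: "'p \<times> 'd \<times> real \<times> real \<Rightarrow> 'p \<times> 'd \<times> real \<times> real \<Rightarrow> real" where
  "E \<equiv> moment M \<xi>"
abbreviation En :: "nat \<Rightarrow> 'w \<Rightarrow> 'p \<times> 'd \<times> real \<times> real \<Rightarrow> 'p \<times> 'd \<times> real \<times> real \<Rightarrow> real" where
  "En \<equiv> sample_moment \<xi>"

lemma inner_\<xi> [simp]:
  "eW m \<bullet> \<xi> i \<omega> = m \<bullet> W i \<omega>" "eD c \<bullet> \<xi> i \<omega> = c \<bullet> D i \<omega>" "ev \<bullet> \<xi> i \<omega> = v i \<omega>" "ee \<bullet> \<xi> i \<omega> = \<epsilon> i \<omega>"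
  by (simp_all add: eW_def eD_def ev_def ee_def \<xi>_def)

lemma embed_simps:
  "eW (a + b) = eW a + eW b" "eW (r *\<^sub>R a) = r *\<^sub>R eW a" "eD (c + d) = eD c + eD d"
  "eD (r *\<^sub>R c) = r *\<^sub>R eD c" "eW 0 = 0" "eD 0 = 0"
  by (simp_all add: eW_def eD_def zero_prod_def)

lemma embed_norm [simp]: "norm (eW a) = norm a" "norm (eD c) = norm c" "norm ev = 1" "norm ee = 1"
  by (simp_all add: eW_def eD_def ev_def ee_def norm_Pair)

lemma iid_\<xi>: "iid M \<xi>"
  using iid_all by (simp add: \<xi>_def[abs_def])

lemma measurable_components [measurable]:
  "W i \<in> borel_measurable M" "D i \<in> borel_measurable M" "v i \<in> borel_measurable M" "\<epsilon> i \<in> borel_measurable M"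
proof -
  have *: "\<xi> i \<in> borel_measurable M" by (rule iid_measurable[OF iid_\<xi>])
  have "(\<lambda>\<omega>. fst (\<xi> i \<omega>)) \<in> borel_measurable M" "(\<lambda>\<omega>. fst (snd (\<xi> i \<omega>))) \<in> borel_measurable M"
    "(\<lambda>\<omega>. fst (snd (snd (\<xi> i \<omega>)))) \<in> borel_measurable M" "(\<lambda>\<omega>. snd (snd (snd (\<xi> i \<omega>)))) \<in> borel_measurable M"
    by (rule measurable_compose[OF *], intro borel_measurable_continuous_onI continuous_intros)+
  then show "W i \<in> borel_measurable M" "D i \<in> borel_measurable M" "v i \<in> borel_measurable M" "\<epsilon> i \<in> borel_measurable M"
    by (simp_all add: \<xi>_def)
qed

lemma sq_\<xi>: "integrable M (\<lambda>\<omega>. (norm (\<xi> 0 \<omega>))\<^sup>2)"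
  using sq_W sq_D sq_v sq_\<epsilon> by (simp add: \<xi>_def norm_Pair)

lemmas bilinear_E = bilinear_moment[OF iid_\<xi> sq_\<xi>]
lemmas E_bilinear_simps =
  bilinear_ladd[OF bilinear_E] bilinear_radd[OF bilinear_E] bilinear_lmul[OF bilinear_E]
  bilinear_rmul[OF bilinear_E] bilinear_lsub[OF bilinear_E] bilinear_rsub[OF bilinear_E]
  bilinear_lzero[OF bilinear_E] bilinear_rzero[OF bilinear_E]
  bilinear_lneg[OF bilinear_E] bilinear_rneg[OF bilinear_E]
lemmas E_commute = moment_commute[of M \<xi>]
lemmas E_nonneg = moment_nonneg[of M \<xi>]
lemmas E_eq_0_iff = moment_self_eq_0_iff[OF iid_\<xi> sq_\<xi>]
lemmas E_Cauchy_Schwarz = moment_Cauchy_Schwarz[OF iid_\<xi> sq_\<xi>]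

lemma integrable_components:
  "integrable M (W 0)" "integrable M (D 0)" "integrable M (v 0)" "integrable M (\<epsilon> 0)"
  by (rule square_integrable_imp_integrable_vector; simp add: sq_W sq_D sq_v sq_\<epsilon>)+

lemmas indep_W_error = indep_rv_integral_mult[OF indep_W]
lemmas indep_\<epsilon>_rest = indep_rv_integral_mult[OF indep_\<epsilon>]

lemma E_W_v: "E (eW m) ev = 0"
  and E_W_\<epsilon>: "E (eW m) ee = 0"
  and E_D_\<epsilon>: "E (eD c) ee = 0"
  and E_v_\<epsilon>: "E ev ee = 0"
proof -
  have meas: "(\<lambda>w. m \<bullet> w) \<in> borel_measurable (borel :: 'p measure)"
    "fst \<in> borel_measurable (borel :: (real \<times> real) measure)"
    "snd \<in> borel_measurable (borel :: (real \<times> real) measure)"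
    "(\<lambda>w. c \<bullet> fst (snd w)) \<in> borel_measurable (borel :: ('p \<times> 'd \<times> real) measure)"
    "(\<lambda>w. snd (snd w)) \<in> borel_measurable (borel :: ('p \<times> 'd \<times> real) measure)"
    "(\<lambda>x. x) \<in> borel_measurable (borel :: real measure)"
    by (intro borel_measurable_continuous_onI continuous_intros)+
  have int: "integrable M (\<lambda>\<omega>. m \<bullet> W 0 \<omega>)" "integrable M (\<lambda>\<omega>. c \<bullet> D 0 \<omega>)"
    using integrable_components by simp_all
  show "E (eW m) ev = 0"
    using indep_W_error(2)[OF meas(1,2)] int integrable_components by (simp add: moment_def mean_v)
  show "E (eW m) ee = 0"
    using indep_W_error(2)[OF meas(1,3)] int integrable_components by (simp add: moment_def mean_\<epsilon>)
  show "E (eD c) ee = 0"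
    using indep_\<epsilon>_rest(2)[OF meas(4,6)] int integrable_components by (simp add: moment_def mean_\<epsilon>)
  show "E ev ee = 0"
    using indep_\<epsilon>_rest(2)[OF meas(5,6)] int integrable_components by (simp add: moment_def mean_\<epsilon>)
qed

lemma E_W_nondegenerate: "E (eW m) (eW m) = 0 \<Longrightarrow> m = 0"
  unfolding E_eq_0_iff using lin_indep_W[of m] by simp

lemma E_rank: "(\<And>m. E (eW m) (eD b) = 0) \<Longrightarrow> b = 0"
  using rank[of b] by (simp add: moment_def)

lemma bilinear_W: "bilinear (\<lambda>m l. E (eW m) (eW l))"
  unfolding bilinear_def by (auto intro!: linearI simp: embed_simps E_bilinear_simps)

text \<open>Normalises a vanishing variance, so that the limiting linear system of the control function
  estimator stays regular when the first-stage error vanishes.\<close>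
definition \<kappa> :: real where "\<kappa> = of_bool (E ev ev = 0)"

lemma var_v_pos: "E ev ev + \<kappa> > 0"
  using E_nonneg[of ev] by (auto simp: \<kappa>_def)

text \<open>Population limits of the stacked normal equations of both stages, as bilinear forms in the
  scaled errors \<open>x\<close> and the test vector \<open>y\<close>. In \<open>KT\<close> the auxiliary unknown is the coefficient
  vector of the first-stage fit of \<open>b \<bullet> D\<close> minus the outcome error; in \<open>KC\<close> the first component is the
  first-stage error and the last one is the error of the residual's coefficient.\<close>
definition KT :: "'p \<times> 'd \<Rightarrow> 'p \<times> 'd \<Rightarrow> real" where
  "KT x y = E (eW (fst y)) (eW (fst x) - eD (snd x)) + E (eW (fst x)) (eD (snd y))"

definition KC :: "'p \<times> 'd \<times> real \<Rightarrow> 'p \<times> 'd \<times> real \<Rightarrow> real" where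
  "KC x y = (case x of (a, b, r) \<Rightarrow> case y of (m, c, q) \<Rightarrow>
     E (eW m) (eW a) + E (eD c) (eD b + r *\<^sub>R ev - \<rho> *\<^sub>R eW a) + q * E ev (eD b + r *\<^sub>R ev) + \<kappa> * q * r)"

lemma bilinear_KT: "bilinear KT"
  unfolding bilinear_def KT_def
  by (auto intro!: linearI simp: embed_simps E_bilinear_simps algebra_simps)

lemma bilinear_KC: "bilinear KC"
  unfolding bilinear_def KC_def
  by (auto intro!: linearI simp: embed_simps E_bilinear_simps algebra_simps)

text \<open>Saddle point structure: testing with the unknown itself cancels the two mixed terms and
  leaves \<open>E (eW l) (eW l)\<close>; once \<open>l = 0\<close>, the rank assumption gives
  \<open>b = 0\<close>.\<close>

lemma KT_nondegenerate:
  assumes "\<And>y. KT x y = 0" shows "x = 0"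
proof -
  obtain l b where x: "x = (l, b)" by (cases x)
  have "E (eW l) (eW l) = 0"
    using assms[of "(l, b)"] by (simp add: KT_def x E_bilinear_simps)
  then have l: "l = 0" by (rule E_W_nondegenerate)
  then have "E (eW m) (eD b) = 0" for m
    using assms[of "(m, 0)"] by (simp add: KT_def x E_bilinear_simps embed_simps)
  then have "b = 0" by (rule E_rank)
  with l show ?thesis by (simp add: x zero_prod_def)
qed

lemma E_null_right: "E z z = 0 \<Longrightarrow> E x z = 0"
  using E_Cauchy_Schwarz[of x z] by simp

text \<open>Block triangular: the test vector \<open>(a, 0, 0)\<close> isolates the first-stage
  error, and on the rest the form is a sum of squares. If a combination of \<open>D\<close> and
  \<open>v\<close> is null, pairing it with \<open>W\<close> removes \<open>v\<close> and the rank
  assumption gives \<open>b = 0\<close>; positivity of \<open>E ev ev + \<kappa>\<close> then gives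
  \<open>r = 0\<close>.\<close>

lemma KC_nondegenerate:
  assumes "\<And>y. KC x y = 0" shows "x = 0"
proof -
  obtain a b r where x: "x = (a, b, r)" by (cases x)
  have "E (eW a) (eW a) = 0"
    using assms[of "(a, 0, 0)"] by (simp add: KC_def x E_bilinear_simps embed_simps)
  then have a: "a = 0" by (rule E_W_nondegenerate)
  let ?z = "eD b + r *\<^sub>R ev"
  have "E ?z ?z + \<kappa> * r\<^sup>2 = 0"
    using assms[of "(0, b, r)"]
    by (simp add: KC_def x a E_bilinear_simps embed_simps power2_eq_square algebra_simps)
  moreover have "E ?z ?z \<ge> 0" "\<kappa> * r\<^sup>2 \<ge> 0" by (rule E_nonneg) (simp add: \<kappa>_def)
  ultimately have z: "E ?z ?z = 0" and \<kappa>r: "\<kappa> * r\<^sup>2 = 0" by linarith+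
  have "E (eW m) (eD b) = 0" for m
    using E_null_right[OF z, of "eW m"] by (simp add: E_bilinear_simps E_W_v)
  then have b: "b = 0" by (rule E_rank)
  then have "r\<^sup>2 * (E ev ev + \<kappa>) = 0"
    using z \<kappa>r by (auto simp: b embed_simps E_bilinear_simps power2_eq_square distrib_left)
  then have "r = 0" using var_v_pos by simp
  with a b show ?thesis by (simp add: x zero_prod_def)
qed

text \<open>Contributions of one observation to the right-hand sides of the two stacked systems. The
  minus sign matches the convention of \<open>KT\<close>; the zero component belongs to the
  second-stage normal equation, which has no error term. Each nonzero component is a product of
  independent square integrable factors and thus square integrable.\<close>

definition "\<tau>T i \<omega> = (- ((\<rho> * v i \<omega> + \<epsilon> i \<omega>) *\<^sub>R W i \<omega>), 0 :: 'd)"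
definition "\<tau>C i \<omega> = (v i \<omega> *\<^sub>R W i \<omega>, \<epsilon> i \<omega> *\<^sub>R D i \<omega>, v i \<omega> * \<epsilon> i \<omega>)"

lemma integrable_E: "integrable M (\<lambda>\<omega>. (x \<bullet> \<xi> 0 \<omega>) * (y \<bullet> \<xi> 0 \<omega>))"
  by (rule integrable_moment[OF iid_\<xi> sq_\<xi>])

lemma second_moment: "expectation (\<lambda>\<omega>. (x \<bullet> \<xi> 0 \<omega>)\<^sup>2) = E x x"
  by (simp add: moment_def power2_eq_square)

lemma integrable_square: "integrable M (\<lambda>\<omega>. (x \<bullet> \<xi> 0 \<omega>)\<^sup>2)"
  using integrable_E[of x x] by (simp add: power2_eq_square)

lemma \<tau>T:
  "iid M \<tau>T" "integrable M (\<lambda>\<omega>. (norm (\<tau>T 0 \<omega>))\<^sup>2)" "expectation (\<tau>T 0) = 0"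
  "expectation (\<lambda>\<omega>. ((m, c) \<bullet> \<tau>T 0 \<omega>)\<^sup>2) = (\<rho>\<^sup>2 * E ev ev + E ee ee) * E (eW m) (eW m)"
proof -
  define F where "F x = (- ((\<rho> * fst (snd (snd x)) + snd (snd (snd x))) *\<^sub>R fst x), 0 :: 'd)"
    for x :: "'p \<times> 'd \<times> real \<times> real"
  have "F \<in> borel_measurable borel"
    unfolding F_def by (intro borel_measurable_continuous_onI continuous_intros)
  from iid_compose[OF iid_\<xi> this] show iid: "iid M \<tau>T"
    by (simp add: F_def \<xi>_def \<tau>T_def[abs_def])
  define u where "u \<omega> = \<rho> * v 0 \<omega> + \<epsilon> 0 \<omega>" for \<omega>
  have u: "u \<omega> = (\<rho> *\<^sub>R ev + ee) \<bullet> \<xi> 0 \<omega>" for \<omega> by (simp add: u_def inner_add_left)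
  have Eu: "E (\<rho> *\<^sub>R ev + ee) (\<rho> *\<^sub>R ev + ee) = \<rho>\<^sup>2 * E ev ev + E ee ee"
    using E_commute[of ee ev] by (simp add: E_bilinear_simps E_v_\<epsilon> power2_eq_square algebra_simps)
  have meas: "(\<lambda>x::real \<times> real. (\<rho> * fst x + snd x)\<^sup>2) \<in> borel_measurable borel"
    "(\<lambda>w::'p. (norm w)\<^sup>2) \<in> borel_measurable borel" "(\<lambda>w::'p. (m \<bullet> w)\<^sup>2) \<in> borel_measurable borel"
    by (intro borel_measurable_continuous_onI continuous_intros)+
  have u_sq: "integrable M (\<lambda>\<omega>. (\<rho> * v 0 \<omega> + \<epsilon> 0 \<omega>)\<^sup>2)"
    using integrable_square[of "\<rho> *\<^sub>R ev + ee"] by (simp add: inner_add_left)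
  show sq: "integrable M (\<lambda>\<omega>. (norm (\<tau>T 0 \<omega>))\<^sup>2)"
    using indep_W_error(1)[OF meas(2,1)] sq_W u_sq
    by (simp add: \<tau>T_def norm_Pair power_mult_distrib mult.commute)
  show "expectation (\<tau>T 0) = 0"
  proof (rule expectation_eq_0I[OF iid_measurable[OF iid] sq])
    fix y :: "'p \<times> 'd"
    obtain m c where y: "y = (m, c)" by (cases y)
    have "expectation (\<lambda>\<omega>. y \<bullet> \<tau>T 0 \<omega>) = expectation (\<lambda>\<omega>. - ((eW m \<bullet> \<xi> 0 \<omega>) * ((\<rho> *\<^sub>R ev + ee) \<bullet> \<xi> 0 \<omega>)))"
      unfolding u[symmetric] by (simp add: y \<tau>T_def u_def mult.commute)
    also have "\<dots> = - E (eW m) (\<rho> *\<^sub>R ev + ee)"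
      unfolding moment_def by (rule Bochner_Integration.integral_minus)
    also have "\<dots> = 0" by (simp add: E_bilinear_simps E_W_v E_W_\<epsilon>)
    finally show "expectation (\<lambda>\<omega>. y \<bullet> \<tau>T 0 \<omega>) = 0" .
  qed
  have "expectation (\<lambda>\<omega>. ((m, c) \<bullet> \<tau>T 0 \<omega>)\<^sup>2) = expectation (\<lambda>\<omega>. (m \<bullet> W 0 \<omega>)\<^sup>2 * (\<rho> * v 0 \<omega> + \<epsilon> 0 \<omega>)\<^sup>2)"
    by (simp add: \<tau>T_def power_mult_distrib mult.commute)
  also have "\<dots> = expectation (\<lambda>\<omega>. (m \<bullet> W 0 \<omega>)\<^sup>2) * expectation (\<lambda>\<omega>. (\<rho> * v 0 \<omega> + \<epsilon> 0 \<omega>)\<^sup>2)"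
    using indep_W_error(2)[OF meas(3,1)] integrable_square[of "eW m"] u_sq by simp
  also have "\<dots> = E (eW m) (eW m) * (\<rho>\<^sup>2 * E ev ev + E ee ee)"
    using second_moment[of "eW m"] second_moment[of "\<rho> *\<^sub>R ev + ee"] unfolding Eu
    by (simp add: inner_add_left)
  finally show "expectation (\<lambda>\<omega>. ((m, c) \<bullet> \<tau>T 0 \<omega>)\<^sup>2) = (\<rho>\<^sup>2 * E ev ev + E ee ee) * E (eW m) (eW m)"
    by (simp add: mult.commute)
qed

lemma \<tau>C:
  "iid M \<tau>C" "integrable M (\<lambda>\<omega>. (norm (\<tau>C 0 \<omega>))\<^sup>2)" "expectation (\<tau>C 0) = 0"
  "expectation (\<lambda>\<omega>. ((m, c, q) \<bullet> \<tau>C 0 \<omega>)\<^sup>2) =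
     E ev ev * E (eW m) (eW m) + E ee ee * E (eD c + q *\<^sub>R ev) (eD c + q *\<^sub>R ev)"
proof -
  define F where "F x = (fst (snd (snd x)) *\<^sub>R fst x, snd (snd (snd x)) *\<^sub>R fst (snd x),
      fst (snd (snd x)) * snd (snd (snd x)))"
    for x :: "'p \<times> 'd \<times> real \<times> real"
  have "F \<in> borel_measurable borel"
    unfolding F_def by (intro borel_measurable_continuous_onI continuous_intros)
  from iid_compose[OF iid_\<xi> this] show iid: "iid M \<tau>C"
    by (simp add: F_def \<xi>_def \<tau>C_def[abs_def])
  have meas: "(\<lambda>x::real \<times> real. (fst x)\<^sup>2) \<in> borel_measurable borel"
    "(\<lambda>w::'p. (norm w)\<^sup>2) \<in> borel_measurable borel" "(\<lambda>w::'p. (m \<bullet> w)\<^sup>2) \<in> borel_measurable borel"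
    "(\<lambda>x::real. x\<^sup>2) \<in> borel_measurable borel" "(\<lambda>x::real. x) \<in> borel_measurable borel"
    "(\<lambda>w::'p \<times> 'd \<times> real. (norm (fst (snd w)))\<^sup>2) \<in> borel_measurable borel"
    "(\<lambda>w::'p \<times> 'd \<times> real. (snd (snd w))\<^sup>2) \<in> borel_measurable borel"
    "(\<lambda>w::'p \<times> 'd \<times> real. (c \<bullet> fst (snd w) + q * snd (snd w))\<^sup>2) \<in> borel_measurable borel"
    "(\<lambda>w::'p \<times> 'd \<times> real. (snd (snd w) * (m \<bullet> fst w)) * (c \<bullet> fst (snd w) + q * snd (snd w)))
        \<in> borel_measurable borel"
    by (intro borel_measurable_continuous_onI continuous_intros)+
  show sq: "integrable M (\<lambda>\<omega>. (norm (\<tau>C 0 \<omega>))\<^sup>2)"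
    using indep_W_error(1)[OF meas(2,1)] indep_\<epsilon>_rest(1)[OF meas(6,4)] indep_\<epsilon>_rest(1)[OF meas(7,4)]
      sq_W sq_D sq_v sq_\<epsilon>
    by (simp add: \<tau>C_def norm_Pair power_mult_distrib mult.commute)
  show "expectation (\<tau>C 0) = 0"
  proof (rule expectation_eq_0I[OF iid_measurable[OF iid] sq])
    fix y :: "'p \<times> 'd \<times> real"
    obtain m c q where y: "y = (m, c, q)" by (cases y)
    have "expectation (\<lambda>\<omega>. y \<bullet> \<tau>C 0 \<omega>) = expectation (\<lambda>\<omega>.
        (eW m \<bullet> \<xi> 0 \<omega>) * (ev \<bullet> \<xi> 0 \<omega>) + ((eD c + q *\<^sub>R ev) \<bullet> \<xi> 0 \<omega>) * (ee \<bullet> \<xi> 0 \<omega>))"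
      by (simp add: y \<tau>C_def inner_add_left algebra_simps)
    also have "\<dots> = E (eW m) ev + E (eD c + q *\<^sub>R ev) ee"
      unfolding moment_def by (intro Bochner_Integration.integral_add integrable_E)
    also have "\<dots> = 0" by (simp add: E_bilinear_simps E_W_v E_D_\<epsilon> E_v_\<epsilon>)
    finally show "expectation (\<lambda>\<omega>. y \<bullet> \<tau>C 0 \<omega>) = 0" .
  qed
  let ?z = "\<lambda>\<omega>. c \<bullet> D 0 \<omega> + q * v 0 \<omega>"
  have z_sq: "integrable M (\<lambda>\<omega>. (?z \<omega>)\<^sup>2)" "expectation (\<lambda>\<omega>. (?z \<omega>)\<^sup>2) = E (eD c + q *\<^sub>R ev) (eD c + q *\<^sub>R ev)"
    using integrable_square[of "eD c + q *\<^sub>R ev"] second_moment[of "eD c + q *\<^sub>R ev"]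
    by (simp_all add: inner_add_left)
  have m_sq: "integrable M (\<lambda>\<omega>. (m \<bullet> W 0 \<omega>)\<^sup>2)" using integrable_square[of "eW m"] by simp
  note A = indep_W_error[OF meas(3,1)]
  have A1: "integrable M (\<lambda>\<omega>. (m \<bullet> W 0 \<omega>)\<^sup>2 * (v 0 \<omega>)\<^sup>2)"
    "expectation (\<lambda>\<omega>. (m \<bullet> W 0 \<omega>)\<^sup>2 * (v 0 \<omega>)\<^sup>2) = E (eW m) (eW m) * E ev ev"
    using A m_sq sq_v second_moment[of "eW m"] second_moment[of ev] by simp_all
  note B = indep_\<epsilon>_rest[OF meas(8,4)]
  have B1: "integrable M (\<lambda>\<omega>. (?z \<omega>)\<^sup>2 * (\<epsilon> 0 \<omega>)\<^sup>2)"
    "expectation (\<lambda>\<omega>. (?z \<omega>)\<^sup>2 * (\<epsilon> 0 \<omega>)\<^sup>2) = E (eD c + q *\<^sub>R ev) (eD c + q *\<^sub>R ev) * E ee ee"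
    using B z_sq sq_\<epsilon> second_moment[of ee] by simp_all
  \<comment> \<open>The mixed term is \<open>\<epsilon>\<close> times a function of
    \<open>(W, D, v)\<close>, hence has mean zero; it is integrable because \<open>v\<close> times
    \<open>m \<bullet> W\<close> is square integrable by independence.\<close>
  have "integrable M (\<lambda>\<omega>. (v 0 \<omega> * (m \<bullet> W 0 \<omega>)) * ?z \<omega>)"
    using A1(1) z_sq(1)
    by (intro square_integrable_mult) (simp_all add: power_mult_distrib mult.commute)
  then have C1: "integrable M (\<lambda>\<omega>. (v 0 \<omega> * (m \<bullet> W 0 \<omega>)) * ?z \<omega> * \<epsilon> 0 \<omega>)"
    "expectation (\<lambda>\<omega>. (v 0 \<omega> * (m \<bullet> W 0 \<omega>)) * ?z \<omega> * \<epsilon> 0 \<omega>) = 0"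
    using indep_\<epsilon>_rest[OF meas(9,5)] integrable_components mean_\<epsilon> by simp_all
  have eq: "((m, c, q) \<bullet> \<tau>C 0 \<omega>)\<^sup>2 = (m \<bullet> W 0 \<omega>)\<^sup>2 * (v 0 \<omega>)\<^sup>2 + (?z \<omega>)\<^sup>2 * (\<epsilon> 0 \<omega>)\<^sup>2 +
      2 * ((v 0 \<omega> * (m \<bullet> W 0 \<omega>)) * ?z \<omega> * \<epsilon> 0 \<omega>)" for \<omega>
    by (simp add: \<tau>C_def power2_eq_square algebra_simps)
  show "expectation (\<lambda>\<omega>. ((m, c, q) \<bullet> \<tau>C 0 \<omega>)\<^sup>2) =
     E ev ev * E (eW m) (eW m) + E ee ee * E (eD c + q *\<^sub>R ev) (eD c + q *\<^sub>R ev)"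
    unfolding eq using A1 B1 C1 by (simp add: mult.commute)
qed

end

section \<open>Normal equations of the two estimators\<close>

lemma scaled_sum_div: "n > 0 \<Longrightarrow> sqrt (real n) * s / n = s / sqrt (real n)"
  by (simp add: field_simps)

context endogenous_regression
begin

text \<open>The unknown \<open>l\<close> is the scaled coefficient vector of the first-stage fit of
  \<open>(b - \<beta>) \<bullet> D\<close> minus the error \<open>\<rho> * v + \<epsilon>\<close>.
  The first block states that it is such a fit, the second that the fit is orthogonal in the sample
  to every combination of \<open>D\<close>.\<close>

lemma two_stage_linear_system:
  assumes n: "n > 0"
    and est: "two_stage_coefficients n (\<lambda>i. W i \<omega>) (\<lambda>i. D i \<omega>)
      (\<lambda>i. \<beta> \<bullet> D i \<omega> + (\<rho> * v i \<omega> + \<epsilon> i \<omega>)) b"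
  obtains l where "\<And>m c. En n \<omega> (eW m) (eW l - eD (sqrt n *\<^sub>R (b - \<beta>))) + En n \<omega> (eW l) (eD c) =
    ((1 / sqrt n) *\<^sub>R (\<Sum>i<n. \<tau>T i \<omega>)) \<bullet> (m, c)"
proof -
  define u where "u i = \<rho> * v i \<omega> + \<epsilon> i \<omega>" for i
  let ?W = "\<lambda>i. W i \<omega>" and ?D = "\<lambda>i. D i \<omega>"
  obtain w where fit: "\<And>c. \<exists>a. least_squares n ?W (\<lambda>i. c \<bullet> ?D i) a \<and> (\<forall>i<n. c \<bullet> w i = a \<bullet> ?W i)"
    and second: "least_squares n w (\<lambda>i. \<beta> \<bullet> ?D i + u i) b"
    using est unfolding two_stage_coefficients_def u_def by blast
  obtain a0 where a0: "least_squares n ?W (\<lambda>i. (b - \<beta>) \<bullet> ?D i) a0" "\<forall>i<n. (b - \<beta>) \<bullet> w i = a0 \<bullet> ?W i"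
    using fit by blast
  obtain a1 where a1: "least_squares n ?W (\<lambda>i. \<beta> \<bullet> ?D i) a1" "\<forall>i<n. \<beta> \<bullet> w i = a1 \<bullet> ?W i"
    using fit by blast
  obtain a2 where a2: "least_squares n ?W u a2" by (rule least_squares_exists)
  define l where "l = sqrt n *\<^sub>R (a0 - a2)"
  have N0: "(\<Sum>i<n. (m \<bullet> ?W i) * ((b - \<beta>) \<bullet> ?D i - a0 \<bullet> ?W i)) = 0"
    and N1: "(\<Sum>i<n. (m \<bullet> ?W i) * (\<beta> \<bullet> ?D i - a1 \<bullet> ?W i)) = 0"
    and N2: "(\<Sum>i<n. (m \<bullet> ?W i) * (u i - a2 \<bullet> ?W i)) = 0" for m
    using a0(1) a1(1) a2 by (simp_all add: least_squares_iff_normal_equations)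
  have first_eq: "(\<Sum>i<n. (m \<bullet> ?W i) * (l \<bullet> ?W i - (sqrt n *\<^sub>R (b - \<beta>)) \<bullet> ?D i)) =
      - sqrt n * (\<Sum>i<n. (m \<bullet> ?W i) * u i)" for m
  proof -
    have "(\<Sum>i<n. (m \<bullet> ?W i) * (l \<bullet> ?W i - (sqrt n *\<^sub>R (b - \<beta>)) \<bullet> ?D i)) =
      sqrt n * ((\<Sum>i<n. (m \<bullet> ?W i) * (u i - a2 \<bullet> ?W i)) - (\<Sum>i<n. (m \<bullet> ?W i) * ((b - \<beta>) \<bullet> ?D i - a0 \<bullet> ?W i))
        - (\<Sum>i<n. (m \<bullet> ?W i) * u i))"
      unfolding sum_subtractf[symmetric] sum_distrib_left
      by (rule sum.cong) (simp_all add: l_def inner_diff_left algebra_simps)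
    then show ?thesis by (simp only: N0 N2) simp
  qed
  have second_eq: "(\<Sum>i<n. (l \<bullet> ?W i) * (c \<bullet> ?D i)) = 0" for c
  proof -
    obtain ac where ac: "least_squares n ?W (\<lambda>i. c \<bullet> ?D i) ac" "\<forall>i<n. c \<bullet> w i = ac \<bullet> ?W i"
      using fit by blast
    have N3: "(\<Sum>i<n. (l \<bullet> ?W i) * (c \<bullet> ?D i - ac \<bullet> ?W i)) = 0"
      using ac(1) by (simp add: least_squares_iff_normal_equations)
    have "(\<Sum>i<n. (c \<bullet> w i) * (\<beta> \<bullet> ?D i + u i - b \<bullet> w i)) = 0"
      using second by (simp add: least_squares_iff_normal_equations)
    \<comment> \<open>The second-stage residual is the first-stage residual of
      \<open>\<beta> \<bullet> D\<close>, orthogonal to \<open>W\<close>, plus the outcome error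
      minus the fit given by \<open>a0\<close>.\<close>
    also have "(\<Sum>i<n. (c \<bullet> w i) * (\<beta> \<bullet> ?D i + u i - b \<bullet> w i)) =
        (\<Sum>i<n. (ac \<bullet> ?W i) * (\<beta> \<bullet> ?D i - a1 \<bullet> ?W i)) + (\<Sum>i<n. (ac \<bullet> ?W i) * (u i - a0 \<bullet> ?W i))"
      unfolding sum.distrib[symmetric]
    proof (rule sum.cong)
      fix i assume "i \<in> {..<n}"
      then have "c \<bullet> w i = ac \<bullet> ?W i" "b \<bullet> w i = a1 \<bullet> ?W i + a0 \<bullet> ?W i"
        using ac(2) a0(2) a1(2) by (auto simp: inner_diff_left)
      then show "(c \<bullet> w i) * (\<beta> \<bullet> ?D i + u i - b \<bullet> w i) =
          (ac \<bullet> ?W i) * (\<beta> \<bullet> ?D i - a1 \<bullet> ?W i) + (ac \<bullet> ?W i) * (u i - a0 \<bullet> ?W i)"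
        by (simp add: algebra_simps)
    qed simp
    finally have N4: "(\<Sum>i<n. (ac \<bullet> ?W i) * (u i - a0 \<bullet> ?W i)) = 0" by (simp only: N1)
    have "(\<Sum>i<n. (l \<bullet> ?W i) * (c \<bullet> ?D i)) = (\<Sum>i<n. (l \<bullet> ?W i) * (c \<bullet> ?D i - ac \<bullet> ?W i)) +
        sqrt n * ((\<Sum>i<n. (ac \<bullet> ?W i) * (u i - a2 \<bullet> ?W i)) - (\<Sum>i<n. (ac \<bullet> ?W i) * (u i - a0 \<bullet> ?W i)))"
      unfolding sum_subtractf[symmetric] sum_distrib_left sum.distrib[symmetric]
      by (rule sum.cong) (simp_all add: l_def inner_diff_left algebra_simps)
    then show ?thesis by (simp only: N2 N3 N4) simp
  qed
  have "En n \<omega> (eW m) (eW l - eD (sqrt n *\<^sub>R (b - \<beta>))) + En n \<omega> (eW l) (eD c) =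
    ((1 / sqrt n) *\<^sub>R (\<Sum>i<n. \<tau>T i \<omega>)) \<bullet> (m, c)" for m c
  proof -
    have "\<tau>T i \<omega> \<bullet> (m, c) = - ((m \<bullet> ?W i) * u i)" for i
      by (simp add: \<tau>T_def u_def inner_commute)
    then have "((1 / sqrt n) *\<^sub>R (\<Sum>i<n. \<tau>T i \<omega>)) \<bullet> (m, c) = - (\<Sum>i<n. (m \<bullet> ?W i) * u i) / sqrt n"
      by (simp add: inner_sum_left sum_negf)
    also have "\<dots> = (- sqrt n * (\<Sum>i<n. (m \<bullet> ?W i) * u i)) / n"
      using scaled_sum_div[OF n, of "- (\<Sum>i<n. (m \<bullet> ?W i) * u i)"] by simp
    also have "\<dots> = En n \<omega> (eW m) (eW l - eD (sqrt n *\<^sub>R (b - \<beta>)))"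
      unfolding first_eq[symmetric] sample_moment_def by (simp only: inner_diff_left inner_\<xi>)
    also have "En n \<omega> (eW l) (eD c) = 0"
      unfolding sample_moment_def by (simp only: inner_\<xi> second_eq)
    then have "En n \<omega> (eW m) (eW l - eD (sqrt n *\<^sub>R (b - \<beta>))) =
       En n \<omega> (eW m) (eW l - eD (sqrt n *\<^sub>R (b - \<beta>))) + En n \<omega> (eW l) (eD c)" by simp
    finally show ?thesis by simp
  qed
  then show thesis by (rule that)
qed

text \<open>With residual \<open>h = v - a' \<bullet> W\<close> one has
  \<open>\<rho> * v = \<rho> * h + \<rho> * (a' \<bullet> W)\<close>: the generated regressor adds
  the first-stage error to the outcome error, whence the term with \<open>\<rho>\<close>. The term
  with \<open>ee\<close> arises from replacing \<open>h * \<epsilon>\<close> by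
  \<open>v * \<epsilon>\<close>.\<close>

lemma control_function_linear_system:
  assumes n: "n > 0"
    and est: "control_function_coefficients n (\<lambda>i. W i \<omega>) (\<lambda>i. D i \<omega>) (\<lambda>i. \<alpha> \<bullet> W i \<omega> + v i \<omega>)
      (\<lambda>i. \<beta> \<bullet> D i \<omega> + (\<rho> * v i \<omega> + \<epsilon> i \<omega>)) b r"
    and degenerate: "\<kappa> \<noteq> 0 \<longrightarrow> (\<forall>i. v i \<omega> = 0)"
  obtains a' r' where "\<And>m. En n \<omega> (eW m) (ev - eW a') = 0"
    "\<And>m c q. En n \<omega> (eW m) (eW (sqrt n *\<^sub>R a'))
      + En n \<omega> (eD c) (eD (sqrt n *\<^sub>R (b - \<beta>)) + r' *\<^sub>R (ev - eW a') - \<rho> *\<^sub>R eW (sqrt n *\<^sub>R a'))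
      + q * (En n \<omega> (ev - eW a') (eD (sqrt n *\<^sub>R (b - \<beta>)) + r' *\<^sub>R (ev - eW a')) + En n \<omega> ee (eW (sqrt n *\<^sub>R a')))
      + \<kappa> * q * r' =
    ((1 / sqrt n) *\<^sub>R (\<Sum>i<n. \<tau>C i \<omega>)) \<bullet> (m, c, q)"
proof -
  let ?W = "\<lambda>i. W i \<omega>" and ?D = "\<lambda>i. D i \<omega>" and ?v = "\<lambda>i. v i \<omega>" and ?e = "\<lambda>i. \<epsilon> i \<omega>"
  obtain a where first: "least_squares n ?W (\<lambda>i. \<alpha> \<bullet> ?W i + ?v i) a"
    and second: "least_squares n (\<lambda>i. (?D i, \<alpha> \<bullet> ?W i + ?v i - a \<bullet> ?W i))
      (\<lambda>i. \<beta> \<bullet> ?D i + (\<rho> * ?v i + ?e i)) (b, r)"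
    using est unfolding control_function_coefficients_def by blast
  define a' where "a' = a - \<alpha>"
  define h where "h i = ?v i - a' \<bullet> ?W i" for i
  have h: "\<alpha> \<bullet> ?W i + ?v i - a \<bullet> ?W i = h i" for i by (simp add: h_def a'_def inner_diff_left)
  have h_\<xi>: "(ev - eW a') \<bullet> \<xi> i \<omega> = h i" for i by (simp add: inner_diff_left h_def)
  have N1: "(\<Sum>i<n. (m \<bullet> ?W i) * h i) = 0" for m
    using first unfolding least_squares_iff_normal_equations h by blast
  have N2: "(\<Sum>i<n. (c \<bullet> ?D i + q * h i) * (\<beta> \<bullet> ?D i + (\<rho> * ?v i + ?e i) - (b \<bullet> ?D i + r * h i))) = 0" for c q
    using second unfolding least_squares_iff_normal_equations h split_paired_All by simp
  \<comment> \<open>For \<open>\<kappa> \<noteq> 0\<close> all residuals vanish and \<open>r\<close>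
    is arbitrary; the value 0 makes the artificial term \<open>\<kappa> * q * r'\<close> disappear
    in this case too.\<close>
  define r' where "r' = (if \<kappa> = 0 then sqrt n * (r - \<rho>) else 0)"
  have r'h: "r' * h i = sqrt n * (r - \<rho>) * h i" if "i < n" for i
  proof (cases "\<kappa> = 0")
    case False
    \<comment> \<open>Here the residual is itself a combination of \<open>W\<close> and orthogonal
      to all such combinations, hence zero.\<close>
    have "h i = (- a') \<bullet> ?W i" for i using degenerate False by (simp add: h_def)
    then have "(\<Sum>i<n. (h i)\<^sup>2) = 0" using N1[of "- a'"] by (simp add: power2_eq_square)
    then show ?thesis using that by (simp add: sum_nonneg_eq_0_iff)
  qed (simp add: r'_def)
  let ?b = "sqrt n *\<^sub>R (b - \<beta>)" and ?a = "sqrt n *\<^sub>R a'"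
  have resid: "sqrt n * (\<beta> \<bullet> ?D i + (\<rho> * ?v i + ?e i) - (b \<bullet> ?D i + r * h i)) =
      sqrt n * ?e i + \<rho> * (?a \<bullet> ?W i) - ?b \<bullet> ?D i - r' * h i" if "i < n" for i
    unfolding r'h[OF that] by (simp add: h_def inner_diff_left algebra_simps)
  have N3: "(\<Sum>i<n. (c \<bullet> ?D i + q * h i) * (sqrt n * ?e i + \<rho> * (?a \<bullet> ?W i) - ?b \<bullet> ?D i - r' * h i)) = 0" for c q
  proof -
    have "(\<Sum>i<n. (c \<bullet> ?D i + q * h i) * (sqrt n * ?e i + \<rho> * (?a \<bullet> ?W i) - ?b \<bullet> ?D i - r' * h i)) =
        sqrt n * (\<Sum>i<n. (c \<bullet> ?D i + q * h i) * (\<beta> \<bullet> ?D i + (\<rho> * ?v i + ?e i) - (b \<bullet> ?D i + r * h i)))"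
      unfolding sum_distrib_left
    proof (rule sum.cong[OF refl])
      fix i assume "i \<in> {..<n}"
      then have "i < n" by simp
      show "(c \<bullet> ?D i + q * h i) * (sqrt n * ?e i + \<rho> * (?a \<bullet> ?W i) - ?b \<bullet> ?D i - r' * h i) =
          sqrt n * ((c \<bullet> ?D i + q * h i) * (\<beta> \<bullet> ?D i + (\<rho> * ?v i + ?e i) - (b \<bullet> ?D i + r * h i)))"
        unfolding resid[OF \<open>i < n\<close>, symmetric] by (rule mult.left_commute)
    qed
    then show ?thesis by (simp only: N2)
  qed
  have W_eq: "(\<Sum>i<n. (m \<bullet> ?W i) * (?a \<bullet> ?W i)) = sqrt n * (\<Sum>i<n. (m \<bullet> ?W i) * ?v i)" for m
  proof -
    have "(\<Sum>i<n. (m \<bullet> ?W i) * (?a \<bullet> ?W i)) =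
        sqrt n * ((\<Sum>i<n. (m \<bullet> ?W i) * ?v i) - (\<Sum>i<n. (m \<bullet> ?W i) * h i))"
      unfolding sum_subtractf[symmetric] sum_distrib_left
      by (rule sum.cong) (simp_all add: h_def algebra_simps)
    then show ?thesis by (simp only: N1) simp
  qed
  have D_eq: "(\<Sum>i<n. (c \<bullet> ?D i) * (?b \<bullet> ?D i + r' * h i - \<rho> * (?a \<bullet> ?W i))) = sqrt n * (\<Sum>i<n. (c \<bullet> ?D i) * ?e i)" for c
  proof -
    have "(\<Sum>i<n. (c \<bullet> ?D i) * (?b \<bullet> ?D i + r' * h i - \<rho> * (?a \<bullet> ?W i))) = sqrt n * (\<Sum>i<n. (c \<bullet> ?D i) * ?e i)
      - (\<Sum>i<n. (c \<bullet> ?D i + 0 * h i) * (sqrt n * ?e i + \<rho> * (?a \<bullet> ?W i) - ?b \<bullet> ?D i - r' * h i))"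
      unfolding sum_subtractf[symmetric] sum_distrib_left
      by (rule sum.cong) (simp_all add: algebra_simps)
    then show ?thesis by (simp only: N3)
  qed
  have v_eq: "(\<Sum>i<n. h i * (?b \<bullet> ?D i + r' * h i)) + (\<Sum>i<n. ?e i * (?a \<bullet> ?W i)) = sqrt n * (\<Sum>i<n. ?v i * ?e i)"
  proof -
    have "(\<Sum>i<n. h i * (?b \<bullet> ?D i + r' * h i)) + (\<Sum>i<n. ?e i * (?a \<bullet> ?W i)) = sqrt n * (\<Sum>i<n. ?v i * ?e i)
      - (\<Sum>i<n. (0 \<bullet> ?D i + 1 * h i) * (sqrt n * ?e i + \<rho> * (?a \<bullet> ?W i) - ?b \<bullet> ?D i - r' * h i))
      + \<rho> * (\<Sum>i<n. (?a \<bullet> ?W i) * h i)"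
      unfolding sum_subtractf[symmetric] sum_distrib_left sum.distrib[symmetric]
      by (rule sum.cong) (simp_all add: h_def algebra_simps)
    then show ?thesis by (simp only: N3 N1)
  qed
  have \<kappa>r': "\<kappa> * q * r' = 0" for q by (simp add: r'_def)
  have "En n \<omega> (eW m) (ev - eW a') = 0" for m
    unfolding sample_moment_def by (simp only: h_\<xi> inner_\<xi> N1)
  moreover have "En n \<omega> (eW m) (eW ?a)
      + En n \<omega> (eD c) (eD ?b + r' *\<^sub>R (ev - eW a') - \<rho> *\<^sub>R eW ?a)
      + q * (En n \<omega> (ev - eW a') (eD ?b + r' *\<^sub>R (ev - eW a')) + En n \<omega> ee (eW ?a))
      + \<kappa> * q * r' =
    ((1 / sqrt n) *\<^sub>R (\<Sum>i<n. \<tau>C i \<omega>)) \<bullet> (m, c, q)" for m c q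
  proof -
    have "\<tau>C i \<omega> \<bullet> (m, c, q) = (m \<bullet> ?W i) * ?v i + (c \<bullet> ?D i) * ?e i + q * (?v i * ?e i)" for i
      by (simp add: \<tau>C_def inner_commute)
    then have "((1 / sqrt n) *\<^sub>R (\<Sum>i<n. \<tau>C i \<omega>)) \<bullet> (m, c, q) =
      ((\<Sum>i<n. (m \<bullet> ?W i) * ?v i) + (\<Sum>i<n. (c \<bullet> ?D i) * ?e i) + q * (\<Sum>i<n. ?v i * ?e i)) / sqrt n"
      unfolding sum_distrib_left sum.distrib[symmetric]
      by (simp add: inner_sum_left)
    also have "\<dots> = (sqrt n * (\<Sum>i<n. (m \<bullet> ?W i) * ?v i) + sqrt n * (\<Sum>i<n. (c \<bullet> ?D i) * ?e i)
        + q * (sqrt n * (\<Sum>i<n. ?v i * ?e i))) / n"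
      by (subst scaled_sum_div[OF n, symmetric]) (simp add: algebra_simps)
    also have "\<dots> = (\<Sum>i<n. (m \<bullet> ?W i) * (?a \<bullet> ?W i)) / n
        + (\<Sum>i<n. (c \<bullet> ?D i) * (?b \<bullet> ?D i + r' * h i - \<rho> * (?a \<bullet> ?W i))) / n
        + q * ((\<Sum>i<n. h i * (?b \<bullet> ?D i + r' * h i)) / n + (\<Sum>i<n. ?e i * (?a \<bullet> ?W i)) / n)"
      unfolding W_eq D_eq v_eq[symmetric] by (simp add: add_divide_distrib distrib_left)
    finally show ?thesis
      unfolding sample_moment_def \<kappa>r'
      by (simp only: inner_diff_left inner_add_left inner_scaleR_left inner_\<xi> h_\<xi>[unfolded inner_diff_left inner_\<xi>])
  qed
  ultimately show thesis by (rule that)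
qed

end

section \<open>Asymptotic covariances\<close>

context endogenous_regression
begin

abbreviation deviation :: "nat \<Rightarrow> 'w \<Rightarrow> real" where
  "deviation \<equiv> moment_deviation M \<xi>"

lemma En_E: "\<bar>En n \<omega> x y - E x y\<bar> \<le> deviation n \<omega> * norm x * norm y"
  by (rule moment_deviation_bound[OF iid_\<xi> sq_\<xi>])

lemmas deviation_tendsto = moment_deviation_tendsto[OF iid_\<xi> sq_\<xi>]

lemma two_stage_asymptotics:
  obtains V where
    "asymptotic_covariance M (\<lambda>n \<omega>. two_stage_coefficients n (\<lambda>i. W i \<omega>) (\<lambda>i. D i \<omega>)
      (\<lambda>i. \<beta> \<bullet> D i \<omega> + (\<rho> * v i \<omega> + \<epsilon> i \<omega>))) \<beta> V"
    "\<And>d m c. (\<And>l b. KT (l, b) (m, c) = b \<bullet> d) \<Longrightarrow> d \<bullet> V d = (\<rho>\<^sup>2 * E ev ev + E ee ee) * E (eW m) (eW m)"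
proof -
  let ?est = "\<lambda>n \<omega>. two_stage_coefficients n (\<lambda>i. W i \<omega>) (\<lambda>i. D i \<omega>)
      (\<lambda>i. \<beta> \<bullet> D i \<omega> + (\<rho> * v i \<omega> + \<epsilon> i \<omega>))"
  have approx: "\<exists>\<delta>>0. AE \<omega> in M. \<forall>n>0. \<forall>b. deviation n \<omega> \<le> \<delta> \<longrightarrow> ?est n \<omega> b \<longrightarrow>
      (\<exists>x. snd x = sqrt n *\<^sub>R (b - \<beta>) \<and>
        (\<forall>y. \<bar>KT x y - ((1 / sqrt n) *\<^sub>R (\<Sum>i<n. \<tau>T i \<omega>)) \<bullet> y\<bar> \<le> \<eta> * norm x * norm y))"
    if "\<eta> > 0" for \<eta>
  \<comment> \<open>The factor 3: the difference in the first block has at most twice the norm of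
    the unknown, and the second block adds one more.\<close>
  proof (intro exI[of _ "\<eta> / 3"] conjI AE_I2 allI impI)
    fix \<omega> n b assume n: "n > (0::nat)" and dev: "deviation n \<omega> \<le> \<eta> / 3" and est: "?est n \<omega> b"
    obtain l where l: "\<And>m c. En n \<omega> (eW m) (eW l - eD (sqrt n *\<^sub>R (b - \<beta>))) + En n \<omega> (eW l) (eD c) =
        ((1 / sqrt n) *\<^sub>R (\<Sum>i<n. \<tau>T i \<omega>)) \<bullet> (m, c)"
      using two_stage_linear_system[OF n est] by blast
    let ?b = "sqrt n *\<^sub>R (b - \<beta>)"
    show "\<exists>x. snd x = ?b \<and>
        (\<forall>y. \<bar>KT x y - ((1 / sqrt n) *\<^sub>R (\<Sum>i<n. \<tau>T i \<omega>)) \<bullet> y\<bar> \<le> \<eta> * norm x * norm y)"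
    proof (intro exI[of _ "(l, ?b)"] conjI allI)
      fix y :: "'p \<times> 'd"
      obtain m c where y: "y = (m, c)" by (cases y)
      let ?x = "(l, ?b)"
      have d0: "deviation n \<omega> \<ge> 0" by (rule moment_deviation_nonneg)
      have nx: "norm l \<le> norm ?x" "norm ?b \<le> norm ?x" and ny: "norm m \<le> norm y" "norm c \<le> norm y"
        unfolding y by (rule norm_fst_le norm_snd_le)+
      have nd: "norm (eW l - eD ?b) \<le> 2 * norm ?x"
        using norm_triangle_ineq4[of "eW l" "eD ?b"] nx unfolding embed_norm by linarith
      have "\<bar>KT ?x y - ((1 / sqrt n) *\<^sub>R (\<Sum>i<n. \<tau>T i \<omega>)) \<bullet> y\<bar> \<le>
        \<bar>En n \<omega> (eW m) (eW l - eD ?b) - E (eW m) (eW l - eD ?b)\<bar> + \<bar>En n \<omega> (eW l) (eD c) - E (eW l) (eD c)\<bar>"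
        unfolding y l[symmetric] KT_def fst_conv snd_conv by linarith
      also have "\<dots> \<le> deviation n \<omega> * norm m * norm (eW l - eD ?b) + deviation n \<omega> * norm l * norm c"
        using En_E[of n \<omega> "eW m" "eW l - eD ?b"] En_E[of n \<omega> "eW l" "eD c"] unfolding embed_norm by linarith
      also have "\<dots> \<le> deviation n \<omega> * norm y * (2 * norm ?x) + deviation n \<omega> * norm ?x * norm y"
        using d0 nx ny nd by (intro add_mono mult_mono) auto
      also have "\<dots> = (3 * deviation n \<omega>) * (norm ?x * norm y)" by (simp add: algebra_simps)
      also have "\<dots> \<le> \<eta> * (norm ?x * norm y)" using dev by (intro mult_right_mono) auto
      finally show "\<bar>KT ?x y - ((1 / sqrt n) *\<^sub>R (\<Sum>i<n. \<tau>T i \<omega>)) \<bullet> y\<bar> \<le> \<eta> * norm ?x * norm y"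
        by (simp only: mult.assoc)
    qed simp
  qed (use that in simp)
  obtain V where V: "asymptotic_covariance M ?est \<beta> V"
    "\<And>d y. (\<And>x. KT x y = snd x \<bullet> d) \<Longrightarrow> d \<bullet> V d = expectation (\<lambda>\<omega>. (y \<bullet> \<tau>T 0 \<omega>)\<^sup>2)"
    using asymptotic_covariance_linear_system[OF \<tau>T(1-3) bilinear_KT KT_nondegenerate linear_snd
      deviation_tendsto(1) moment_deviation_nonneg deviation_tendsto(2) approx] by blast
  show thesis
  proof (rule that[OF V(1)])
    fix d m c assume "\<And>l b. KT (l, b) (m, c) = b \<bullet> d"
    then have "d \<bullet> V d = expectation (\<lambda>\<omega>. ((m, c) \<bullet> \<tau>T 0 \<omega>)\<^sup>2)" by (intro V(2)) auto
    then show "d \<bullet> V d = (\<rho>\<^sup>2 * E ev ev + E ee ee) * E (eW m) (eW m)" by (simp only: \<tau>T(4))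
  qed
qed

text \<open>The residuals use the estimated first stage, so its error must be small before
  second-stage moments can be compared. As \<open>W\<close> is orthogonal to \<open>v\<close>,
  \<open>m0 * norm a\<close> is at most \<open>\<delta> * (1 + norm a)\<close>, and
  \<open>\<delta> \<le> m0 / 2\<close> absorbs the last term.\<close>

lemma first_stage_consistency:
  obtains m0 where "m0 > 0" "\<And>n \<omega> \<delta> a. deviation n \<omega> \<le> \<delta> \<Longrightarrow> \<delta> \<le> m0 / 2 \<Longrightarrow>
    (\<And>m. En n \<omega> (eW m) (ev - eW a) = 0) \<Longrightarrow> norm a \<le> 2 * \<delta> / m0"
proof -
  obtain k m0 where rep: "\<And>x y. E (eW x) (eW y) = k x \<bullet> y" and m0: "m0 > 0" "\<And>x. m0 * norm x \<le> norm (k x)"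
    using nondegenerate_bilinear_form_representation[OF bilinear_W] E_W_nondegenerate by metis
  show thesis
  proof (rule that[OF m0(1)])
    fix n \<omega> \<delta> a
    assume dev: "deviation n \<omega> \<le> \<delta>" and \<delta>: "\<delta> \<le> m0 / 2" and normal: "\<And>m. En n \<omega> (eW m) (ev - eW a) = 0"
    have d0: "deviation n \<omega> \<ge> 0" by (rule moment_deviation_nonneg)
    let ?m = "k a"
    have "(norm ?m)\<^sup>2 = E (eW a) (eW ?m)" by (simp add: rep power2_norm_eq_inner)
    also have "\<dots> = E (eW ?m) (eW a)" by (rule E_commute)
    also have "\<dots> = En n \<omega> (eW ?m) (ev - eW a) - E (eW ?m) (ev - eW a)"
      by (simp add: normal E_bilinear_simps E_W_v)
    also have "\<dots> \<le> deviation n \<omega> * norm ?m * norm (ev - eW a)"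
      using En_E[of n \<omega> "eW ?m" "ev - eW a"] unfolding embed_norm by linarith
    also have "\<dots> \<le> \<delta> * norm ?m * (1 + norm a)"
      using d0 dev norm_triangle_ineq4[of ev "eW a"] by (intro mult_mono) (auto intro: mult_nonneg_nonneg)
    finally have "norm ?m * norm ?m \<le> (\<delta> * (1 + norm a)) * norm ?m"
      by (simp add: power2_eq_square mult_ac)
    then have "norm ?m \<le> \<delta> * (1 + norm a)"
      using d0 dev by (cases "norm ?m = 0") (auto intro!: mult_nonneg_nonneg)
    with m0(2)[of a] have "m0 * norm a \<le> \<delta> + \<delta> * norm a" by (simp add: algebra_simps)
    also have "\<dots> \<le> \<delta> + m0 / 2 * norm a" using \<delta> by (intro add_left_mono mult_right_mono) auto
    finally show "norm a \<le> 2 * \<delta> / m0" using m0(1) by (simp add: field_simps)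
  qed
qed

text \<open>Replacing sample by population moments costs a multiple of \<open>\<delta>\<close>,
  replacing the residual direction \<open>ev - eW a'\<close> by \<open>ev\<close> a multiple of
  \<open>B * \<alpha>\<close>. The first multiple is 1 for the first block,
  \<open>3 + \<bar>\<rho>\<bar>\<close> for the second and 6 + 1 for the third; the second is 1 + 3
  + 1.\<close>

lemma control_function_system_perturbation:
  fixes a b r m c q a'
  defines "x \<equiv> (a, b, r)" and "y \<equiv> (m, c, q)"
  assumes dev: "deviation n \<omega> \<le> \<delta>" and a': "norm a' \<le> \<alpha>" "\<alpha> \<le> 1"
    and B: "\<And>x y. \<bar>E x y\<bar> \<le> B * norm x * norm y" "B \<ge> 0"
  shows "\<bar>KC x y - (En n \<omega> (eW m) (eW a) + En n \<omega> (eD c) (eD b + r *\<^sub>R (ev - eW a') - \<rho> *\<^sub>R eW a)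
      + q * (En n \<omega> (ev - eW a') (eD b + r *\<^sub>R (ev - eW a')) + En n \<omega> ee (eW a)) + \<kappa> * q * r)\<bar>
    \<le> ((11 + \<bar>\<rho>\<bar>) * \<delta> + 5 * B * \<alpha>) * (norm x * norm y)"
proof -
  have d0: "deviation n \<omega> \<ge> 0" by (rule moment_deviation_nonneg)
  then have \<delta>0: "\<delta> \<ge> 0" using dev by linarith
  have \<alpha>0: "\<alpha> \<ge> 0" using a' norm_ge_zero[of a'] by linarith
  have En: "\<bar>En n \<omega> z w - E z w\<bar> \<le> \<delta> * Z * U" if "norm z \<le> Z" "norm w \<le> U" for z w Z U
  proof -
    have "deviation n \<omega> * norm z * norm w \<le> \<delta> * Z * U"
      using that dev \<delta>0 order_trans[OF norm_ge_zero that(1)]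
      by (intro mult_mono mult_nonneg_nonneg norm_ge_zero) simp_all
    then show ?thesis using En_E[of n \<omega> z w] by linarith
  qed
  have EB: "\<bar>E z w\<bar> \<le> B * Z * U" if "norm z \<le> Z" "norm w \<le> U" for z w Z U
  proof -
    have "B * norm z * norm w \<le> B * Z * U"
      using that B(2) order_trans[OF norm_ge_zero that(1)]
      by (intro mult_mono mult_nonneg_nonneg norm_ge_zero) simp_all
    then show ?thesis using B(1)[of z w] by linarith
  qed
  have na: "norm a \<le> norm x" and nb: "norm b \<le> norm x" and nr: "\<bar>r\<bar> \<le> norm x"
    unfolding x_def real_norm_def[symmetric]
    by (rule norm_fst_le, rule order_trans[OF norm_fst_le norm_snd_le], rule order_trans[OF norm_snd_le norm_snd_le])
  have nm: "norm m \<le> norm y" and nc: "norm c \<le> norm y" and nq: "\<bar>q\<bar> \<le> norm y"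
    unfolding y_def real_norm_def[symmetric]
    by (rule norm_fst_le, rule order_trans[OF norm_fst_le norm_snd_le], rule order_trans[OF norm_snd_le norm_snd_le])
  define h where "h = ev - eW a'"
  define s where "s = eD b + r *\<^sub>R h"
  define p where "p = s - \<rho> *\<^sub>R eW a"
  have nh: "norm h \<le> 2"
    using norm_triangle_ineq4[of ev "eW a'"] a' by (simp add: h_def)
  have "\<bar>r\<bar> * norm h \<le> norm x * 2" using nr nh by (intro mult_mono) auto
  then have ns: "norm s \<le> 3 * norm x"
    using norm_triangle_ineq[of "eD b" "r *\<^sub>R h"] nb by (simp add: s_def)
  have "\<bar>\<rho>\<bar> * norm a \<le> \<bar>\<rho>\<bar> * norm x" using na by (intro mult_left_mono) auto
  then have np: "norm p \<le> (3 + \<bar>\<rho>\<bar>) * norm x"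
    using norm_triangle_ineq4[of s "\<rho> *\<^sub>R eW a"] ns by (simp add: p_def algebra_simps)
  have nra: "norm (r *\<^sub>R eW a') \<le> norm x * \<alpha>"
    using mult_mono[OF nr a'(1)] by simp
  have t1: "\<bar>En n \<omega> (eW m) (eW a) - E (eW m) (eW a)\<bar> \<le> \<delta> * norm y * norm x"
    using nm na by (intro En) auto
  have t2: "\<bar>En n \<omega> (eD c) p - E (eD c) p\<bar> \<le> \<delta> * norm y * ((3 + \<bar>\<rho>\<bar>) * norm x)"
    using nc np by (intro En) auto
  have t2': "\<bar>E (eD c) (r *\<^sub>R eW a')\<bar> \<le> B * norm y * (norm x * \<alpha>)"
    using nc nra by (intro EB) auto
  have t3: "\<bar>En n \<omega> h s - E h s\<bar> \<le> \<delta> * 2 * (3 * norm x)"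
    using nh ns by (intro En) auto
  have t3': "\<bar>E (eW a') s\<bar> \<le> B * \<alpha> * (3 * norm x)"
    using a' ns by (intro EB) auto
  have t3'': "\<bar>E ev (r *\<^sub>R eW a')\<bar> \<le> B * 1 * (norm x * \<alpha>)"
    using nra by (intro EB) auto
  have t4: "\<bar>En n \<omega> ee (eW a) - E ee (eW a)\<bar> \<le> \<delta> * 1 * norm x"
    using na by (intro En) auto
  \<comment> \<open>The sample term with \<open>ee\<close> has population value zero, which is why
    \<open>KC\<close> has no counterpart of it.\<close>
  have E4: "E ee (eW a) = 0" using E_commute[of ee "eW a"] E_W_\<epsilon> by simp
  let ?q = "(En n \<omega> h s - E h s) - E (eW a') s - E ev (r *\<^sub>R eW a') + (En n \<omega> ee (eW a) - E ee (eW a))"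
  have "\<bar>q * ?q\<bar> \<le> norm y * (\<delta> * 2 * (3 * norm x) + B * \<alpha> * (3 * norm x) + B * 1 * (norm x * \<alpha>) + \<delta> * 1 * norm x)"
    unfolding abs_mult using nq t3 t3' t3'' t4 by (intro mult_mono) linarith+
  moreover have "KC x y - (En n \<omega> (eW m) (eW a) + En n \<omega> (eD c) p + q * (En n \<omega> h s + En n \<omega> ee (eW a)) + \<kappa> * q * r)
    = - (En n \<omega> (eW m) (eW a) - E (eW m) (eW a)) - (En n \<omega> (eD c) p - E (eD c) p)
      + E (eD c) (r *\<^sub>R eW a') - q * ?q"
    by (simp add: KC_def x_def y_def p_def s_def h_def E_bilinear_simps E4 algebra_simps)
  ultimately have "\<bar>KC x y - (En n \<omega> (eW m) (eW a) + En n \<omega> (eD c) p + q * (En n \<omega> h s + En n \<omega> ee (eW a)) + \<kappa> * q * r)\<bar>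
    \<le> \<delta> * norm y * norm x + \<delta> * norm y * ((3 + \<bar>\<rho>\<bar>) * norm x) + B * norm y * (norm x * \<alpha>) +
      norm y * (\<delta> * 2 * (3 * norm x) + B * \<alpha> * (3 * norm x) + B * 1 * (norm x * \<alpha>) + \<delta> * 1 * norm x)"
    using t1 t2 t2' by linarith
  also have "\<dots> = ((11 + \<bar>\<rho>\<bar>) * \<delta> + 5 * B * \<alpha>) * (norm x * norm y)"
    by (simp add: algebra_simps)
  finally show ?thesis by (simp only: p_def s_def h_def)
qed

lemma control_function_asymptotics:
  obtains V where
    "asymptotic_covariance M (\<lambda>n \<omega> b. \<exists>r. control_function_coefficients n (\<lambda>i. W i \<omega>) (\<lambda>i. D i \<omega>)
      (\<lambda>i. \<alpha> \<bullet> W i \<omega> + v i \<omega>) (\<lambda>i. \<beta> \<bullet> D i \<omega> + (\<rho> * v i \<omega> + \<epsilon> i \<omega>)) b r) \<beta> V"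
    "\<And>d m c q. (\<And>a b r. KC (a, b, r) (m, c, q) = b \<bullet> d) \<Longrightarrow>
      d \<bullet> V d = E ev ev * E (eW m) (eW m) + E ee ee * E (eD c + q *\<^sub>R ev) (eD c + q *\<^sub>R ev)"
proof -
  let ?est = "\<lambda>n \<omega> b. \<exists>r. control_function_coefficients n (\<lambda>i. W i \<omega>) (\<lambda>i. D i \<omega>)
      (\<lambda>i. \<alpha> \<bullet> W i \<omega> + v i \<omega>) (\<lambda>i. \<beta> \<bullet> D i \<omega> + (\<rho> * v i \<omega> + \<epsilon> i \<omega>)) b r"
  obtain B where B: "B > 0" "\<And>x y. \<bar>E x y\<bar> \<le> B * norm x * norm y"
    using bilinear_bounded_pos[OF bilinear_E] unfolding real_norm_def by blast
  obtain m0 where m0: "m0 > 0" and first_stage: "\<And>n \<omega> \<delta> a. deviation n \<omega> \<le> \<delta> \<Longrightarrow> \<delta> \<le> m0 / 2 \<Longrightarrow>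
    (\<And>m. En n \<omega> (eW m) (ev - eW a) = 0) \<Longrightarrow> norm a \<le> 2 * \<delta> / m0"
    using first_stage_consistency by blast
  have degenerate: "AE \<omega> in M. \<kappa> \<noteq> 0 \<longrightarrow> (\<forall>i. v i \<omega> = 0)"
  proof (cases "\<kappa> = 0")
    case False
    then have "AE \<omega> in M. (ev \<bullet> \<xi> 0 \<omega>) = 0"
      using E_eq_0_iff[of ev] by (simp add: \<kappa>_def split: if_splits)
    then have "AE \<omega> in M. (ev \<bullet> \<xi> i \<omega>) = 0" for i
      by (rule iid_AE[OF iid_\<xi>]) measurable
    then show ?thesis by (simp add: AE_all_countable)
  qed simp
  have approx: "\<exists>\<delta>>0. AE \<omega> in M. \<forall>n>0. \<forall>b. deviation n \<omega> \<le> \<delta> \<longrightarrow> ?est n \<omega> b \<longrightarrow>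
      (\<exists>x. fst (snd x) = sqrt n *\<^sub>R (b - \<beta>) \<and>
        (\<forall>y. \<bar>KC x y - ((1 / sqrt n) *\<^sub>R (\<Sum>i<n. \<tau>C i \<omega>)) \<bullet> y\<bar> \<le> \<eta> * norm x * norm y))"
    if "\<eta> > 0" for \<eta>
  proof -
    \<comment> \<open>The bound \<open>2 * \<delta> / m0\<close> on the first-stage error turns the
      coefficient \<open>5 * B\<close> into \<open>10 * B / m0\<close>.\<close>
    define Q where "Q = 11 + \<bar>\<rho>\<bar> + 10 * B / m0"
    have Q: "Q > 0" using B m0 by (simp add: Q_def add_pos_pos add_nonneg_pos)
    define \<delta> where "\<delta> = min (m0 / 2) (\<eta> / Q)"
    have \<delta>: "\<delta> > 0" "\<delta> \<le> m0 / 2" "Q * \<delta> \<le> \<eta>"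
      using m0 Q \<open>\<eta> > 0\<close> by (auto simp: \<delta>_def min_def field_simps)
    show ?thesis
    proof (intro exI[of _ \<delta>] conjI \<delta>(1))
      show "AE \<omega> in M. \<forall>n>0. \<forall>b. deviation n \<omega> \<le> \<delta> \<longrightarrow> ?est n \<omega> b \<longrightarrow>
        (\<exists>x. fst (snd x) = sqrt n *\<^sub>R (b - \<beta>) \<and>
          (\<forall>y. \<bar>KC x y - ((1 / sqrt n) *\<^sub>R (\<Sum>i<n. \<tau>C i \<omega>)) \<bullet> y\<bar> \<le> \<eta> * norm x * norm y))"
        using degenerate
      proof (eventually_elim, intro allI impI)
        fix \<omega> n b assume v0: "\<kappa> \<noteq> 0 \<longrightarrow> (\<forall>i. v i \<omega> = 0)" and n: "n > (0::nat)"
          and dev: "deviation n \<omega> \<le> \<delta>" and "?est n \<omega> b"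
        then obtain r where est: "control_function_coefficients n (\<lambda>i. W i \<omega>) (\<lambda>i. D i \<omega>)
          (\<lambda>i. \<alpha> \<bullet> W i \<omega> + v i \<omega>) (\<lambda>i. \<beta> \<bullet> D i \<omega> + (\<rho> * v i \<omega> + \<epsilon> i \<omega>)) b r" by blast
        let ?b = "sqrt n *\<^sub>R (b - \<beta>)"
        obtain a' r' where normal: "\<And>m. En n \<omega> (eW m) (ev - eW a') = 0"
          and sys: "\<And>m c q. En n \<omega> (eW m) (eW (sqrt n *\<^sub>R a'))
            + En n \<omega> (eD c) (eD ?b + r' *\<^sub>R (ev - eW a') - \<rho> *\<^sub>R eW (sqrt n *\<^sub>R a'))
            + q * (En n \<omega> (ev - eW a') (eD ?b + r' *\<^sub>R (ev - eW a')) + En n \<omega> ee (eW (sqrt n *\<^sub>R a')))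
            + \<kappa> * q * r' = ((1 / sqrt n) *\<^sub>R (\<Sum>i<n. \<tau>C i \<omega>)) \<bullet> (m, c, q)"
          by (rule control_function_linear_system[OF n est v0]) (rule that, blast, blast)
        have a': "norm a' \<le> 2 * \<delta> / m0" by (rule first_stage[OF dev \<delta>(2) normal])
        have small: "2 * \<delta> / m0 \<le> 1" using \<delta>(2) m0 by (simp add: field_simps)
        let ?x = "(sqrt n *\<^sub>R a', ?b, r')"
        show "\<exists>x. fst (snd x) = ?b \<and>
          (\<forall>y. \<bar>KC x y - ((1 / sqrt n) *\<^sub>R (\<Sum>i<n. \<tau>C i \<omega>)) \<bullet> y\<bar> \<le> \<eta> * norm x * norm y)"
        proof (intro exI[of _ ?x] conjI allI)
          fix y :: "'p \<times> 'd \<times> real"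
          obtain m c q where y: "y = (m, c, q)" by (cases y)
          have "\<bar>KC ?x y - ((1 / sqrt n) *\<^sub>R (\<Sum>i<n. \<tau>C i \<omega>)) \<bullet> y\<bar> \<le>
              ((11 + \<bar>\<rho>\<bar>) * \<delta> + 5 * B * (2 * \<delta> / m0)) * (norm ?x * norm y)"
            unfolding y sys[symmetric]
            by (rule control_function_system_perturbation[OF dev a' small B(2)]) (use B in simp)
          also have "(11 + \<bar>\<rho>\<bar>) * \<delta> + 5 * B * (2 * \<delta> / m0) = Q * \<delta>"
            by (simp add: Q_def algebra_simps)
          also have "Q * \<delta> * (norm ?x * norm y) \<le> \<eta> * (norm ?x * norm y)"
            using \<delta>(3) by (intro mult_right_mono) auto
          finally show "\<bar>KC ?x y - ((1 / sqrt n) *\<^sub>R (\<Sum>i<n. \<tau>C i \<omega>)) \<bullet> y\<bar> \<le> \<eta> * norm ?x * norm y"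
            by (simp only: mult.assoc)
        qed simp
      qed
    qed
  qed
  have lin: "linear (\<lambda>x :: 'p \<times> 'd \<times> real. fst (snd x))"
    by (rule linearI) simp_all
  obtain V where V: "asymptotic_covariance M ?est \<beta> V"
    "\<And>d y. (\<And>x. KC x y = fst (snd x) \<bullet> d) \<Longrightarrow> d \<bullet> V d = expectation (\<lambda>\<omega>. (y \<bullet> \<tau>C 0 \<omega>)\<^sup>2)"
    using asymptotic_covariance_linear_system[OF \<tau>C(1-3) bilinear_KC KC_nondegenerate lin
      deviation_tendsto(1) moment_deviation_nonneg deviation_tendsto(2) approx] by blast
  show thesis
  proof (rule that[OF V(1)])
    fix d m c q assume "\<And>a b r. KC (a, b, r) (m, c, q) = b \<bullet> d"
    then have "d \<bullet> V d = expectation (\<lambda>\<omega>. ((m, c, q) \<bullet> \<tau>C 0 \<omega>)\<^sup>2)" by (intro V(2)) auto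
    then show "d \<bullet> V d = E ev ev * E (eW m) (eW m) + E ee ee * E (eD c + q *\<^sub>R ev) (eD c + q *\<^sub>R ev)"
      by (simp only: \<tau>C(4))
  qed
qed

end

section \<open>Comparison of the two estimators\<close>

context endogenous_regression
begin

lemma KT_solution:
  assumes "\<And>l b. KT (l, b) (m, c) = b \<bullet> d"
  shows "E (eW m) (eD b) = - (b \<bullet> d)"
  using assms[of 0 b] by (simp add: KT_def embed_simps E_bilinear_simps)

text \<open>In the adjoint solution \<open>m \<bullet> W\<close> is \<open>\<rho>\<close> times the
  projection of \<open>c \<bullet> D\<close>, equivalently of \<open>h\<close>, on the span of
  \<open>W\<close>, because \<open>v\<close> is orthogonal to \<open>W\<close>. Projections do not
  increase second moments, which bounds the contribution of the first stage.\<close>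

lemma KC_solution:
  assumes sol: "\<And>a b r. KC (a, b, r) (m, c, q) = b \<bullet> d"
  defines "h \<equiv> eD c + q *\<^sub>R ev"
  shows "E h (eD b) = b \<bullet> d" "E h ev = 0" "E h h = c \<bullet> d" "E (eW m) (eW m) \<le> \<rho>\<^sup>2 * E h h"
proof -
  have m: "E (eW m) (eW a) = \<rho> * E (eD c) (eW a)" for a
    using sol[of a 0 0] by (simp add: KC_def embed_simps E_bilinear_simps)
  show b: "E h (eD b) = b \<bullet> d" for b
    using sol[of 0 b 0] by (simp add: KC_def h_def embed_simps E_bilinear_simps)
  have r: "E (eD c) ev + q * (E ev ev + \<kappa>) = 0"
    using sol[of 0 0 1] by (simp add: KC_def embed_simps E_bilinear_simps algebra_simps)
  \<comment> \<open>If \<open>\<kappa> \<noteq> 0\<close>, then \<open>v\<close> is null, its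
    moments vanish and the equation \<open>r\<close> reduces to this one.\<close>
  have "q * \<kappa> = 0"
  proof (cases "\<kappa> = 0")
    case False
    then have "E ev ev = 0" by (simp add: \<kappa>_def split: if_splits)
    then show ?thesis using r E_null_right[of ev "eD c"] by simp
  qed simp
  then show hv: "E h ev = 0"
    using r by (simp only: h_def E_bilinear_simps distrib_left add_0_right) simp
  have "E h h = E h (eD c) + q * E h ev"
    by (subst (2) h_def) (simp add: E_bilinear_simps)
  then show "E h h = c \<bullet> d" by (simp add: b hv)
  have "E (eW m) (eW m) = \<rho> * E h (eW m)"
    using m[of m] E_commute[of ev "eW m"] by (simp add: h_def E_bilinear_simps E_W_v)
  then have "(E (eW m) (eW m))\<^sup>2 = \<rho>\<^sup>2 * (E h (eW m))\<^sup>2" by (simp add: power_mult_distrib)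
  also have "\<dots> \<le> \<rho>\<^sup>2 * (E h h * E (eW m) (eW m))"
    by (intro mult_left_mono E_Cauchy_Schwarz) simp
  finally have "E (eW m) (eW m) * E (eW m) (eW m) \<le> (\<rho>\<^sup>2 * E h h) * E (eW m) (eW m)"
    by (simp add: power2_eq_square mult_ac)
  then show "E (eW m) (eW m) \<le> \<rho>\<^sup>2 * E h h"
    using E_nonneg[of "eW m"] E_nonneg[of h]
    by (cases "E (eW m) (eW m) = 0") auto
qed

lemma asymptotic_variance_comparison:
  assumes T: "\<And>l b. KT (l, b) (m, c') = b \<bullet> d" and C: "\<And>a b r. KC (a, b, r) (m', c, q) = b \<bullet> d"
  defines "vT \<equiv> (\<rho>\<^sup>2 * E ev ev + E ee ee) * E (eW m) (eW m)"
    and "vC \<equiv> E ev ev * E (eW m') (eW m') + E ee ee * E (eD c + q *\<^sub>R ev) (eD c + q *\<^sub>R ev)"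
  shows "vC \<le> vT"
    "vC = vT \<Longrightarrow> \<rho>\<^sup>2 * E ev ev + E ee ee > 0 \<Longrightarrow> AE \<omega> in M. c \<bullet> D 0 \<omega> = (- m) \<bullet> W 0 \<omega> + (- q) * v 0 \<omega>"
proof -
  let ?h = "eD c + q *\<^sub>R ev" and ?p = "eW m" and ?w = "\<rho>\<^sup>2 * E ev ev + E ee ee"
  note h = KC_solution[OF C]
  \<comment> \<open>The \<open>W\<close>-combination is orthogonal to \<open>v\<close>, so only the
    \<open>D\<close> part of \<open>h\<close> counts, and there the two representations of
    \<open>d\<close> have opposite signs.\<close>
  have ph: "E ?p ?h = - E ?h ?h"
  proof -
    have "E ?p ?h = E ?p (eD c)" by (simp add: E_bilinear_simps E_W_v)
    also have "\<dots> = - E ?h ?h" unfolding h(3) by (rule KT_solution[OF T])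
    finally show ?thesis .
  qed
  have sum: "E (?p + ?h) (?p + ?h) = E ?p ?p - E ?h ?h"
  proof -
    have "E (?p + ?h) (?p + ?h) = E ?p ?p + E ?p ?h + E ?h ?p + E ?h ?h"
      unfolding bilinear_ladd[OF bilinear_E] bilinear_radd[OF bilinear_E, of _ ?p ?h] by simp
    then show ?thesis using E_commute[of ?h ?p] ph by simp
  qed
  have hp: "E ?h ?h \<le> E ?p ?p" using E_nonneg[of "?p + ?h"] sum by simp
  have w: "?w \<ge> 0" using E_nonneg[of ev] E_nonneg[of ee] by simp
  have "E ev ev * E (eW m') (eW m') \<le> E ev ev * (\<rho>\<^sup>2 * E ?h ?h)"
    using h(4) E_nonneg[of ev] by (rule mult_left_mono)
  then have vC: "vC \<le> ?w * E ?h ?h" by (simp add: vC_def algebra_simps)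
  also have "\<dots> \<le> vT" unfolding vT_def using hp w by (rule mult_left_mono)
  finally show "vC \<le> vT" .
  assume "vC = vT" and pos: "?w > 0"
  with vC have "?w * E ?p ?p \<le> ?w * E ?h ?h" by (simp add: vT_def)
  with pos have "E ?p ?p \<le> E ?h ?h" by simp
  with hp sum have "E (?p + ?h) (?p + ?h) = 0" by simp
  then show "AE \<omega> in M. c \<bullet> D 0 \<omega> = (- m) \<bullet> W 0 \<omega> + (- q) * v 0 \<omega>"
    unfolding E_eq_0_iff by (rule AE_mp) (simp add: inner_add_left algebra_simps)
qed

text \<open>For strictness the coefficient vector \<open>c\<close> is prescribed and
  \<open>d\<close> is read off. The blocks are solved separately: \<open>q\<close> settles the
  equation of the residual, \<open>m\<close> is a Riesz representation on \<open>W\<close>, and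
  \<open>d\<close> represents what remains as a functional of \<open>b\<close>.\<close>

lemma KC_solvable_for_coefficient:
  "\<exists>d m q. \<forall>a b r. KC (a, b, r) (m, c, q) = b \<bullet> d"
proof -
  define q where "q = - E (eD c) ev / (E ev ev + \<kappa>)"
  have q: "E (eD c) ev + q * (E ev ev + \<kappa>) = 0" using var_v_pos by (simp add: q_def)
  have "linear (\<lambda>a. \<rho> * E (eD c) (eW a))"
    by (rule linearI) (simp_all add: embed_simps E_bilinear_simps algebra_simps)
  moreover have "x = 0" if "\<And>y. E (eW x) (eW y) = 0" for x
    using that[of x] by (rule E_W_nondegenerate)
  ultimately obtain m where m: "\<And>a. E (eW a) (eW m) = \<rho> * E (eD c) (eW a)"
    using nondegenerate_bilinear_form_riesz[OF bilinear_W] by blast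
  define \<phi> where "\<phi> b = E (eD c + q *\<^sub>R ev) (eD b)" for b
  have "linear \<phi>" unfolding \<phi>_def by (rule linearI) (simp_all add: embed_simps E_bilinear_simps)
  then have d: "b \<bullet> adjoint \<phi> 1 = \<phi> b" for b using adjoint_works[of \<phi> b 1] by simp
  have "KC (a, b, r) (m, c, q) = b \<bullet> adjoint \<phi> 1" for a b r
  proof -
    have "KC (a, b, r) (m, c, q) = (E (eW a) (eW m) - \<rho> * E (eD c) (eW a)) + \<phi> b
        + r * (E (eD c) ev + q * (E ev ev + \<kappa>))"
      using E_commute[of "eW m" "eW a"] by (simp add: KC_def \<phi>_def E_bilinear_simps algebra_simps)
    then show ?thesis by (simp add: m q d)
  qed
  then show ?thesis by blast
qed

lemma control_function_at_least_as_efficient: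
  obtains V_TS V_CF where
    "asymptotic_covariance M (\<lambda>n \<omega>. two_stage_coefficients n (\<lambda>i. W i \<omega>) (\<lambda>i. D i \<omega>)
      (\<lambda>i. \<beta> \<bullet> D i \<omega> + (\<rho> * v i \<omega> + \<epsilon> i \<omega>))) \<beta> V_TS"
    "asymptotic_covariance M (\<lambda>n \<omega> b. \<exists>r. control_function_coefficients n (\<lambda>i. W i \<omega>) (\<lambda>i. D i \<omega>)
      (\<lambda>i. \<alpha> \<bullet> W i \<omega> + v i \<omega>) (\<lambda>i. \<beta> \<bullet> D i \<omega> + (\<rho> * v i \<omega> + \<epsilon> i \<omega>)) b r) \<beta> V_CF"
    "\<And>d. d \<bullet> V_CF d \<le> d \<bullet> V_TS d"
    "\<And>c. V_CF = V_TS \<Longrightarrow> expectation (\<lambda>\<omega>. (\<rho> * v 0 \<omega> + \<epsilon> 0 \<omega>)\<^sup>2) > 0 \<Longrightarrow>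
      \<exists>m q. AE \<omega> in M. c \<bullet> D 0 \<omega> = m \<bullet> W 0 \<omega> + q * v 0 \<omega>"
proof -
  obtain V_TS where T: "asymptotic_covariance M (\<lambda>n \<omega>. two_stage_coefficients n (\<lambda>i. W i \<omega>) (\<lambda>i. D i \<omega>)
      (\<lambda>i. \<beta> \<bullet> D i \<omega> + (\<rho> * v i \<omega> + \<epsilon> i \<omega>))) \<beta> V_TS"
    "\<And>d m c. (\<And>l b. KT (l, b) (m, c) = b \<bullet> d) \<Longrightarrow> d \<bullet> V_TS d = (\<rho>\<^sup>2 * E ev ev + E ee ee) * E (eW m) (eW m)"
    using two_stage_asymptotics by blast
  obtain V_CF where C: "asymptotic_covariance M (\<lambda>n \<omega> b. \<exists>r. control_function_coefficients n (\<lambda>i. W i \<omega>) (\<lambda>i. D i \<omega>)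
      (\<lambda>i. \<alpha> \<bullet> W i \<omega> + v i \<omega>) (\<lambda>i. \<beta> \<bullet> D i \<omega> + (\<rho> * v i \<omega> + \<epsilon> i \<omega>)) b r) \<beta> V_CF"
    "\<And>d m c q. (\<And>a b r. KC (a, b, r) (m, c, q) = b \<bullet> d) \<Longrightarrow>
      d \<bullet> V_CF d = E ev ev * E (eW m) (eW m) + E ee ee * E (eD c + q *\<^sub>R ev) (eD c + q *\<^sub>R ev)"
    using control_function_asymptotics by blast
  have T_sol: "\<exists>m c. \<forall>l b. KT (l, b) (m, c) = b \<bullet> d" for d
  proof -
    have "linear (\<lambda>x :: 'p \<times> 'd. snd x \<bullet> d)" by (rule linearI) (simp_all add: inner_add_left)
    from nondegenerate_bilinear_form_riesz[OF bilinear_KT KT_nondegenerate this]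
    obtain y where y: "\<And>x. KT x y = snd x \<bullet> d" by blast
    obtain m c where mc: "y = (m, c)" by (cases y)
    have "KT (l, b) (m, c) = b \<bullet> d" for l b using y[of "(l, b)"] by (simp add: mc)
    then show ?thesis by blast
  qed
  have C_sol: "\<exists>m c q. \<forall>a b r. KC (a, b, r) (m, c, q) = b \<bullet> d" for d
  proof -
    have "linear (\<lambda>x :: 'p \<times> 'd \<times> real. fst (snd x) \<bullet> d)" by (rule linearI) (simp_all add: inner_add_left)
    from nondegenerate_bilinear_form_riesz[OF bilinear_KC KC_nondegenerate this]
    obtain y where y: "\<And>x. KC x y = fst (snd x) \<bullet> d" by blast
    obtain m c q where mcq: "y = (m, c, q)" by (cases y)
    have "KC (a, b, r) (m, c, q) = b \<bullet> d" for a b r using y[of "(a, b, r)"] by (simp add: mcq)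
    then show ?thesis by blast
  qed
  show thesis
  proof (rule that[OF T(1) C(1)])
    fix d
    obtain m c' where KT: "\<And>l b. KT (l, b) (m, c') = b \<bullet> d" using T_sol by blast
    obtain m' c q where KC: "\<And>a b r. KC (a, b, r) (m', c, q) = b \<bullet> d" using C_sol by blast
    show "d \<bullet> V_CF d \<le> d \<bullet> V_TS d"
      unfolding T(2)[OF KT] C(2)[OF KC] by (rule asymptotic_variance_comparison(1)[OF KT KC])
  next
    fix c
    assume eq: "V_CF = V_TS" and pos: "expectation (\<lambda>\<omega>. (\<rho> * v 0 \<omega> + \<epsilon> 0 \<omega>)\<^sup>2) > 0"
    have "expectation (\<lambda>\<omega>. (\<rho> * v 0 \<omega> + \<epsilon> 0 \<omega>)\<^sup>2) = E (\<rho> *\<^sub>R ev + ee) (\<rho> *\<^sub>R ev + ee)"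
      using second_moment[of "\<rho> *\<^sub>R ev + ee"] by (simp add: inner_add_left)
    also have "\<dots> = \<rho>\<^sup>2 * E ev ev + E ee ee"
      using E_commute[of ee ev] by (simp add: E_bilinear_simps E_v_\<epsilon> power2_eq_square algebra_simps)
    finally have pos': "\<rho>\<^sup>2 * E ev ev + E ee ee > 0" using pos by (simp only:)
    obtain d m' q where KC: "\<And>a b r. KC (a, b, r) (m', c, q) = b \<bullet> d"
      using KC_solvable_for_coefficient[of c] by blast
    obtain m c' where KT: "\<And>l b. KT (l, b) (m, c') = b \<bullet> d" using T_sol by blast
    have "d \<bullet> V_CF d = d \<bullet> V_TS d" by (simp only: eq)
    from asymptotic_variance_comparison(2)[OF KT KC this[unfolded T(2)[OF KT] C(2)[OF KC]] pos']
    show "\<exists>m q. AE \<omega> in M. c \<bullet> D 0 \<omega> = m \<bullet> W 0 \<omega> + q * v 0 \<omega>" by blast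
  qed
qed

end

section \<open>The instrumental variable model\<close>

text \<open>Antitone in the relation: every measurable selection from \<open>est\<close> is also one
  from \<open>est'\<close>.\<close>

lemma asymptotic_covariance_mono:
  assumes "asymptotic_covariance M est' \<beta> V"
    and "\<And>n \<omega> b. \<omega> \<in> space M \<Longrightarrow> est n \<omega> b \<Longrightarrow> est' n \<omega> b"
  shows "asymptotic_covariance M est \<beta> V"
  unfolding asymptotic_covariance_def
proof (intro allI impI)
  fix b assume b: "\<forall>n. b n \<in> borel_measurable M \<and> (AE \<omega> in M. est n \<omega> (b n \<omega>))"
  have "AE \<omega> in M. est' n \<omega> (b n \<omega>)" for n
  proof (rule AE_mp[OF conjunct2[OF spec[OF b]]])
    show "AE \<omega> in M. est n \<omega> (b n \<omega>) \<longrightarrow> est' n \<omega> (b n \<omega>)"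
      using assms(2) by (intro AE_I2) blast
  qed
  with b show "converges_to_gaussian M (\<lambda>n \<omega>. sqrt (real n) *\<^sub>R (b n \<omega> - \<beta>)) V"
    using assms(1) unfolding asymptotic_covariance_def by blast
qed

text \<open>Each \<open>g j\<close> is linear in the covariates and so is reproduced exactly by the
  first stage. Hence fitting only the \<open>f j\<close> already replaces every combination of
  second-stage regressors by its first-stage fit.\<close>

lemma two_stage_estimate_imp_coefficients:
  fixes f :: "'k1::finite \<Rightarrow> real \<Rightarrow> real" and g :: "'k2::finite \<Rightarrow> real^'n2 \<Rightarrow> real"
    and z :: "nat \<Rightarrow> real^'n1"
  assumes g: "\<And>j. linear_function (g j)" and est: "two_stage_estimate f g n z c x y b"
  shows "two_stage_coefficients n (\<lambda>i. (1::real, z i, c i))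
    (\<lambda>i. (1::real, \<chi> j. f j (x i), \<chi> j. g j (c i))) y b"
proof -
  let ?W = "\<lambda>i. (1::real, z i, c i)" and ?D = "\<lambda>i. (1::real, \<chi> j. f j (x i), \<chi> j. g j (c i))"
  obtain a where a: "\<And>j. least_squares n ?W (\<lambda>i. f j (x i)) (a j)"
    and second: "least_squares n (\<lambda>i. (1::real, \<chi> j. a j \<bullet> ?W i, \<chi> j. g j (c i))) y b"
    using est unfolding two_stage_estimate_def by blast
  obtain g0 g1 where g_eq: "\<And>j t. g j t = g0 j + g1 j \<bullet> t"
    using g unfolding linear_function_def by metis
  have "\<exists>a'. least_squares n ?W (\<lambda>i. d \<bullet> ?D i) a' \<and>
      (\<forall>i<n. d \<bullet> (1::real, \<chi> j. a j \<bullet> ?W i, \<chi> j. g j (c i)) = a' \<bullet> ?W i)" for d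
  proof -
    obtain d0 d1 d2 where d: "d = (d0, d1, d2)" by (cases d)
    define A where "A = (d0, 0, 0) + (\<Sum>j\<in>UNIV. (d1 $ j) *\<^sub>R a j) + (\<Sum>j\<in>UNIV. (d2 $ j) *\<^sub>R (g0 j, 0, g1 j))"
    have w_g: "(g0 j, 0, g1 j) \<bullet> ?W i = g j (c i)" for i j by (simp add: g_eq)
    have A: "A \<bullet> ?W i = d0 + (\<Sum>j\<in>UNIV. d1 $ j * (a j \<bullet> ?W i)) + (\<Sum>j\<in>UNIV. d2 $ j * g j (c i))" for i
      unfolding A_def inner_add_left inner_sum_left inner_scaleR_left w_g by simp
    have diff: "d \<bullet> ?D i - A \<bullet> ?W i = (\<Sum>j\<in>UNIV. d1 $ j * (f j (x i) - a j \<bullet> ?W i))" for i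
      unfolding A by (simp only: d inner_Pair inner_vec_def)
        (simp add: right_diff_distrib sum_subtractf del: inner_Pair)
    have "(\<Sum>i<n. (m \<bullet> ?W i) * (d \<bullet> ?D i - A \<bullet> ?W i)) = 0" for m
    proof -
      have "(\<Sum>i<n. (m \<bullet> ?W i) * (d \<bullet> ?D i - A \<bullet> ?W i)) =
          (\<Sum>i<n. \<Sum>j\<in>UNIV. d1 $ j * ((m \<bullet> ?W i) * (f j (x i) - a j \<bullet> ?W i)))"
        unfolding diff by (simp only: sum_distrib_left mult.left_commute)
      also have "\<dots> = (\<Sum>j\<in>UNIV. d1 $ j * (\<Sum>i<n. (m \<bullet> ?W i) * (f j (x i) - a j \<bullet> ?W i)))"
        unfolding sum_distrib_left by (rule sum.swap)
      also have "\<dots> = 0"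
      proof -
        have "(\<Sum>i<n. (m \<bullet> ?W i) * (f j (x i) - a j \<bullet> ?W i)) = 0" for j
          using a[of j] unfolding least_squares_iff_normal_equations by blast
        then show ?thesis by (simp only: mult_zero_right sum.neutral_const)
      qed
      finally show ?thesis .
    qed
    then have "least_squares n ?W (\<lambda>i. d \<bullet> ?D i) A"
      unfolding least_squares_iff_normal_equations by blast
    moreover have "d \<bullet> (1::real, \<chi> j. a j \<bullet> ?W i, \<chi> j. g j (c i)) = A \<bullet> ?W i" for i
      unfolding A by (simp only: d inner_Pair inner_vec_def) (simp del: inner_Pair)
    ultimately show ?thesis by blast
  qed
  with second show ?thesis
    unfolding two_stage_coefficients_def
    by (intro exI[of _ "\<lambda>i. (1::real, \<chi> j. a j \<bullet> ?W i, \<chi> j. g j (c i))"] conjI allI)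
qed

lemma control_function_estimate_eq_coefficients:
  "control_function_estimate f g n z c x y b r \<longleftrightarrow>
    control_function_coefficients n (\<lambda>i. (1::real, z i, c i))
      (\<lambda>i. (1::real, \<chi> j. f j (x i), \<chi> j. g j (c i))) x y b r"
  by (simp add: control_function_estimate_def control_function_coefficients_def)

lemma borel_measurable_vec_lambda:
  fixes F :: "'k::finite \<Rightarrow> 'a \<Rightarrow> real"
  assumes "\<And>j. F j \<in> borel_measurable M"
  shows "(\<lambda>x. \<chi> j. F j x) \<in> borel_measurable M"
  using assms
  by (subst borel_measurable_euclidean_space) (auto simp: Basis_vec_def inner_axis)

lemma integrable_norm_sq_vec_lambda:
  fixes F :: "'k::finite \<Rightarrow> 'a \<Rightarrow> real"
  assumes "\<And>j. integrable M (\<lambda>x. (F j x)\<^sup>2)"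
  shows "integrable M (\<lambda>x. (norm (\<chi> j. F j x))\<^sup>2)"
proof -
  have "(norm (\<chi> j. F j x))\<^sup>2 = (\<Sum>j\<in>UNIV. (F j x)\<^sup>2)" for x
    by (simp add: power2_norm_eq_inner inner_vec_def) (simp add: power2_eq_square)
  then show ?thesis using assms by simp
qed

context prob_space
begin

lemma AE_constI: "(AE x in M. P) \<Longrightarrow> P"
  by (simp add: AE_const)

text \<open>Shifts of a law dominating Lebesgue measure see every point of the line, so a function of
  \<open>m W + \<delta>\<close> that depends on \<open>W\<close> only is constant.\<close>

lemma constant_if_determined_by_shift:
  fixes W :: "'a \<Rightarrow> 'b::second_countable_topology" and \<delta> :: "'a \<Rightarrow> real"
  assumes indep: "indep_rv M W \<delta>" and ac: "absolutely_continuous (distr M lborel \<delta>) lborel"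
    and [measurable]: "\<phi> \<in> borel_measurable borel" "m \<in> borel_measurable borel" "l \<in> borel_measurable borel"
    and eq: "AE \<omega> in M. \<phi> (m (W \<omega>) + \<delta> \<omega>) = (l (W \<omega>) :: real)"
  shows "\<exists>\<kappa>. AE \<omega> in M. \<phi> (m (W \<omega>) + \<delta> \<omega>) = \<kappa>"
proof -
  note [measurable] = indep_rvD(1,2)[OF indep]
  let ?P = "distr M borel W" and ?Q = "distr M borel \<delta>"
  interpret P: prob_space ?P by (rule prob_space_distr) simp
  interpret Q: prob_space ?Q by (rule prob_space_distr) simp
  interpret PQ: pair_prob_space ?P ?Q ..
  have "AE p in distr M borel (\<lambda>\<omega>. (W \<omega>, \<delta> \<omega>)). \<phi> (m (fst p) + snd p) = l (fst p)"
    using eq by (subst AE_distr_iff) (auto simp: borel_prod[symmetric])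
  then have "AE p in ?P \<Otimes>\<^sub>M ?Q. \<phi> (m (fst p) + snd p) = l (fst p)"
    unfolding indep_rvD(3)[OF indep] .
  then have "AE w in ?P. AE d in ?Q. \<phi> (m w + d) = l w"
    using PQ.AE_pair by fastforce
  moreover have "AE x in lborel. \<phi> x = l w" if "AE d in ?Q. \<phi> (m w + d) = l w" for w
  proof -
    have "AE \<omega> in M. \<phi> (m w + \<delta> \<omega>) = l w"
      using that by (subst (asm) AE_distr_iff) auto
    then have "AE d in distr M lborel \<delta>. \<phi> (m w + d) = l w"
      by (subst AE_distr_iff) auto
    then have "AE d in lborel. \<phi> (m w + d) = l w"
      by (rule absolutely_continuous_AE[OF _ ac, rotated]) simp
    then have "AE x in distr lborel borel ((+) (m w)). \<phi> x = l w"
      by (subst AE_distr_iff) auto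
    \<comment> \<open>Translation invariance of Lebesgue measure removes the shift
      \<open>m w\<close>, so the exceptional point set no longer involves it.\<close>
    then show ?thesis unfolding lborel_distr_plus .
  qed
  ultimately have *: "AE w in ?P. AE x in lborel. \<phi> x = l w" by auto
  have "\<exists>w0. AE x in lborel. \<phi> x = l w0"
  proof (rule ccontr)
    assume none: "\<not> (\<exists>w0. AE x in lborel. \<phi> x = l w0)"
    from * have "AE w in ?P. False" by (rule AE_mp) (use none in auto)
    then show False by (rule P.AE_constI)
  qed
  then obtain w0 where w0: "AE x in lborel. \<phi> x = l w0" ..
  have "AE w in ?P. l w = l w0"
    using *
  proof eventually_elim
    case (elim w)
    \<comment> \<open>Both constants agree almost everywhere with \<open>\<phi>\<close>, and
      Lebesgue measure is not zero.\<close>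
    with w0 have "AE x in (lborel :: real measure). l w = l w0" by eventually_elim simp
    then show ?case by (auto simp: eventually_const_iff ae_filter_eq_bot_iff)
  qed
  then have "AE \<omega> in M. l (W \<omega>) = l w0" by (subst (asm) AE_distr_iff) auto
  with eq have "AE \<omega> in M. \<phi> (m (W \<omega>) + \<delta> \<omega>) = l w0" by eventually_elim simp
  then show ?thesis by blast
qed

text \<open>Fubini's theorem: for almost every fixed \<open>z\<close> the relation is one between
  the constant and the covariates, which gives \<open>a2 = 0\<close> and leaves a relation between
  the constant and the instruments.\<close>

lemma linearly_independent_rv_indep_pair:
  fixes Z :: "'a \<Rightarrow> 'b::euclidean_space" and C :: "'a \<Rightarrow> 'c::euclidean_space"
  assumes indep: "indep_rv M Z C"
    and Z: "linearly_independent_rv M (\<lambda>\<omega>. (1::real, Z \<omega>))"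
    and C: "linearly_independent_rv M (\<lambda>\<omega>. (1::real, C \<omega>))"
  shows "linearly_independent_rv M (\<lambda>\<omega>. (1::real, Z \<omega>, C \<omega>))"
  unfolding linearly_independent_rv_def
proof (intro allI impI)
  note [measurable] = indep_rvD(1,2)[OF indep]
  fix a :: "real \<times> 'b \<times> 'c" assume ae: "AE \<omega> in M. a \<bullet> (1, Z \<omega>, C \<omega>) = 0"
  obtain a0 a1 a2 where a: "a = (a0, a1, a2)" by (cases a)
  let ?P = "distr M borel Z" and ?Q = "distr M borel C"
  interpret P: prob_space ?P by (rule prob_space_distr) simp
  interpret Q: prob_space ?Q by (rule prob_space_distr) simp
  interpret PQ: pair_prob_space ?P ?Q ..
  have "AE p in distr M borel (\<lambda>\<omega>. (Z \<omega>, C \<omega>)). a0 + a1 \<bullet> fst p + a2 \<bullet> snd p = 0"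
    using ae by (subst AE_distr_iff) (auto simp: borel_prod[symmetric] a add.assoc)
  then have "AE p in ?P \<Otimes>\<^sub>M ?Q. a0 + a1 \<bullet> fst p + a2 \<bullet> snd p = 0"
    unfolding indep_rvD(3)[OF indep] .
  then have ae2: "AE z in ?P. AE c in ?Q. a0 + a1 \<bullet> z + a2 \<bullet> c = 0"
    using PQ.AE_pair by fastforce
  have coeff: "(a0 + a1 \<bullet> z, a2) = 0" if "AE c in ?Q. a0 + a1 \<bullet> z + a2 \<bullet> c = 0" for z
  proof -
    have "AE \<omega> in M. (a0 + a1 \<bullet> z, a2) \<bullet> (1, C \<omega>) = 0"
      using that by (subst (asm) AE_distr_iff) auto
    then show ?thesis using C unfolding linearly_independent_rv_def by blast
  qed
  have *: "AE z in ?P. a0 + a1 \<bullet> z = 0 \<and> a2 = 0"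
    using ae2 by eventually_elim (use coeff in \<open>auto simp: zero_prod_def\<close>)
  then have "AE z in ?P. a2 = 0" by auto
  then have a2: "a2 = 0" by (rule P.AE_constI)
  have "AE \<omega> in M. (a0, a1) \<bullet> (1, Z \<omega>) = 0"
    using * by (subst (asm) AE_distr_iff) auto
  then have "(a0, a1) = 0" using Z unfolding linearly_independent_rv_def by blast
  with a2 show "a = 0" by (simp add: a zero_prod_def)
qed

end

theorem theorem5:
  fixes M :: "'w measure"
    and Z :: "nat \<Rightarrow> 'w \<Rightarrow> real^'n1" and C :: "nat \<Rightarrow> 'w \<Rightarrow> real^'n2"
    and U \<epsilon>X \<epsilon>Y \<delta>1 \<delta>2 X Y e :: "nat \<Rightarrow> 'w \<Rightarrow> real"
    and f :: "'k1::finite \<Rightarrow> real \<Rightarrow> real" and g :: "'k2::finite \<Rightarrow> real^'n2 \<Rightarrow> real"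
    and h :: "real \<Rightarrow> real"
    and \<beta>X0 \<beta>Y0 \<beta>U \<rho> :: real and \<beta>Z :: "real^'n1" and \<beta>C :: "real^'n2"
    and \<theta> :: "real^'k1" and \<gamma> :: "real^'k2"
  assumes prob: "prob_space M"
    and sample_indep: "prob_space.indep_vars M (\<lambda>_. borel)
          (\<lambda>i \<omega>. (Z i \<omega>, C i \<omega>, U i \<omega>, \<epsilon>X i \<omega>, \<epsilon>Y i \<omega>)) UNIV"
    and sample_ident: "\<And>i. distr M borel (\<lambda>\<omega>. (Z i \<omega>, C i \<omega>, U i \<omega>, \<epsilon>X i \<omega>, \<epsilon>Y i \<omega>)) =
          distr M borel (\<lambda>\<omega>. (Z 0 \<omega>, C 0 \<omega>, U 0 \<omega>, \<epsilon>X 0 \<omega>, \<epsilon>Y 0 \<omega>))"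
    and mutual_indep: "distr M borel (\<lambda>\<omega>. (Z 0 \<omega>, C 0 \<omega>, U 0 \<omega>, \<epsilon>X 0 \<omega>, \<epsilon>Y 0 \<omega>)) =
          distr M borel (Z 0) \<Otimes>\<^sub>M (distr M borel (C 0) \<Otimes>\<^sub>M (distr M borel (U 0) \<Otimes>\<^sub>M
            (distr M borel (\<epsilon>X 0) \<Otimes>\<^sub>M distr M borel (\<epsilon>Y 0))))"
    and measurable: "\<And>j. f j \<in> borel_measurable borel" "\<And>j. g j \<in> borel_measurable borel"
          "h \<in> borel_measurable borel"
    and error_mean: "integrable M (\<epsilon>X 0)" "prob_space.expectation M (\<epsilon>X 0) = 0"
          "integrable M (\<epsilon>Y 0)" "prob_space.expectation M (\<epsilon>Y 0) = 0"
    and \<delta>1: "\<And>i \<omega>. \<delta>1 i \<omega> = \<beta>U * U i \<omega> + \<epsilon>X i \<omega>"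
    and \<delta>2: "\<And>i \<omega>. \<delta>2 i \<omega> = h (U i \<omega>) + \<epsilon>Y i \<omega>"
    and X: "\<And>i \<omega>. X i \<omega> = \<beta>X0 + \<beta>Z \<bullet> Z i \<omega> + \<beta>C \<bullet> C i \<omega> + \<delta>1 i \<omega>"
    and Y: "\<And>i \<omega>. Y i \<omega> = \<beta>Y0 + (\<Sum>j\<in>UNIV. \<theta> $ j * f j (X i \<omega>))
          + (\<Sum>j\<in>UNIV. \<gamma> $ j * g j (C i \<omega>)) + \<delta>2 i \<omega>"
    and instrument: "\<beta>Z \<noteq> 0"
    and lin_indep: "linearly_independent_rv M (\<lambda>\<omega>. (1::real, \<chi> j. f j (X 0 \<omega>)))"
          "linearly_independent_rv M (\<lambda>\<omega>. (1::real, \<chi> j. g j (C 0 \<omega>)))"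
          "linearly_independent_rv M (\<lambda>\<omega>. (1::real, Z 0 \<omega>))"
          "linearly_independent_rv M (\<lambda>\<omega>. (1::real, C 0 \<omega>))"
    and order_condition:
          "CARD('k1) + card {j. linear_function (g j)} \<le> CARD('n1) + CARD('n2)"
    and g_linear: "\<And>j. linear_function (g j)"
    and error_decomposition: "\<And>i \<omega>. \<delta>2 i \<omega> = \<rho> * \<delta>1 i \<omega> + e i \<omega>"
          "prob_space.indep_var M borel (\<delta>1 0) borel (e 0)"
  shows
    \<comment> \<open>linear effect: equality for every sample of every size\<close>
    "((\<forall>j. linear_function (f j)) \<longrightarrow>
        (\<forall>n. \<forall>\<omega>\<in>space M. \<forall>b.
           two_stage_estimate f g n (\<lambda>i. Z i \<omega>) (\<lambda>i. C i \<omega>) (\<lambda>i. X i \<omega>) (\<lambda>i. Y i \<omega>) b \<longleftrightarrow>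
           (\<exists>r. control_function_estimate f g n
                  (\<lambda>i. Z i \<omega>) (\<lambda>i. C i \<omega>) (\<lambda>i. X i \<omega>) (\<lambda>i. Y i \<omega>) b r)))
     \<and>
     \<comment> \<open>nonlinear effect, with finite second moments and the rank condition that makes
         the parameters identified: ordering of the asymptotic covariances. The mean of the outcome
         error is not separable from the intercept; if it is zero, the target is
         \<open>(\<beta>Y0, \<theta>, \<gamma>)\<close>\<close>
     ((\<exists>j. \<not> (\<exists>a b. AE \<omega> in M. f j (X 0 \<omega>) = a + b * X 0 \<omega>)) \<and>
      integrable M (\<lambda>\<omega>. (norm (Z 0 \<omega>))\<^sup>2) \<and> integrable M (\<lambda>\<omega>. (norm (C 0 \<omega>))\<^sup>2) \<and>
      integrable M (\<lambda>\<omega>. (X 0 \<omega>)\<^sup>2) \<and> integrable M (\<lambda>\<omega>. (Y 0 \<omega>)\<^sup>2) \<and>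
      (\<forall>j. integrable M (\<lambda>\<omega>. (f j (X 0 \<omega>))\<^sup>2)) \<and>
      (\<forall>b::real \<times> (real^'k1) \<times> (real^'k2).
         (\<integral>\<omega>. (b \<bullet> (1, \<chi> j. f j (X 0 \<omega>), \<chi> j. g j (C 0 \<omega>))) *\<^sub>R (1::real, Z 0 \<omega>, C 0 \<omega>) \<partial>M) = 0
         \<longrightarrow> b = 0)
      \<longrightarrow>
        (\<exists>V_TS V_CF.
           asymptotic_covariance M
             (\<lambda>n \<omega> b. two_stage_estimate f g n
                (\<lambda>i. Z i \<omega>) (\<lambda>i. C i \<omega>) (\<lambda>i. X i \<omega>) (\<lambda>i. Y i \<omega>) b)
             (\<beta>Y0 + prob_space.expectation M (\<delta>2 0), \<theta>, \<gamma>) V_TS \<and>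
           asymptotic_covariance M
             (\<lambda>n \<omega> b. \<exists>r. control_function_estimate f g n
                (\<lambda>i. Z i \<omega>) (\<lambda>i. C i \<omega>) (\<lambda>i. X i \<omega>) (\<lambda>i. Y i \<omega>) b r)
             (\<beta>Y0 + prob_space.expectation M (\<delta>2 0), \<theta>, \<gamma>) V_CF \<and>
           (\<forall>d. d \<bullet> V_CF d \<le> d \<bullet> V_TS d) \<and>
           \<comment> \<open>strictness: nondegenerate outcome error, and either first-stage errors charging every
               set of positive length or some \<open>f j (X)\<close> not linear in \<open>(Z, C, X)\<close>\<close>
           (prob_space.variance M (\<delta>2 0) > 0 \<and>
            (absolutely_continuous (distr M lborel (\<delta>1 0)) lborel \<or>
             (\<exists>j. \<not> (\<exists>a b. AE \<omega> in M. f j (X 0 \<omega>) = a \<bullet> (1::real, Z 0 \<omega>, C 0 \<omega>) + b * X 0 \<omega>)))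
            \<longrightarrow> V_CF \<noteq> V_TS)))"
proof (intro conjI impI, goal_cases)
  case 1
  then show ?case using linear_effect_estimates_coincide g_linear by blast
next
  case regular: 2
  interpret prob_space M by (rule prob)
  note [measurable] = measurable
  define \<zeta> where "\<zeta> i \<omega> = (Z i \<omega>, C i \<omega>, U i \<omega>, \<epsilon>X i \<omega>, \<epsilon>Y i \<omega>)" for i \<omega>
  have iid_\<zeta>: "iid M \<zeta>"
    using sample_indep sample_ident unfolding iid_def \<zeta>_def[abs_def] by blast
  have proj [measurable]:
    "(\<lambda>t. fst t) \<in> borel_measurable (borel :: ((real^'n1) \<times> (real^'n2) \<times> real \<times> real \<times> real) measure)"
    "(\<lambda>t. fst (snd t)) \<in> borel_measurable (borel :: ((real^'n1) \<times> (real^'n2) \<times> real \<times> real \<times> real) measure)"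
    "(\<lambda>t. fst (snd (snd t))) \<in> borel_measurable (borel :: ((real^'n1) \<times> (real^'n2) \<times> real \<times> real \<times> real) measure)"
    "(\<lambda>t. fst (snd (snd (snd t)))) \<in> borel_measurable (borel :: ((real^'n1) \<times> (real^'n2) \<times> real \<times> real \<times> real) measure)"
    "(\<lambda>t. snd (snd (snd (snd t)))) \<in> borel_measurable (borel :: ((real^'n1) \<times> (real^'n2) \<times> real \<times> real \<times> real) measure)"
    by (intro borel_measurable_continuous_onI continuous_intros)+
  have [measurable]: "Z i \<in> borel_measurable M" "C i \<in> borel_measurable M" "U i \<in> borel_measurable M"
    "\<epsilon>X i \<in> borel_measurable M" "\<epsilon>Y i \<in> borel_measurable M" for i
    using proj[THEN measurable_compose[OF iid_measurable[OF iid_\<zeta>, of i]]] by (simp_all add: \<zeta>_def)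
  have e: "e i \<omega> = \<delta>2 i \<omega> - \<rho> * \<delta>1 i \<omega>" for i \<omega>
    using error_decomposition(1)[of i \<omega>] by simp
  have [measurable]: "\<delta>1 i \<in> borel_measurable M" "\<delta>2 i \<in> borel_measurable M" "X i \<in> borel_measurable M"
    "e i \<in> borel_measurable M" for i
    unfolding \<delta>1[abs_def] \<delta>2[abs_def] X[abs_def] e[abs_def] by measurable
  define W where "W i \<omega> = (1::real, Z i \<omega>, C i \<omega>)" for i \<omega>
  define D where "D i \<omega> = (1::real, (\<chi> j. f j (X i \<omega>)), (\<chi> j. g j (C i \<omega>)))" for i \<omega>
  \<comment> \<open>The errors \<open>\<delta>1\<close> and \<open>e\<close> are centred; their
    means move into the intercepts of \<open>\<alpha>\<close> and \<open>\<beta>\<close>, which is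
    why the target contains the mean of \<open>\<delta>2\<close>.\<close>
  define v where "v i \<omega> = \<delta>1 i \<omega> - expectation (\<delta>1 0)" for i \<omega>
  define \<epsilon> where "\<epsilon> i \<omega> = e i \<omega> - expectation (e 0)" for i \<omega>
  define \<alpha> where "\<alpha> = (\<beta>X0 + expectation (\<delta>1 0), \<beta>Z, \<beta>C)"
  define \<beta> where "\<beta> = (\<beta>Y0 + expectation (\<delta>2 0), \<theta>, \<gamma>)"
  have X_eq: "X i \<omega> = \<alpha> \<bullet> W i \<omega> + v i \<omega>" for i \<omega>
    by (simp add: X \<alpha>_def W_def v_def)
  have [measurable]: "W i \<in> borel_measurable M" "D i \<in> borel_measurable M" for i
    unfolding W_def[abs_def] D_def[abs_def]
    by (intro borel_measurable_Pair borel_measurable_vec_lambda; measurable)+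
  have sq_W: "integrable M (\<lambda>\<omega>. (norm (W 0 \<omega>))\<^sup>2)"
    using regular by (simp add: W_def norm_Pair)
  have sq_D: "integrable M (\<lambda>\<omega>. (norm (D 0 \<omega>))\<^sup>2)"
  proof -
    have "integrable M (\<lambda>\<omega>. (g j (C 0 \<omega>))\<^sup>2)" for j
    proof -
      obtain a b where "\<And>t. g j t = a + b \<bullet> t" using g_linear[of j] unfolding linear_function_def by blast
      then show ?thesis
        using square_integrable_inner[OF _ sq_W, of "(a, 0, b)"] by (simp add: W_def)
    qed
    then show ?thesis
      using regular by (simp add: D_def norm_Pair integrable_norm_sq_vec_lambda)
  qed
  \<comment> \<open>Second moments of the unobserved errors are recovered from the observables:
    \<open>\<delta>1\<close> is a fixed linear combination of \<open>X\<close> and \<open>W\<close>,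
    and \<open>\<delta>2\<close> below one of \<open>Y\<close> and \<open>D\<close>.\<close>
  have sq_\<delta>1: "integrable M (\<lambda>\<omega>. (\<delta>1 0 \<omega>)\<^sup>2)"
    using square_integrable_inner[of "\<lambda>\<omega>. (X 0 \<omega>, W 0 \<omega>)" M "(1, - (\<beta>X0, \<beta>Z, \<beta>C))"] regular sq_W
    by (simp add: norm_Pair X W_def)
  have sq_\<delta>2: "integrable M (\<lambda>\<omega>. (\<delta>2 0 \<omega>)\<^sup>2)"
  proof -
    have Y_eq: "Y 0 \<omega> = (\<beta>Y0, \<theta>, \<gamma>) \<bullet> D 0 \<omega> + \<delta>2 0 \<omega>" for \<omega>
      by (simp add: Y D_def inner_vec_def)
    then have [measurable]: "Y 0 \<in> borel_measurable M" by (simp add: Y_eq[abs_def])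
    have "integrable M (\<lambda>\<omega>. ((1, - (\<beta>Y0, \<theta>, \<gamma>)) \<bullet> (Y 0 \<omega>, D 0 \<omega>))\<^sup>2)"
      using regular sq_D by (intro square_integrable_inner) (simp_all add: norm_Pair)
    moreover have "(1, - (\<beta>Y0, \<theta>, \<gamma>)) \<bullet> (Y 0 \<omega>, D 0 \<omega>) = \<delta>2 0 \<omega>" for \<omega>
      unfolding inner_Pair inner_minus_left Y_eq by simp
    ultimately show ?thesis by simp
  qed
  have sq_v: "integrable M (\<lambda>\<omega>. (v 0 \<omega>)\<^sup>2)"
    using square_integrable_inner[of "\<lambda>\<omega>. (\<delta>1 0 \<omega>, 1::real)" M "(1, - expectation (\<delta>1 0))"] sq_\<delta>1
    by (simp add: norm_Pair v_def)
  have sq_e: "integrable M (\<lambda>\<omega>. (e 0 \<omega>)\<^sup>2)"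
    using square_integrable_inner[of "\<lambda>\<omega>. (\<delta>2 0 \<omega>, \<delta>1 0 \<omega>)" M "(1, - \<rho>)"] sq_\<delta>1 sq_\<delta>2
    by (simp add: norm_Pair e)
  have sq_\<epsilon>: "integrable M (\<lambda>\<omega>. (\<epsilon> 0 \<omega>)\<^sup>2)"
    using square_integrable_inner[of "\<lambda>\<omega>. (e 0 \<omega>, 1::real)" M "(1, - expectation (e 0))"] sq_e
    by (simp add: norm_Pair \<epsilon>_def)
  have int: "integrable M (\<delta>1 0)" "integrable M (\<delta>2 0)" "integrable M (e 0)"
    using sq_\<delta>1 sq_\<delta>2 sq_e by (auto intro: square_integrable_imp_integrable)
  have mean_\<delta>2: "expectation (\<delta>2 0) = \<rho> * expectation (\<delta>1 0) + expectation (e 0)"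
    unfolding error_decomposition(1)[of 0, abs_def] using int by simp
  have \<delta>2_eq: "\<delta>2 i \<omega> - expectation (\<delta>2 0) = \<rho> * v i \<omega> + \<epsilon> i \<omega>" for i \<omega>
    unfolding mean_\<delta>2 v_def \<epsilon>_def e by (simp add: algebra_simps)
  have Y_eq: "Y i \<omega> = \<beta> \<bullet> D i \<omega> + (\<rho> * v i \<omega> + \<epsilon> i \<omega>)" for i \<omega>
    unfolding \<delta>2_eq[symmetric] by (simp add: Y \<beta>_def D_def inner_vec_def)
  \<comment> \<open>The joint product law is peeled factor by factor; afterwards
    \<open>(Z, C)\<close> is regrouped against the unobserved variables.\<close>
  have ZC: "indep_rv M (Z 0) (\<lambda>\<omega>. (C 0 \<omega>, U 0 \<omega>, \<epsilon>X 0 \<omega>, \<epsilon>Y 0 \<omega>))"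
    and law: "distr M borel (\<lambda>\<omega>. (C 0 \<omega>, U 0 \<omega>, \<epsilon>X 0 \<omega>, \<epsilon>Y 0 \<omega>)) =
      distr M borel (C 0) \<Otimes>\<^sub>M (distr M borel (U 0) \<Otimes>\<^sub>M (distr M borel (\<epsilon>X 0) \<Otimes>\<^sub>M distr M borel (\<epsilon>Y 0)))"
    by (rule indep_rv_from_product[OF _ _ mutual_indep];
      (intro prob_space_pair prob_space_distr)?; simp add: borel_prod[symmetric] cong: sets_pair_measure_cong)+
  have CU: "indep_rv M (C 0) (\<lambda>\<omega>. (U 0 \<omega>, \<epsilon>X 0 \<omega>, \<epsilon>Y 0 \<omega>))"
    by (rule indep_rv_from_product(1)[OF _ _ law];
      (intro prob_space_pair prob_space_distr)?; simp add: borel_prod[symmetric] cong: sets_pair_measure_cong)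
  have "indep_rv M (\<lambda>\<omega>. (Z 0 \<omega>, C 0 \<omega>)) (\<lambda>\<omega>. (U 0 \<omega>, \<epsilon>X 0 \<omega>, \<epsilon>Y 0 \<omega>))"
    by (rule indep_rv_assoc[OF ZC CU])
  from indep_rv_compose[OF this, of "\<lambda>p. (1::real, fst p, snd p)" "\<lambda>q. (\<beta>U * fst q + fst (snd q) - expectation (\<delta>1 0),
      h (fst q) + snd (snd q) - \<rho> * (\<beta>U * fst q + fst (snd q)) - expectation (e 0))"]
  have indep_W: "indep_rv M (W 0) (\<lambda>\<omega>. (v 0 \<omega>, \<epsilon> 0 \<omega>))"
    by (simp add: W_def[abs_def] v_def \<epsilon>_def e \<delta>1 \<delta>2 borel_prod[symmetric])
  have "indep_rv M (\<delta>1 0) (e 0)" using error_decomposition(2) by (simp add: indep_rv_iff_indep_var)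
  from indep_rv_compose[OF this, of "\<lambda>x. x - expectation (\<delta>1 0)" "\<lambda>x. x - expectation (e 0)"]
  have "indep_rv M (v 0) (\<epsilon> 0)" by (simp add: v_def[abs_def] \<epsilon>_def[abs_def])
  \<comment> \<open>Independence of \<open>W\<close> from \<open>(v, \<epsilon>)\<close> and of
    \<open>v\<close> from \<open>\<epsilon>\<close> frees \<open>\<epsilon>\<close> from the pair
    \<open>(W, v)\<close>, of which \<open>D\<close> is a function since
    \<open>X = \<alpha> \<bullet> W + v\<close>.\<close>
  then have Wv: "indep_rv M (\<lambda>\<omega>. (W 0 \<omega>, v 0 \<omega>)) (\<epsilon> 0)"
    by (rule indep_rv_assoc[OF indep_W])
  have indep_\<epsilon>: "indep_rv M (\<lambda>\<omega>. (W 0 \<omega>, D 0 \<omega>, v 0 \<omega>)) (\<epsilon> 0)"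
  proof -
    define H where "H p = (fst p, (1::real, (\<chi> j. f j (\<alpha> \<bullet> fst p + snd p)), (\<chi> j. g j (snd (snd (fst p))))), snd p)"
      for p :: "(real \<times> (real^'n1) \<times> (real^'n2)) \<times> real"
    have [measurable]: "(\<lambda>p. fst p) \<in> borel_measurable (borel :: ((real \<times> (real^'n1) \<times> (real^'n2)) \<times> real) measure)"
      "(\<lambda>p. snd p) \<in> borel_measurable (borel :: ((real \<times> (real^'n1) \<times> (real^'n2)) \<times> real) measure)"
      "(\<lambda>p. snd (snd (fst p))) \<in> borel_measurable (borel :: ((real \<times> (real^'n1) \<times> (real^'n2)) \<times> real) measure)"
      "(\<lambda>p. \<alpha> \<bullet> fst p + snd p) \<in> borel_measurable (borel :: ((real \<times> (real^'n1) \<times> (real^'n2)) \<times> real) measure)"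
      by (intro borel_measurable_continuous_onI continuous_intros)+
    have "H \<in> borel_measurable borel"
      unfolding H_def by (intro borel_measurable_Pair borel_measurable_vec_lambda; measurable)
    moreover have "H (W 0 \<omega>, v 0 \<omega>) = (W 0 \<omega>, D 0 \<omega>, v 0 \<omega>)" for \<omega>
      unfolding H_def fst_conv snd_conv X_eq[symmetric] by (simp add: D_def W_def)
    ultimately show ?thesis
      using indep_rv_compose[OF Wv, of H "\<lambda>x. x"] by simp
  qed
  have iid_all: "iid M (\<lambda>i \<omega>. (W i \<omega>, D i \<omega>, v i \<omega>, \<epsilon> i \<omega>))"
  proof -
    define d1 where "d1 t = \<beta>U * fst (snd (snd t)) + fst (snd (snd (snd t)))"
      for t :: "(real^'n1) \<times> (real^'n2) \<times> real \<times> real \<times> real"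
    define d2 where "d2 t = h (fst (snd (snd t))) + snd (snd (snd (snd t)))"
      for t :: "(real^'n1) \<times> (real^'n2) \<times> real \<times> real \<times> real"
    define x where "x t = \<beta>X0 + \<beta>Z \<bullet> fst t + \<beta>C \<bullet> fst (snd t) + d1 t"
      for t :: "(real^'n1) \<times> (real^'n2) \<times> real \<times> real \<times> real"
    define F where "F t = ((1::real, fst t, fst (snd t)),
        (1::real, (\<chi> j. f j (x t)), (\<chi> j. g j (fst (snd t)))),
        d1 t - expectation (\<delta>1 0), d2 t - \<rho> * d1 t - expectation (e 0))" for t
    have [measurable]: "d1 \<in> borel_measurable borel" "d2 \<in> borel_measurable borel" "x \<in> borel_measurable borel"
      unfolding d1_def[abs_def] d2_def[abs_def] x_def[abs_def] by measurable
    have "F \<in> borel_measurable borel"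
      unfolding F_def by (intro borel_measurable_Pair borel_measurable_vec_lambda; measurable)
    moreover have "F (\<zeta> i \<omega>) = (W i \<omega>, D i \<omega>, v i \<omega>, \<epsilon> i \<omega>)" for i \<omega>
      by (simp add: F_def \<zeta>_def W_def D_def v_def \<epsilon>_def e d1_def d2_def x_def X \<delta>1 \<delta>2)
    ultimately show ?thesis using iid_compose[OF iid_\<zeta>, of F] by simp
  qed
  have lin_indep_W: "linearly_independent_rv M (W 0)"
  proof -
    have "indep_rv M (Z 0) (C 0)"
      using indep_rv_compose[OF ZC, of "\<lambda>z. z" fst] by (simp add: borel_prod[symmetric])
    then show ?thesis
      unfolding W_def[abs_def] by (rule linearly_independent_rv_indep_pair) (rule lin_indep)+
  qed
  interpret endogenous_regression M W D v \<epsilon> \<rho>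
  proof
    show "expectation (v 0) = 0" "expectation (\<epsilon> 0) = 0"
      using int by (simp_all add: v_def[abs_def] \<epsilon>_def[abs_def] prob_space)
    show "a = 0" if "AE \<omega> in M. a \<bullet> W 0 \<omega> = 0" for a
      using lin_indep_W that unfolding linearly_independent_rv_def by blast
    fix b assume zero: "\<And>m. expectation (\<lambda>\<omega>. (m \<bullet> W 0 \<omega>) * (b \<bullet> D 0 \<omega>)) = 0"
    have D_sq: "integrable M (\<lambda>\<omega>. (b \<bullet> D 0 \<omega>)\<^sup>2)" by (rule square_integrable_inner[OF _ sq_D]) simp
    have "integrable M (\<lambda>\<omega>. (b \<bullet> D 0 \<omega>) *\<^sub>R W 0 \<omega>)"
    proof (rule Bochner_Integration.integrable_bound)
      show "integrable M (\<lambda>\<omega>. (b \<bullet> D 0 \<omega>) * norm (W 0 \<omega>))"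
        using D_sq sq_W by (intro square_integrable_mult) simp_all
    qed (simp_all add: abs_mult)
    then have "m \<bullet> (\<integral>\<omega>. (b \<bullet> D 0 \<omega>) *\<^sub>R W 0 \<omega> \<partial>M) = expectation (\<lambda>\<omega>. m \<bullet> ((b \<bullet> D 0 \<omega>) *\<^sub>R W 0 \<omega>))" for m
      by (rule integral_inner_right[symmetric])
    then have "m \<bullet> (\<integral>\<omega>. (b \<bullet> D 0 \<omega>) *\<^sub>R W 0 \<omega> \<partial>M) = 0" for m
      using zero[of m] by (simp add: mult.commute)
    then have "(\<integral>\<omega>. (b \<bullet> D 0 \<omega>) *\<^sub>R W 0 \<omega> \<partial>M) = 0" using inner_eq_zero_iff by blast
    then show "b = 0" using regular unfolding W_def D_def by blast
  qed (fact iid_all sq_W sq_D sq_v sq_\<epsilon> indep_W indep_\<epsilon>)+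
  obtain V_TS V_CF where
    TS: "asymptotic_covariance M (\<lambda>n \<omega>. two_stage_coefficients n (\<lambda>i. W i \<omega>) (\<lambda>i. D i \<omega>)
      (\<lambda>i. \<beta> \<bullet> D i \<omega> + (\<rho> * v i \<omega> + \<epsilon> i \<omega>))) \<beta> V_TS" and
    CF: "asymptotic_covariance M (\<lambda>n \<omega> b. \<exists>r. control_function_coefficients n (\<lambda>i. W i \<omega>) (\<lambda>i. D i \<omega>)
      (\<lambda>i. \<alpha> \<bullet> W i \<omega> + v i \<omega>) (\<lambda>i. \<beta> \<bullet> D i \<omega> + (\<rho> * v i \<omega> + \<epsilon> i \<omega>)) b r) \<beta> V_CF" and
    le: "\<And>d. d \<bullet> V_CF d \<le> d \<bullet> V_TS d" and
    strict: "\<And>c. V_CF = V_TS \<Longrightarrow> expectation (\<lambda>\<omega>. (\<rho> * v 0 \<omega> + \<epsilon> 0 \<omega>)\<^sup>2) > 0 \<Longrightarrow>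
      \<exists>m q. AE \<omega> in M. c \<bullet> D 0 \<omega> = m \<bullet> W 0 \<omega> + q * v 0 \<omega>"
    using control_function_at_least_as_efficient[of \<beta> \<alpha>] by blast
  show ?case
    unfolding \<beta>_def[symmetric]
  proof (rule exI[of _ V_TS], rule exI[of _ V_CF], intro conjI allI impI le)
    show "asymptotic_covariance M
       (\<lambda>n \<omega> b. two_stage_estimate f g n
          (\<lambda>i. Z i \<omega>) (\<lambda>i. C i \<omega>) (\<lambda>i. X i \<omega>) (\<lambda>i. Y i \<omega>) b) \<beta> V_TS"
    proof (rule asymptotic_covariance_mono[OF TS])
      fix n \<omega> b
      assume "two_stage_estimate f g n (\<lambda>i. Z i \<omega>) (\<lambda>i. C i \<omega>) (\<lambda>i. X i \<omega>) (\<lambda>i. Y i \<omega>) b"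
      then show "two_stage_coefficients n (\<lambda>i. W i \<omega>) (\<lambda>i. D i \<omega>)
          (\<lambda>i. \<beta> \<bullet> D i \<omega> + (\<rho> * v i \<omega> + \<epsilon> i \<omega>)) b"
        unfolding Y_eq[symmetric] unfolding W_def D_def
        by (rule two_stage_estimate_imp_coefficients[where g = g, OF g_linear])
    qed
    show "asymptotic_covariance M
       (\<lambda>n \<omega> b. \<exists>r. control_function_estimate f g n
          (\<lambda>i. Z i \<omega>) (\<lambda>i. C i \<omega>) (\<lambda>i. X i \<omega>) (\<lambda>i. Y i \<omega>) b r) \<beta> V_CF"
    proof (rule asymptotic_covariance_mono[OF CF])
      fix n \<omega> b
      assume "\<exists>r. control_function_estimate f g n (\<lambda>i. Z i \<omega>) (\<lambda>i. C i \<omega>) (\<lambda>i. X i \<omega>) (\<lambda>i. Y i \<omega>) b r"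
      then show "\<exists>r. control_function_coefficients n (\<lambda>i. W i \<omega>) (\<lambda>i. D i \<omega>)
          (\<lambda>i. \<alpha> \<bullet> W i \<omega> + v i \<omega>) (\<lambda>i. \<beta> \<bullet> D i \<omega> + (\<rho> * v i \<omega> + \<epsilon> i \<omega>)) b r"
        unfolding control_function_estimate_eq_coefficients Y_eq[symmetric] X_eq[symmetric]
        unfolding W_def D_def .
    qed
    assume hyp: "variance (\<delta>2 0) > 0 \<and>
      (absolutely_continuous (distr M lborel (\<delta>1 0)) lborel \<or>
       (\<exists>j. \<not> (\<exists>a b. AE \<omega> in M. f j (X 0 \<omega>) = a \<bullet> (1::real, Z 0 \<omega>, C 0 \<omega>) + b * X 0 \<omega>)))"
    show "V_CF \<noteq> V_TS"
    proof
      assume eq: "V_CF = V_TS"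
      have pos: "expectation (\<lambda>\<omega>. (\<rho> * v 0 \<omega> + \<epsilon> 0 \<omega>)\<^sup>2) > 0"
        using hyp unfolding \<delta>2_eq by blast
      have linear: "\<exists>a b. AE \<omega> in M. f j (X 0 \<omega>) = a \<bullet> W 0 \<omega> + b * X 0 \<omega>" for j
      proof -
        \<comment> \<open>The unit vector selects \<open>f j (X)\<close>; substituting
          \<open>v = X - \<alpha> \<bullet> W\<close> then trades \<open>v\<close> for
          \<open>X\<close>.\<close>
        obtain m q where "AE \<omega> in M. (0, axis j 1, 0) \<bullet> D 0 \<omega> = m \<bullet> W 0 \<omega> + q * v 0 \<omega>"
          using strict[OF eq pos] by blast
        then have "AE \<omega> in M. f j (X 0 \<omega>) = (m - q *\<^sub>R \<alpha>) \<bullet> W 0 \<omega> + q * X 0 \<omega>"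
          by eventually_elim
            (simp add: D_def inner_axis' inner_diff_left X_eq[of 0] algebra_simps)
        then show ?thesis by blast
      qed
      from hyp show False
      proof (elim conjE disjE)
        assume ac: "absolutely_continuous (distr M lborel (\<delta>1 0)) lborel"
        obtain j where j: "\<not> (\<exists>a b. AE \<omega> in M. f j (X 0 \<omega>) = a + b * X 0 \<omega>)" using regular by blast
        obtain a b where ab: "AE \<omega> in M. f j (X 0 \<omega>) = a \<bullet> W 0 \<omega> + b * X 0 \<omega>" using linear by blast
        have X': "X 0 \<omega> = (\<beta>X0, \<beta>Z, \<beta>C) \<bullet> W 0 \<omega> + \<delta>1 0 \<omega>" for \<omega>
          by (simp add: X W_def)
        have "indep_rv M (W 0) (\<delta>1 0)"
          using indep_rv_compose[OF indep_W, of "\<lambda>w. w" "\<lambda>p. fst p + expectation (\<delta>1 0)"]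
          by (simp add: v_def borel_prod[symmetric])
        \<comment> \<open>Evaluated at \<open>X\<close>, the function \<open>f j x - b * x\<close>
          depends on \<open>W\<close> alone, while \<open>X\<close> is a function of
          \<open>W\<close> shifted by the independent \<open>\<delta>1\<close>; so it must be
          constant.\<close>
        moreover have "AE \<omega> in M. f j (X 0 \<omega>) - b * X 0 \<omega> = a \<bullet> W 0 \<omega>"
          using ab by eventually_elim simp
        ultimately obtain k where "AE \<omega> in M. f j (X 0 \<omega>) - b * X 0 \<omega> = k"
          using constant_if_determined_by_shift[OF _ ac, of "W 0" "\<lambda>x. f j x - b * x"
            "\<lambda>w. (\<beta>X0, \<beta>Z, \<beta>C) \<bullet> w" "\<lambda>w. a \<bullet> w", folded X'] by auto
        then have "AE \<omega> in M. f j (X 0 \<omega>) = k + b * X 0 \<omega>" by eventually_elim simp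
        with j show False by blast
      next
        assume "\<exists>j. \<not> (\<exists>a b. AE \<omega> in M. f j (X 0 \<omega>) = a \<bullet> (1::real, Z 0 \<omega>, C 0 \<omega>) + b * X 0 \<omega>)"
        with linear show False unfolding W_def by blast
      qed
    qed
  qed
qed

end
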